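(* For every connected non-bipartite graph $H$, there is some constant $C = C_H > 0$ such that, for every $0 < \epsilon < 1$, $$e^{\epsilon N_{H}(C \epsilon)/C} \le M_H(\epsilon) \le e^{C\delta_H(\epsilon/C)^{-2}}.$$
   Context: All graphs are finite and simple. A graph $G$ is $H$-homomorphism-free if there is no graph homomorphism from $H$ to $G$. A homomorphic copy of $H$ in $G$ is a subgraph of $G$ that is the image of a homomorphism from $H$ to $G$ (the image consisting of the images of the vertices and of the edges of $H$). The core of $H$, denoted $\mathrm{core}(H)$, is the smallest subgraph of $H$ that can arise as the image of a homomorphism from $H$ to $H$; it is unique up to isomorphism. Given graphs $G$ and $F$, a map $\phi \colon V(G) \to V(F)$ is an $\epsilon$-approximate homomorphism if at most $\epsilon |V(G)|^2$ edges of $G$ do not map to edges of $F$ under $\phi$. For a connected non-bipartite graph $H$ and $\epsilon>0$, define the following (all exist by standard removal-lemma results): - $\delta_H(\epsilon)$ is the largest $\delta>0$ such that every $n$-vertex graph with fewer than $\delta n^{|V(H)|}$ homomorphic copies of $H$ can be made $H$-homomorphism-free by removing at most $\epsilon n^2$ edges. - $M_H(\epsilon)$ is the smallest integer $M$ such that every $H$-homomorphism-free graph has an $\epsilon$-approximate homomorphism to an $H$-homomorphism-free graph on at most $M$ vertices. - $N_H(\epsilon)$ is the smallest nonnegative integer $N$ such that for every $n$-vertex graph $G$ with $n \ge N$, if every edge of $G$ lies in a unique homomorphic copy of $\mathrm{core}(H)$, then $G$ has at most $\epsilon n^2$ edges. *)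

theory Defs
  imports Complex_Main
begin

record 'a graph =
  verts :: "'a set"
  edges :: "'a set set"

definition simple_graph :: "'a graph \<Rightarrow> bool" where
  "simple_graph G \<longleftrightarrow>
     finite (verts G) \<and> (\<forall>e \<in> edges G. e \<subseteq> verts G \<and> card e = 2)"

definition connected_graph :: "'a graph \<Rightarrow> bool" where
  "connected_graph G \<longleftrightarrow> verts G \<noteq> {} \<and>
     (\<forall>u \<in> verts G. \<forall>v \<in> verts G. (u, v) \<in> {(x, y). {x, y} \<in> edges G}\<^sup>*)"

definition bipartite :: "'a graph \<Rightarrow> bool" where
  "bipartite G \<longleftrightarrow> (\<exists>A B. A \<union> B = verts G \<and> A \<inter> B = {} \<and>
     (\<forall>e \<in> edges G. \<exists>a \<in> A. \<exists>b \<in> B. e = {a, b}))"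

text \<open>In a simple graph every edge has exactly two endpoints, so the condition
  \<open>\<phi> ` e \<in> edges G\<close> also forces \<open>\<phi>\<close> to be injective on \<open>e\<close>.\<close>

definition is_hom :: "('a \<Rightarrow> 'b) \<Rightarrow> 'a graph \<Rightarrow> 'b graph \<Rightarrow> bool" where
  "is_hom \<phi> H G \<longleftrightarrow> \<phi> ` verts H \<subseteq> verts G \<and> (\<forall>e \<in> edges H. \<phi> ` e \<in> edges G)"

definition hom_free :: "'a graph \<Rightarrow> 'b graph \<Rightarrow> bool" where
  "hom_free H G \<longleftrightarrow> \<not> (\<exists>\<phi>. is_hom \<phi> H G)"

definition hom_image :: "('a \<Rightarrow> 'b) \<Rightarrow> 'a graph \<Rightarrow> 'b graph" where
  "hom_image \<phi> H = \<lparr>verts = \<phi> ` verts H, edges = (\<lambda>e. \<phi> ` e) ` edges H\<rparr>"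

text \<open>Homomorphic copies are counted as subgraphs of \<open>G\<close>: homomorphisms with the same image
  yield one copy.\<close>

definition hom_copies :: "'a graph \<Rightarrow> 'b graph \<Rightarrow> 'b graph set" where
  "hom_copies H G = {hom_image \<phi> H | \<phi>. is_hom \<phi> H G}"

text \<open>Smallest is required both for the number of vertices and for the number of edges; the
  two minima are attained together, since the core embeds in every endomorphic image of \<open>H\<close>.
  The core is only unique up to isomorphism, hence the choice operator.\<close>

definition is_core :: "'a graph \<Rightarrow> 'a graph \<Rightarrow> bool" where
  "is_core K H \<longleftrightarrow> K \<in> hom_copies H H \<and>
     (\<forall>K' \<in> hom_copies H H. card (verts K) \<le> card (verts K') \<and> card (edges K) \<le> card (edges K'))"

definition core :: "'a graph \<Rightarrow> 'a graph" where
  "core H = (SOME K. is_core K H)"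

definition remove_edges :: "'a graph \<Rightarrow> 'a set set \<Rightarrow> 'a graph" where
  "remove_edges G R = \<lparr>verts = verts G, edges = edges G - R\<rparr>"

definition approx_hom :: "real \<Rightarrow> ('a \<Rightarrow> 'b) \<Rightarrow> 'a graph \<Rightarrow> 'b graph \<Rightarrow> bool" where
  "approx_hom \<epsilon> \<phi> G F \<longleftrightarrow> \<phi> ` verts G \<subseteq> verts F \<and>
     real (card {e \<in> edges G. \<phi> ` e \<notin> edges F}) \<le> \<epsilon> * real (card (verts G)) ^ 2"

text \<open>The graphs \<open>G\<close> and \<open>F\<close> below have vertices of type \<open>nat\<close>, which covers all finite graphs
  up to isomorphism. For \<open>\<epsilon> \<ge> 1/2\<close> every \<open>\<delta>\<close> qualifies in \<open>delta_fun\<close>, because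
  all edges may be removed; then there is no largest \<open>\<delta>\<close> and the value is unspecified.
  A largest \<open>\<delta>\<close> exists for all sufficiently small \<open>\<epsilon> > 0\<close>, depending on \<open>H\<close>.\<close>

definition delta_fun :: "'a graph \<Rightarrow> real \<Rightarrow> real" where
  "delta_fun H \<epsilon> = (GREATEST \<delta>. \<delta> > 0 \<and>
     (\<forall>G :: nat graph. simple_graph G \<and>
        real (card (hom_copies H G)) < \<delta> * real (card (verts G)) ^ card (verts H) \<longrightarrow>
        (\<exists>R \<subseteq> edges G. real (card R) \<le> \<epsilon> * real (card (verts G)) ^ 2 \<and>
           hom_free H (remove_edges G R))))"

definition M_fun :: "'a graph \<Rightarrow> real \<Rightarrow> nat" where
  "M_fun H \<epsilon> = (LEAST M.
     \<forall>G :: nat graph. simple_graph G \<and> hom_free H G \<longrightarrow>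
       (\<exists>(F :: nat graph) \<phi>. simple_graph F \<and> hom_free H F \<and> card (verts F) \<le> M \<and>
          approx_hom \<epsilon> \<phi> G F))"

definition N_fun :: "'a graph \<Rightarrow> real \<Rightarrow> nat" where
  "N_fun H \<epsilon> = (LEAST N.
     \<forall>G :: nat graph. simple_graph G \<and> card (verts G) \<ge> N \<and>
       (\<forall>e \<in> edges G. \<exists>!K. K \<in> hom_copies (core H) G \<and> e \<in> edges K) \<longrightarrow>
       real (card (edges G)) \<le> \<epsilon> * real (card (verts G)) ^ 2)"

end

theory Submission
  imports Defs "HOL-Library.FuncSet"
begin

text \<open>
  Write \<open>h\<close> for the number of vertices of \<open>H\<close>. The lower bound on \<open>M\<close> relies on the upper bound
  only for the existence of a finite \<open>M\<close>.

  \<^bold>\<open>Upper bound on \<open>M\<close>.\<close>  Let \<open>G\<close> be \<open>H\<close>-homomorphism-free on \<open>n\<close> vertices. A finite family of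
  vertex sets (``cuts'') partitions the vertices into cells, and the energy of the family is the sum, over all pairs
  of vertices, of the squared edge density between their cells; it never exceeds \<open>n\<^sup>2\<close>. Suppose that the reduced graph, whose
  edges are the pairs of vertices in distinct cells of density at least \<open>\<epsilon>/4\<close>, contains at
  least \<open>\<delta> n\<^sup>h\<close> homomorphisms from \<open>H\<close>. Since \<open>G\<close> itself contains none, replacing densities by actual
  edges one edge of \<open>H\<close> at a time must go wrong somewhere, and the error at an edge \<open>ab\<close> is controlled by how much
  the density between the cells of \<open>a\<close> and \<open>b\<close> changes after cutting along the neighbourhoods of the images of the other
  vertices of \<open>H\<close> (\<open>counting_lemma\<close>). So the neighbourhoods of at most \<open>h\<close> vertices, used as
  additional cuts, raise the energy by \<open>\<delta> poly(\<epsilon>) n\<^sup>2\<close> (\<open>cell_tuples_le_energy_gain\<close>). After at most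
  \<open>1/(\<delta> poly(\<epsilon>))\<close> rounds, that is, with \<open>exp(1/(\<delta> poly(\<epsilon>)))\<close> cells, the reduced graph
  has fewer than \<open>\<delta> n\<^sup>h\<close> homomorphisms, and the removal property behind \<open>\<delta>\<close> destroys all of them at the cost of few
  edges. Picking one vertex of every cell at random turns the result into an \<open>H\<close>-homomorphism-free graph with one vertex per
  cell (\<open>approx_hom_of_removal\<close>). The polynomial in \<open>1/\<epsilon>\<close> is absorbed into a second factor
  \<open>1/\<delta>\<close>, because \<open>\<delta>\<close> is smaller than any fixed power of \<open>\<epsilon>\<close> up to a constant (\<open>removable_bound\<close>); this
  follows from a Ruzsa-Szemeredi type graph built from points on a paraboloid (\<open>exists_hard_graph\<close>).

  That \<open>\<delta>\<close> exists at all is the graph removal lemma (\<open>graph_removal_lemma\<close>), which is proved with the same counting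
  lemma: instead of a few cuts per round, all irregular pairs of cells are cut at once.

  \<^bold>\<open>Lower bound on \<open>M\<close>.\<close>  Let every edge of \<open>G\<close> lie in a unique copy of the core \<open>K\<close> of \<open>H\<close>, and let \<open>G\<close> have
  more than \<open>C \<epsilon> n\<^sup>2\<close> edges. Fix a vertex \<open>i0\<close> of \<open>K\<close> with two neighbours \<open>j0\<close> and \<open>j1\<close>. Blow up \<open>V(K) \<times> V(G)\<close>, giving
  every vertex one clone for each set \<open>s\<close> of copies of \<open>K\<close>; every copy \<open>T\<close> contributes its own edges, except that a
  clone in the role \<open>i0\<close> loses its edge towards \<open>j0\<close> or towards \<open>j1\<close>, according to whether \<open>T \<in> s\<close>. Since copies are
  unique, this destroys all homomorphisms from \<open>K\<close> (\<open>switch_blowup_hom_free\<close>). But when an approximate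
  homomorphism to an \<open>H\<close>-homomorphism-free graph \<open>F\<close> identifies two clones that disagree on \<open>T\<close>, all edges of \<open>T\<close>
  reappear in \<open>F\<close> unless one of them was among the lost ones. So for a suitable vertex \<open>w\<close> of \<open>G\<close> that lies in at least order \<open>\<epsilon> n\<close>
  copies, the clones of \<open>w\<close> in a common fibre nearly agree on these copies, and exponentially many fibres are needed
  (\<open>fibres_bound\<close>, \<open>lower_bound\<close>).
\<close>

section \<open>Averaging over one or two coordinates of a tuple\<close>

lemma sum_PiE_insert:
  fixes f :: "('i \<Rightarrow> 'v) \<Rightarrow> real"
  assumes "finite J" "a \<notin> J"
  shows "(\<Sum>x\<in>Pi\<^sub>E (insert a J) V. f x) = (\<Sum>y\<in>V a. \<Sum>x\<in>Pi\<^sub>E J V. f (x(a := y)))"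
proof -
  have "(\<Sum>x\<in>Pi\<^sub>E (insert a J) V. f x) = (\<Sum>(y,x)\<in>V a \<times> Pi\<^sub>E J V. f (x(a := y)))"
    unfolding PiE_insert_eq
    by (subst sum.reindex[OF inj_combinator[OF assms(2)]]) (simp add: case_prod_unfold)
  then show ?thesis by (simp add: sum.cartesian_product)
qed

lemma sum_PiE_resample:
  fixes f :: "('i \<Rightarrow> 'v) \<Rightarrow> real"
  assumes "finite I" "a \<in> I"
  shows "(\<Sum>x\<in>Pi\<^sub>E I V. \<Sum>y\<in>V a. f (x(a := y))) = card (V a) * (\<Sum>x\<in>Pi\<^sub>E I V. f x)"
proof -
  obtain J where J: "I = insert a J" "a \<notin> J" by (meson Set.set_insert assms(2))
  have fJ: "finite J" using J assms by auto
  show ?thesis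
    unfolding J(1) sum_PiE_insert[OF fJ J(2)]
    by (simp add: sum.swap[of _ "Pi\<^sub>E J V"])
qed

text \<open>Both coordinates of a random tuple may be resampled independently without changing an average; this is how
  every random choice in the development is evaluated.\<close>

lemma sum_PiE_resample2:
  fixes f :: "('i \<Rightarrow> 'v) \<Rightarrow> real"
  assumes "finite I" "a \<in> I" "b \<in> I"
  shows "(\<Sum>x\<in>Pi\<^sub>E I V. \<Sum>y\<in>V a. \<Sum>z\<in>V b. f (x(a := y, b := z)))
     = card (V a) * (card (V b) * (\<Sum>x\<in>Pi\<^sub>E I V. f x))"
  using sum_PiE_resample[OF assms(1,2), where V=V and f="\<lambda>x. \<Sum>z\<in>V b. f (x(b := z))"]
    sum_PiE_resample[OF assms(1,3), where V=V and f=f] by simp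

section \<open>Cells, densities and energy\<close>

text \<open>The cell of \<open>x\<close> consists of the vertices that no cut in \<open>S\<close> separates from
  \<open>x\<close>. Describing a partition by the cuts that generate it makes refinement a union of families,
  and bounds the number of cells by \<open>2 ^ card S\<close>.\<close>

definition cell :: "'v set \<Rightarrow> 'v set set \<Rightarrow> 'v \<Rightarrow> 'v set" where
  "cell V S x = {y \<in> V. \<forall>A\<in>S. x \<in> A \<longleftrightarrow> y \<in> A}"

definition cell_avg :: "'v set \<Rightarrow> 'v set set \<Rightarrow> ('v \<Rightarrow> real) \<Rightarrow> 'v \<Rightarrow> real" where
  "cell_avg V S f x = (\<Sum>x'\<in>cell V S x. f x') / card (cell V S x)"

definition dens :: "'v set \<Rightarrow> ('v \<Rightarrow> 'v \<Rightarrow> real) \<Rightarrow> 'v set set \<Rightarrow> 'v \<Rightarrow> 'v \<Rightarrow> real" where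
  "dens V g S x y = cell_avg V S (\<lambda>x'. cell_avg V S (g x') y) x"

definition energy :: "'v set \<Rightarrow> ('v \<Rightarrow> 'v \<Rightarrow> real) \<Rightarrow> 'v set set \<Rightarrow> real" where
  "energy V g S = (\<Sum>x\<in>V. \<Sum>y\<in>V. (dens V g S x y)\<^sup>2)"

text \<open>Such functions take a single value on each product of two cells; on them averaging over cells is invisible
  (\<open>dens_proj\<close>).\<close>

definition step_fun :: "'v set \<Rightarrow> 'v set set \<Rightarrow> ('v \<Rightarrow> 'v \<Rightarrow> real) \<Rightarrow> bool" where
  "step_fun V S u \<longleftrightarrow> (\<forall>x\<in>V. \<forall>x'\<in>V. \<forall>y\<in>V. \<forall>y'\<in>V.
     cell V S x = cell V S x' \<longrightarrow> cell V S y = cell V S y' \<longrightarrow> u x y = u x' y')"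

lemma cell_self: "x \<in> V \<Longrightarrow> x \<in> cell V S x" by (simp add: cell_def)
lemma cell_sub: "cell V S x \<subseteq> V" by (auto simp: cell_def)
lemma finite_cell: "finite V \<Longrightarrow> finite (cell V S x)" by (simp add: cell_def)
lemma cell_eqI: "y \<in> cell V S x \<Longrightarrow> cell V S y = cell V S x" by (auto simp: cell_def)
lemma cell_eq_iff: "x \<in> V \<Longrightarrow> y \<in> V \<Longrightarrow> cell V S x = cell V S y \<longleftrightarrow> (\<forall>A\<in>S. x \<in> A \<longleftrightarrow> y \<in> A)"
  by (auto simp: cell_def)
lemma card_cell_pos: "finite V \<Longrightarrow> x \<in> V \<Longrightarrow> card (cell V S x) > 0"
  using cell_self finite_cell card_gt_0_iff by fastforce
lemma cell_mono_eq: "S \<subseteq> S' \<Longrightarrow> x \<in> V \<Longrightarrow> y \<in> V \<Longrightarrow> cell V S' x = cell V S' y \<Longrightarrow> cell V S x = cell V S y"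
  by (auto simp: cell_eq_iff)

lemma dens_eq:
  "dens V g S x y = (\<Sum>x'\<in>cell V S x. \<Sum>y'\<in>cell V S y. g x' y') / (real (card (cell V S x)) * real (card (cell V S y)))"
  by (simp add: dens_def cell_avg_def sum_divide_distrib mult.commute)

lemma step_fun_mono: "S \<subseteq> S' \<Longrightarrow> step_fun V S u \<Longrightarrow> step_fun V S' u"
  unfolding step_fun_def using cell_mono_eq by metis

lemma step_fun_dens: "step_fun V S (dens V g S)"
  by (simp add: step_fun_def dens_def cell_avg_def)

lemma step_fun_mult: "step_fun V S u \<Longrightarrow> step_fun V S v \<Longrightarrow> step_fun V S (\<lambda>x y. u x y * v x y)"
  unfolding step_fun_def by metis

lemma card_cells_le:
  assumes "finite S" shows "card (cell V S ` V) \<le> 2 ^ card S"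
proof -
  let ?t = "\<lambda>T. {y \<in> V. {A\<in>S. y \<in> A} = T}"
  have "cell V S ` V \<subseteq> ?t ` Pow S"
  proof
    fix c assume "c \<in> cell V S ` V"
    then obtain x where "x \<in> V" "c = cell V S x" by auto
    then have "c = ?t {A\<in>S. x \<in> A}" by (auto simp: cell_def)
    then show "c \<in> ?t ` Pow S" by blast
  qed
  then have "card (cell V S ` V) \<le> card (Pow S)"
    using assms by (meson card_image_le card_mono finite_Pow_iff finite_imageI le_trans)
  then show ?thesis using assms by (simp add: card_Pow)
qed

text \<open>Averaging over cells is the orthogonal projection onto the functions that are constant on cells.\<close>

lemma cell_avg_proj:
  assumes "finite V" and u: "\<And>x x'. x \<in> V \<Longrightarrow> x' \<in> V \<Longrightarrow> cell V S x = cell V S x' \<Longrightarrow> u x = u x'"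
  shows "(\<Sum>x\<in>V. cell_avg V S f x * u x) = (\<Sum>x\<in>V. f x * u x)"
proof -
  have "(\<Sum>x\<in>V. cell_avg V S f x * u x)
      = (\<Sum>x\<in>V. \<Sum>x'\<in>V. if x' \<in> cell V S x then f x' * (u x / card (cell V S x)) else 0)"
  proof (rule sum.cong[OF refl])
    fix x assume "x \<in> V"
    have "cell_avg V S f x * u x = (\<Sum>x'\<in>cell V S x. f x' * (u x / card (cell V S x)))"
      by (simp add: cell_avg_def sum_distrib_right sum_divide_distrib)
    also have "\<dots> = (\<Sum>x'\<in>V \<inter> cell V S x. f x' * (u x / card (cell V S x)))"
      by (simp add: Int_absorb1 cell_sub)
    also have "\<dots> = (\<Sum>x'\<in>V. if x' \<in> cell V S x then f x' * (u x / card (cell V S x)) else 0)"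
      using sum.inter_restrict[OF assms(1)] by blast
    finally show "cell_avg V S f x * u x = \<dots>" .
  qed
  also have "\<dots> = (\<Sum>x'\<in>V. \<Sum>x\<in>V. if x' \<in> cell V S x then f x' * (u x / card (cell V S x)) else 0)"
    by (rule sum.swap)
  also have "\<dots> = (\<Sum>x'\<in>V. f x' * u x')"
  proof (rule sum.cong[OF refl])
    fix x' assume x': "x' \<in> V"
    have "(\<Sum>x\<in>V. if x' \<in> cell V S x then f x' * (u x / card (cell V S x)) else 0)
       = (\<Sum>x\<in>V. if x \<in> cell V S x' then f x' * (u x' / card (cell V S x')) else 0)"
    proof (rule sum.cong[OF refl])
      fix x assume x: "x \<in> V"
      have "x' \<in> cell V S x \<longleftrightarrow> x \<in> cell V S x'" using x x' by (auto simp: cell_def)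
      moreover have "x \<in> cell V S x' \<Longrightarrow> cell V S x = cell V S x'" by (rule cell_eqI)
      ultimately show "(if x' \<in> cell V S x then f x' * (u x / card (cell V S x)) else 0) =
         (if x \<in> cell V S x' then f x' * (u x' / card (cell V S x')) else 0)"
        using u[OF x x'] by auto
    qed
    also have "\<dots> = (\<Sum>x\<in>V \<inter> cell V S x'. f x' * (u x' / card (cell V S x')))"
      by (rule sum.inter_restrict[OF assms(1), symmetric])
    also have "\<dots> = f x' * u x'"
      using card_cell_pos[OF assms(1) x'] by (simp add: Int_absorb1 cell_sub)
    finally show "(\<Sum>x\<in>V. if x' \<in> cell V S x then f x' * (u x / card (cell V S x)) else 0) = f x' * u x'" .
  qed
  finally show ?thesis .
qed

lemma dens_proj:
  assumes "finite V" "step_fun V S u"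
  shows "(\<Sum>x\<in>V. \<Sum>y\<in>V. dens V g S x y * u x y) = (\<Sum>x\<in>V. \<Sum>y\<in>V. g x y * u x y)"
proof -
  have "(\<Sum>x\<in>V. \<Sum>y\<in>V. dens V g S x y * u x y) = (\<Sum>y\<in>V. \<Sum>x\<in>V. cell_avg V S (\<lambda>x'. cell_avg V S (g x') y) x * u x y)"
    unfolding dens_def by (rule sum.swap)
  also have "\<dots> = (\<Sum>y\<in>V. \<Sum>x\<in>V. cell_avg V S (g x) y * u x y)"
  proof (rule sum.cong[OF refl])
    fix y assume "y \<in> V"
    then show "(\<Sum>x\<in>V. cell_avg V S (\<lambda>x'. cell_avg V S (g x') y) x * u x y) = (\<Sum>x\<in>V. cell_avg V S (g x) y * u x y)"
      using assms(2) unfolding step_fun_def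
      by (intro cell_avg_proj[OF assms(1), where u="\<lambda>x. u x y" and f="\<lambda>x. cell_avg V S (g x) y"]) blast
  qed
  also have "\<dots> = (\<Sum>x\<in>V. \<Sum>y\<in>V. cell_avg V S (g x) y * u x y)" by (rule sum.swap)
  also have "\<dots> = (\<Sum>x\<in>V. \<Sum>y\<in>V. g x y * u x y)"
  proof (rule sum.cong[OF refl])
    fix x assume "x \<in> V"
    then show "(\<Sum>y\<in>V. cell_avg V S (g x) y * u x y) = (\<Sum>y\<in>V. g x y * u x y)"
      using assms(2) unfolding step_fun_def
      by (intro cell_avg_proj[OF assms(1), where u="u x" and f="g x"]) blast
  qed
  finally show ?thesis .
qed

text \<open>For \<open>S \<subseteq> S'\<close> the density of \<open>S\<close> is the projection of the density of
  \<open>S'\<close>, so the difference is orthogonal to it. The weight \<open>w\<close> allows the identity to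
  be restricted to a single pair of cells.\<close>

lemma dens_pythagoras:
  assumes "finite V" "S \<subseteq> S'" and w: "step_fun V S w"
  shows "(\<Sum>x\<in>V. \<Sum>y\<in>V. w x y * (dens V g S' x y - dens V g S x y)\<^sup>2)
     = (\<Sum>x\<in>V. \<Sum>y\<in>V. w x y * (dens V g S' x y)\<^sup>2) - (\<Sum>x\<in>V. \<Sum>y\<in>V. w x y * (dens V g S x y)\<^sup>2)"
proof -
  let ?d = "dens V g S" and ?d' = "dens V g S'"
  have wd: "step_fun V S (\<lambda>x y. w x y * ?d x y)" by (intro step_fun_mult w step_fun_dens)
  have 1: "(\<Sum>x\<in>V. \<Sum>y\<in>V. ?d' x y * (w x y * ?d x y)) = (\<Sum>x\<in>V. \<Sum>y\<in>V. ?d x y * (w x y * ?d x y))"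
    using dens_proj[OF assms(1) wd, of g] dens_proj[OF assms(1) step_fun_mono[OF assms(2) wd], of g] by simp
  have "(\<Sum>x\<in>V. \<Sum>y\<in>V. w x y * (?d' x y - ?d x y)\<^sup>2)
     = (\<Sum>x\<in>V. \<Sum>y\<in>V. (w x y * (?d' x y)\<^sup>2 - 2 * (?d' x y * (w x y * ?d x y))) + w x y * (?d x y)\<^sup>2)"
    by (simp add: power2_eq_square algebra_simps)
  also have "\<dots> = (\<Sum>x\<in>V. \<Sum>y\<in>V. w x y * (?d' x y)\<^sup>2) - 2 * (\<Sum>x\<in>V. \<Sum>y\<in>V. ?d' x y * (w x y * ?d x y))
      + (\<Sum>x\<in>V. \<Sum>y\<in>V. w x y * (?d x y)\<^sup>2)"
    by (simp add: sum.distrib sum_subtractf sum_distrib_left)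
  finally show ?thesis unfolding 1 by (simp add: power2_eq_square algebra_simps)
qed

lemma dens_refine_mono:
  assumes "finite V" "S \<subseteq> S'" "S' \<subseteq> S''" and w: "step_fun V S w" and w0: "\<And>x y. x \<in> V \<Longrightarrow> y \<in> V \<Longrightarrow> 0 \<le> w x y"
  shows "(\<Sum>x\<in>V. \<Sum>y\<in>V. w x y * (dens V g S' x y - dens V g S x y)\<^sup>2)
     \<le> (\<Sum>x\<in>V. \<Sum>y\<in>V. w x y * (dens V g S'' x y - dens V g S x y)\<^sup>2)"
proof -
  have "0 \<le> (\<Sum>x\<in>V. \<Sum>y\<in>V. w x y * (dens V g S'' x y - dens V g S' x y)\<^sup>2)"
    by (intro sum_nonneg) (simp add: w0)
  then show ?thesis
    using dens_pythagoras[OF assms(1,3) step_fun_mono[OF assms(2) w], of g]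
      dens_pythagoras[OF assms(1,2) w, of g] dens_pythagoras[OF assms(1) _ w, of S'' g] assms(2,3) by force
qed

lemma energy_gain:
  assumes "finite V" "S \<subseteq> S'"
  shows "(\<Sum>x\<in>V. \<Sum>y\<in>V. (dens V g S' x y - dens V g S x y)\<^sup>2) = energy V g S' - energy V g S"
  using dens_pythagoras[OF assms, of "\<lambda>_ _. 1" g] by (simp add: step_fun_def energy_def)

lemma dens_bounds:
  assumes "finite V" "\<And>x y. 0 \<le> g x y \<and> g x y \<le> 1"
  shows "0 \<le> dens V g S x y \<and> dens V g S x y \<le> 1"
proof -
  have *: "0 \<le> cell_avg V S f x \<and> cell_avg V S f x \<le> 1" if "\<And>x. 0 \<le> f x \<and> f x \<le> 1" for f x
  proof -
    have "(\<Sum>x'\<in>cell V S x. f x') \<le> (\<Sum>x'\<in>cell V S x. 1)" using that by (intro sum_mono) auto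
    moreover have "0 \<le> (\<Sum>x'\<in>cell V S x. f x')" using that by (intro sum_nonneg) auto
    ultimately show ?thesis unfolding cell_avg_def by (auto simp: divide_le_eq_1)
  qed
  show ?thesis unfolding dens_def by (rule *, rule *, rule assms)
qed

lemma energy_bounds:
  assumes "finite V" "\<And>x y. 0 \<le> g x y \<and> g x y \<le> 1"
  shows "0 \<le> energy V g S" "energy V g S \<le> (real (card V))\<^sup>2"
proof -
  have "energy V g S \<le> (\<Sum>x\<in>V. \<Sum>y\<in>V. 1)" unfolding energy_def
    using dens_bounds[OF assms, where S=S] by (intro sum_mono) (simp add: abs_square_le_1)
  then show "energy V g S \<le> (real (card V))\<^sup>2" by (simp add: power2_eq_square)
  show "0 \<le> energy V g S" unfolding energy_def by (intro sum_nonneg) simp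
qed

text \<open>Energy increment: each failure of stability adds \<open>\<Gamma>\<close> to an energy that is bounded by
  \<open>(card V)\<^sup>2\<close>, so it happens fewer than \<open>N\<close> times. The number \<open>F (card
  S)\<close> of cuts allowed in a round is constant in the application to \<open>M\<close> and exponential in
  the application to the removal lemma.\<close>

lemma exists_stable_family:
  assumes V: "finite V" and g: "\<And>x y. 0 \<le> g x y \<and> g x y \<le> 1" and F: "mono F"
  shows "finite T \<Longrightarrow> \<Gamma> > 0 \<Longrightarrow> (real (card V))\<^sup>2 < energy V g T + real N * \<Gamma> \<Longrightarrow>
    \<exists>S. T \<subseteq> S \<and> finite S \<and> card S \<le> ((\<lambda>s. s + F s) ^^ N) (card T) \<and>
      (\<forall>W. finite W \<and> card W \<le> F (card S) \<longrightarrow> energy V g (S \<union> W) \<le> energy V g S + \<Gamma>)"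
proof (induction N arbitrary: T)
  case 0
  then show ?case using energy_bounds(2)[where g=g and S=T, OF V g] by simp
next
  case (Suc N)
  show ?case
  proof (cases "\<forall>W. finite W \<and> card W \<le> F (card T) \<longrightarrow> energy V g (T \<union> W) \<le> energy V g T + \<Gamma>")
    case True
    have "card T \<le> ((\<lambda>s. s + F s) ^^ M) (card T)" for M by (induction M) auto
    then show ?thesis using True Suc.prems(1) by (intro exI[of _ T]) blast
  next
    case False
    then obtain W where W: "finite W" "card W \<le> F (card T)" "energy V g (T \<union> W) > energy V g T + \<Gamma>"
      by force
    have "(real (card V))\<^sup>2 < energy V g (T \<union> W) + real N * \<Gamma>"
      using Suc.prems(3) W(3) by (simp add: algebra_simps)
    then obtain S where S: "T \<union> W \<subseteq> S" "finite S" "card S \<le> ((\<lambda>s. s + F s) ^^ N) (card (T \<union> W))"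
      "\<forall>W. finite W \<and> card W \<le> F (card S) \<longrightarrow> energy V g (S \<union> W) \<le> energy V g S + \<Gamma>"
      using Suc.IH[of "T \<union> W"] Suc.prems(1,2) W(1) by blast
    have m: "mono (\<lambda>s. s + F s)" using F by (auto simp: mono_def intro: add_mono)
    have "card (T \<union> W) \<le> card T + F (card T)" using W(2) card_Un_le[of T W] by linarith
    then have "((\<lambda>s. s + F s) ^^ N) (card (T \<union> W)) \<le> ((\<lambda>s. s + F s) ^^ N) (card T + F (card T))"
      by (rule monoD[OF mono_pow[OF m]])
    also have "\<dots> = ((\<lambda>s. s + F s) ^^ Suc N) (card T)" by (simp only: funpow_Suc_right o_apply)
    finally show ?thesis using S by (meson le_sup_iff le_trans)
  qed
qed

section \<open>The counting lemma\<close>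

definition adj :: "'v graph \<Rightarrow> 'v \<Rightarrow> 'v \<Rightarrow> real" where
  "adj G x y = (if {x, y} \<in> edges G then 1 else 0)"

definition nbhd :: "'v graph \<Rightarrow> 'v \<Rightarrow> 'v set" where
  "nbhd G x = {y. {x, y} \<in> edges G}"

lemma adj_bounds: "0 \<le> adj G x y \<and> adj G x y \<le> 1" by (simp add: adj_def)

text \<open>These are the cuts that the edge \<open>ab\<close> sees when all vertices of the tuple \<open>x\<close>
  other than \<open>x a\<close> and \<open>x b\<close> are held fixed.\<close>

definition cut_family :: "'v graph \<Rightarrow> 'v set set \<Rightarrow> 'i set \<Rightarrow> ('i \<Rightarrow> 'v) \<Rightarrow> 'i \<Rightarrow> 'i \<Rightarrow> 'v set set" where
  "cut_family G S I x a b = S \<union> nbhd G ` x ` (I - {a, b})"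

definition dens_change :: "'v set \<Rightarrow> 'v graph \<Rightarrow> 'v set set \<Rightarrow> 'i set \<Rightarrow> ('i \<Rightarrow> 'v) \<Rightarrow> 'i \<Rightarrow> 'i \<Rightarrow> 'v \<Rightarrow> 'v \<Rightarrow> real" where
  "dens_change V G S I x a b y z =
     dens V (adj G) (cut_family G S I x a b) y z - dens V (adj G) S y z"

lemma dens_change_upd: "dens_change V G S I (x(a := y, b := z)) a b = dens_change V G S I x a b"
proof -
  have "x(a := y, b := z) ` (I - {a, b}) = x ` (I - {a, b})" by (intro image_cong) auto
  then show ?thesis by (simp only: dens_change_def cut_family_def fun_eq_iff simp_thms)
qed

text \<open>With all coordinates except \<open>a\<close> and \<open>b\<close> fixed, the weight \<open>u\<close> is a
  step function for the refined family, hence cannot distinguish adjacency from the refined density; only the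
  change of density from \<open>S\<close> to the refined family is left. It is bounded with the larger weight
  \<open>r\<close>.\<close>

lemma replace_adj_by_dens:
  fixes G :: "'v graph"
  assumes V: "finite V" and I: "finite I" "a \<in> I" "b \<in> I" "a \<noteq> b"
    and u: "\<And>x. x \<in> I \<rightarrow>\<^sub>E V \<Longrightarrow> 0 \<le> u x \<and> u x \<le> r x"
    and step: "\<And>x. x \<in> I \<rightarrow>\<^sub>E V \<Longrightarrow> step_fun V (cut_family G S I x a b) (\<lambda>y z. u (x(a := y, b := z)))"
  shows "\<bar>\<Sum>x\<in>I \<rightarrow>\<^sub>E V. u x * (adj G (x a) (x b) - dens V (adj G) S (x a) (x b))\<bar>
     \<le> (\<Sum>x\<in>I \<rightarrow>\<^sub>E V. r x * \<bar>dens_change V G S I x a b (x a) (x b)\<bar>)"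
    (is "\<bar>?L\<bar> \<le> ?R")
proof (cases "V = {}")
  case True
  then have "(I \<rightarrow>\<^sub>E V) = {}" using I by (auto simp: PiE_eq_empty_iff)
  then show ?thesis by simp
next
  case False
  let ?n = "card V" and ?d = "dens V (adj G) S" and ?D = "\<lambda>x. dens_change V G S I x a b"
  have n: "?n > 0" using False V by (simp add: card_gt_0_iff)
  have upd: "x(a := y, b := z) \<in> I \<rightarrow>\<^sub>E V" if "x \<in> I \<rightarrow>\<^sub>E V" "y \<in> V" "z \<in> V" for x y z
    using that I by (auto simp: PiE_iff extensional_def)
  have "?n * (?n * ?L) = (\<Sum>x\<in>I \<rightarrow>\<^sub>E V. \<Sum>y\<in>V. \<Sum>z\<in>V. u (x(a := y, b := z)) * (adj G y z - ?d y z))"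
    using sum_PiE_resample2[OF I(1,2,3), where V="\<lambda>_. V" and f="\<lambda>x. u x * (adj G (x a) (x b) - ?d (x a) (x b))"] I(4) by simp
  also have "\<dots> = (\<Sum>x\<in>I \<rightarrow>\<^sub>E V. \<Sum>y\<in>V. \<Sum>z\<in>V. u (x(a := y, b := z)) * ?D x y z)"
  proof (rule sum.cong[OF refl])
    fix x assume x: "x \<in> I \<rightarrow>\<^sub>E V"
    have "(\<Sum>y\<in>V. \<Sum>z\<in>V. dens V (adj G) (cut_family G S I x a b) y z * u (x(a := y, b := z))) = (\<Sum>y\<in>V. \<Sum>z\<in>V. adj G y z * u (x(a := y, b := z)))"
      by (rule dens_proj[OF V step[OF x]])
    then show "(\<Sum>y\<in>V. \<Sum>z\<in>V. u (x(a := y, b := z)) * (adj G y z - ?d y z)) =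
       (\<Sum>y\<in>V. \<Sum>z\<in>V. u (x(a := y, b := z)) * ?D x y z)"
      by (simp add: dens_change_def right_diff_distrib sum_subtractf mult.commute)
  qed
  finally have "\<bar>?n * (?n * ?L)\<bar> \<le> (\<Sum>x\<in>I \<rightarrow>\<^sub>E V. \<Sum>y\<in>V. \<Sum>z\<in>V. \<bar>u (x(a := y, b := z)) * ?D x y z\<bar>)"
    by (simp only:) (intro order_trans[OF sum_abs] sum_mono order.refl)
  also have "\<dots> \<le> (\<Sum>x\<in>I \<rightarrow>\<^sub>E V. \<Sum>y\<in>V. \<Sum>z\<in>V. r (x(a := y, b := z)) * \<bar>?D x y z\<bar>)"
    by (intro sum_mono) (use u[OF upd] in \<open>auto simp: abs_mult intro!: mult_right_mono\<close>)
  also have "\<dots> = ?n * (?n * ?R)"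
    using sum_PiE_resample2[OF I(1,2,3), where V="\<lambda>_. V" and f="\<lambda>x. r x * \<bar>?D x (x a) (x b)\<bar>"] I(4)
    by (simp add: dens_change_upd)
  finally have "?n * (?n * \<bar>?L\<bar>) \<le> ?n * (?n * ?R)" by (simp add: abs_mult)
  then show ?thesis using n by simp
qed

text \<open>Densities are replaced by adjacencies one pair at a time. All other factors that involve \<open>x a\<close>
  or \<open>x b\<close> either depend on cells only or test membership in the neighbourhood of another
  coordinate, which is why the refinement by neighbourhoods suffices.\<close>

lemma counting_lemma:
  fixes G :: "'v graph" and P :: "('i \<times> 'i) set"
  assumes V: "finite V" and I: "finite I" and P: "P \<subseteq> I \<times> I" "\<And>a b. (a, b) \<in> P \<Longrightarrow> a \<noteq> b \<and> (b, a) \<notin> P"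
    and r: "\<And>x. x \<in> I \<rightarrow>\<^sub>E V \<Longrightarrow> 0 \<le> r x"
    and r_step: "\<And>x x'. x \<in> I \<rightarrow>\<^sub>E V \<Longrightarrow> x' \<in> I \<rightarrow>\<^sub>E V \<Longrightarrow> (\<And>i. i \<in> I \<Longrightarrow> cell V S (x i) = cell V S (x' i)) \<Longrightarrow> r x = r x'"
    and Q: "Q \<subseteq> P"
  shows "\<bar>(\<Sum>x\<in>I \<rightarrow>\<^sub>E V. r x * (\<Prod>(a, b)\<in>Q. adj G (x a) (x b)) * (\<Prod>(a, b)\<in>P - Q. dens V (adj G) S (x a) (x b)))
      - (\<Sum>x\<in>I \<rightarrow>\<^sub>E V. r x * (\<Prod>(a, b)\<in>P. dens V (adj G) S (x a) (x b)))\<bar>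
    \<le> (\<Sum>(a, b)\<in>Q. \<Sum>x\<in>I \<rightarrow>\<^sub>E V. r x *
         \<bar>dens_change V G S I x a b (x a) (x b)\<bar>)"
proof -
  have finP: "finite P" using P(1) I finite_subset by blast
  have "finite Q" using finP Q finite_subset by blast
  then show ?thesis using Q
  proof (induction Q rule: finite_induct)
    case empty
    show ?case by simp
  next
    case (insert e Q)
    obtain a b where e: "e = (a, b)" by force
    let ?d = "dens V (adj G) S"
    let ?p = "\<lambda>Q x. (\<Prod>(a, b)\<in>Q. adj G (x a) (x b)) * (\<Prod>(a, b)\<in>P - insert e Q. ?d (x a) (x b))"
    have ab: "(a, b) \<in> P" using insert.prems e by auto
    have abI: "a \<in> I" "b \<in> I" "a \<noteq> b" using ab P by auto
    have PQ: "P - Q = insert e (P - insert e Q)" using insert by auto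
    have s1: "(\<Prod>(a, b)\<in>P - Q. ?d (x a) (x b)) = ?d (x a) (x b) * (\<Prod>(a, b)\<in>P - insert e Q. ?d (x a) (x b))" for x
      by (subst PQ, subst prod.insert) (use finP e in auto)
    have s2: "(\<Prod>(a, b)\<in>insert e Q. adj G (x a) (x b)) = adj G (x a) (x b) * (\<Prod>(a, b)\<in>Q. adj G (x a) (x b))" for x
      using insert.hyps e by simp
    have diff: "(\<Sum>x\<in>I \<rightarrow>\<^sub>E V. r x * (\<Prod>(a, b)\<in>insert e Q. adj G (x a) (x b)) * (\<Prod>(a, b)\<in>P - insert e Q. ?d (x a) (x b)))
      - (\<Sum>x\<in>I \<rightarrow>\<^sub>E V. r x * (\<Prod>(a, b)\<in>Q. adj G (x a) (x b)) * (\<Prod>(a, b)\<in>P - Q. ?d (x a) (x b)))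
      = (\<Sum>x\<in>I \<rightarrow>\<^sub>E V. (r x * ?p Q x) * (adj G (x a) (x b) - ?d (x a) (x b)))"
      unfolding sum_subtractf[symmetric] s1 s2 by (intro sum.cong refl) (simp add: algebra_simps)
    have "\<bar>\<Sum>x\<in>I \<rightarrow>\<^sub>E V. (r x * ?p Q x) * (adj G (x a) (x b) - ?d (x a) (x b))\<bar>
     \<le> (\<Sum>x\<in>I \<rightarrow>\<^sub>E V. r x * \<bar>dens_change V G S I x a b (x a) (x b)\<bar>)"
    proof (rule replace_adj_by_dens[OF V I abI])
      fix x assume x: "x \<in> I \<rightarrow>\<^sub>E V"
      have "0 \<le> ?p Q x \<and> ?p Q x \<le> 1"
        by (intro conjI mult_nonneg_nonneg mult_le_one prod_nonneg prod_le_1)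
          (simp_all add: case_prod_unfold adj_bounds dens_bounds[where g="adj G", OF V adj_bounds])
      then show "0 \<le> r x * ?p Q x \<and> r x * ?p Q x \<le> r x"
        using r[OF x] by (meson mult_left_le mult_nonneg_nonneg)
    next
      fix x assume x: "x \<in> I \<rightarrow>\<^sub>E V"
      let ?S = "cut_family G S I x a b"
      show "step_fun V ?S (\<lambda>y z. r (x(a := y, b := z)) * ?p Q (x(a := y, b := z)))"
        unfolding step_fun_def
      proof (intro ballI impI)
        fix y y' z z' assume yz: "y \<in> V" "y' \<in> V" "z \<in> V" "z' \<in> V"
          and c: "cell V ?S y = cell V ?S y'" "cell V ?S z = cell V ?S z'"
        let ?x = "x(a := y, b := z)" and ?x' = "x(a := y', b := z')"
        have SS: "S \<subseteq> ?S" by (simp add: cut_family_def)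
        have c': "cell V S y = cell V S y'" "cell V S z = cell V S z'"
          using c yz SS cell_mono_eq by metis+
        have ce: "cell V S (?x i) = cell V S (?x' i)" for i using c' by simp
        have N: "y \<in> nbhd G (x i) \<longleftrightarrow> y' \<in> nbhd G (x i)" "z \<in> nbhd G (x i) \<longleftrightarrow> z' \<in> nbhd G (x i)"
          if "i \<in> I - {a, b}" for i
          using c yz that by (auto simp: cell_eq_iff cut_family_def)
        have "r ?x = r ?x'"
          by (rule r_step) (use x yz abI ce in \<open>auto simp: PiE_iff extensional_def\<close>)
        moreover have "(\<Prod>(a, b)\<in>P - insert e Q. ?d (?x a) (?x b)) = (\<Prod>(a, b)\<in>P - insert e Q. ?d (?x' a) (?x' b))"
          by (intro prod.cong refl) (simp only: case_prod_unfold dens_def cell_avg_def ce)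
        moreover have "(\<Prod>(a, b)\<in>Q. adj G (?x a) (?x b)) = (\<Prod>(a, b)\<in>Q. adj G (?x' a) (?x' b))"
        proof (rule prod.cong[OF refl])
          fix p assume p: "p \<in> Q"
          obtain i j where ij: "p = (i, j)" by force
          have ijP: "(i, j) \<in> P" using p ij insert.prems by auto
          then have "i \<in> I" "j \<in> I" "i \<noteq> j" using P by auto
          moreover have "\<not> (i = a \<and> j = b)" using p ij e insert.hyps by auto
          moreover have "\<not> (i = b \<and> j = a)" using P(2)[OF ab] ijP by auto
          ultimately show "(case p of (a, b) \<Rightarrow> adj G (?x a) (?x b)) = (case p of (a, b) \<Rightarrow> adj G (?x' a) (?x' b))"
            using N[of i] N[of j] unfolding ij adj_def nbhd_def
            by (auto simp: insert_commute)
        qed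
        ultimately show "r ?x * ?p Q ?x = r ?x' * ?p Q ?x'" by simp
      qed
    qed
    moreover have "(\<Sum>(a, b)\<in>insert e Q. \<Sum>x\<in>I \<rightarrow>\<^sub>E V. r x *
         \<bar>dens_change V G S I x a b (x a) (x b)\<bar>)
       = (\<Sum>x\<in>I \<rightarrow>\<^sub>E V. r x * \<bar>dens_change V G S I x a b (x a) (x b)\<bar>)
       + (\<Sum>(a, b)\<in>Q. \<Sum>x\<in>I \<rightarrow>\<^sub>E V. r x *
         \<bar>dens_change V G S I x a b (x a) (x b)\<bar>)"
      using insert.hyps e by simp
    moreover note insert.IH diff insert.prems
    ultimately show ?case by (smt (verit) insert_subset)
  qed
qed

section \<open>Homomorphisms and homomorphic copies\<close>

definition hom_set :: "'a graph \<Rightarrow> 'b graph \<Rightarrow> ('a \<Rightarrow> 'b) set" where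
  "hom_set H G = {\<phi> \<in> verts H \<rightarrow>\<^sub>E verts G. is_hom \<phi> H G}"

lemma simple_edge_sub: "simple_graph H \<Longrightarrow> e \<in> edges H \<Longrightarrow> e \<subseteq> verts H"
  by (simp add: simple_graph_def)

lemma simple_edge_neq: "simple_graph H \<Longrightarrow> {a, b} \<in> edges H \<Longrightarrow> a \<noteq> b"
  by (force simp add: simple_graph_def)

lemma simple_edge_verts: "simple_graph H \<Longrightarrow> {a, b} \<in> edges H \<Longrightarrow> a \<in> verts H \<and> b \<in> verts H"
  by (force simp add: simple_graph_def)

lemma simple_edgeE:
  assumes "simple_graph H" "e \<in> edges H"
  obtains a b where "e = {a, b}" "a \<noteq> b" "a \<in> verts H" "b \<in> verts H"
  using assms by (fastforce simp: simple_graph_def card_2_iff)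

lemma finite_edges: "simple_graph H \<Longrightarrow> finite (edges H)"
  by (rule finite_subset[of _ "Pow (verts H)"]) (auto simp: simple_graph_def)

lemma is_hom_cong:
  assumes "simple_graph H" "\<And>v. v \<in> verts H \<Longrightarrow> \<phi> v = \<psi> v"
  shows "is_hom \<phi> H G = is_hom \<psi> H G" "hom_image \<phi> H = hom_image \<psi> H"
proof -
  have 1: "\<phi> ` verts H = \<psi> ` verts H" using assms(2) by (intro image_cong) auto
  have 2: "\<phi> ` e = \<psi> ` e" if "e \<in> edges H" for e
    using assms(2) simple_edge_sub[OF assms(1) that] by (intro image_cong) auto
  show "is_hom \<phi> H G = is_hom \<psi> H G" using 1 2 by (auto simp: is_hom_def)
  show "hom_image \<phi> H = hom_image \<psi> H" using 1 2 by (auto simp: hom_image_def intro: image_cong)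
qed

lemma is_hom_comp: "is_hom \<phi> H G \<Longrightarrow> is_hom \<psi> G F \<Longrightarrow> is_hom (\<psi> \<circ> \<phi>) H F"
  unfolding is_hom_def image_comp[symmetric] by blast

lemma is_hom_edge: "is_hom \<phi> H G \<Longrightarrow> {a, b} \<in> edges H \<Longrightarrow> {\<phi> a, \<phi> b} \<in> edges G"
  by (auto simp: is_hom_def dest!: bspec)

lemma is_homI:
  assumes "simple_graph H" "\<And>v. v \<in> verts H \<Longrightarrow> \<phi> v \<in> verts G"
    "\<And>a b. {a, b} \<in> edges H \<Longrightarrow> {\<phi> a, \<phi> b} \<in> edges G"
  shows "is_hom \<phi> H G"
  unfolding is_hom_def
proof (intro conjI ballI)
  fix e assume e: "e \<in> edges H"
  then obtain a b where "e = {a, b}" by (rule simple_edgeE[OF assms(1)])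
  then show "\<phi> ` e \<in> edges G" using assms(3)[of a b] e by simp
qed (use assms(2) in auto)

lemma is_hom_mono: "is_hom \<phi> H G \<Longrightarrow> verts G \<subseteq> verts G' \<Longrightarrow> edges G \<subseteq> edges G' \<Longrightarrow> is_hom \<phi> H G'"
  by (auto simp: is_hom_def)

lemma restrict_in_hom_set:
  assumes "simple_graph H" "is_hom \<phi> H G"
  shows "restrict \<phi> (verts H) \<in> hom_set H G"
  using assms is_hom_cong(1)[OF assms(1), of \<phi> "restrict \<phi> (verts H)"]
  by (auto simp: hom_set_def is_hom_def)

lemma hom_copies_eq: "simple_graph H \<Longrightarrow> hom_copies H G = (\<lambda>\<phi>. hom_image \<phi> H) ` hom_set H G"
proof -
  assume H: "simple_graph H"
  have "hom_image \<phi> H \<in> (\<lambda>\<phi>. hom_image \<phi> H) ` hom_set H G" if "is_hom \<phi> H G" for \<phi>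
    using restrict_in_hom_set[OF H that] is_hom_cong(2)[OF H, of \<phi> "restrict \<phi> (verts H)"]
    by (intro image_eqI[of _ _ "restrict \<phi> (verts H)"]) auto
  then show ?thesis by (auto simp: hom_copies_def hom_set_def)
qed

lemma finite_hom_set: "simple_graph H \<Longrightarrow> simple_graph G \<Longrightarrow> finite (hom_set H G)"
  unfolding hom_set_def by (simp add: simple_graph_def finite_PiE)

lemma card_hom_copies_le: "simple_graph H \<Longrightarrow> simple_graph G \<Longrightarrow> card (hom_copies H G) \<le> card (hom_set H G)"
  by (simp add: hom_copies_eq card_image_le finite_hom_set)

text \<open>At most \<open>h ^ h\<close> maps have a given image, so copies and homomorphisms have the same order of
  magnitude.\<close>

lemma card_hom_set_le:
  assumes "simple_graph H" "simple_graph G"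
  shows "card (hom_set H G) \<le> card (hom_copies H G) * card (verts H) ^ card (verts H)"
proof -
  let ?h = "card (verts H)"
  have fin: "finite (hom_copies H G)" by (simp add: hom_copies_eq assms finite_hom_set)
  have "hom_set H G \<subseteq> (\<Union>K\<in>hom_copies H G. {\<phi> \<in> hom_set H G. hom_image \<phi> H = K})"
    by (auto simp: hom_copies_eq assms)
  then have "card (hom_set H G) \<le> card (\<Union>K\<in>hom_copies H G. {\<phi> \<in> hom_set H G. hom_image \<phi> H = K})"
    using fin finite_hom_set[OF assms] by (intro card_mono) auto
  also have "\<dots> \<le> (\<Sum>K\<in>hom_copies H G. card {\<phi> \<in> hom_set H G. hom_image \<phi> H = K})"
    by (rule card_UN_le[OF fin])
  also have "\<dots> \<le> (\<Sum>K\<in>hom_copies H G. ?h ^ ?h)"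
  proof (rule sum_mono)
    fix K assume "K \<in> hom_copies H G"
    then obtain \<phi> where "K = hom_image \<phi> H" by (auto simp: hom_copies_def)
    then have vK: "finite (verts K)" "card (verts K) \<le> ?h"
      using assms(1) by (auto simp: hom_image_def simple_graph_def card_image_le)
    have "{\<phi> \<in> hom_set H G. hom_image \<phi> H = K} \<subseteq> verts H \<rightarrow>\<^sub>E verts K"
      by (auto simp: hom_set_def hom_image_def PiE_def)
    then have "card {\<phi> \<in> hom_set H G. hom_image \<phi> H = K} \<le> card (verts H \<rightarrow>\<^sub>E verts K)"
      using vK(1) assms(1) by (intro card_mono) (auto simp: simple_graph_def finite_PiE)
    also have "\<dots> = card (verts K) ^ ?h"
      using assms(1) by (simp add: card_PiE simple_graph_def)
    also have "\<dots> \<le> ?h ^ ?h" using vK(2) by (rule power_mono) simp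
    finally show "card {\<phi> \<in> hom_set H G. hom_image \<phi> H = K} \<le> ?h ^ ?h" .
  qed
  finally show ?thesis by simp
qed

section \<open>Counting homomorphisms through cells\<close>

text \<open>Every edge is listed as exactly one ordered pair, so that products over the edges of \<open>H\<close> can be
  written as products over pairs.\<close>

definition orientation :: "'a graph \<Rightarrow> ('a \<times> 'a) set \<Rightarrow> bool" where
  "orientation H P \<longleftrightarrow> P \<subseteq> verts H \<times> verts H \<and> (\<forall>a b. (a, b) \<in> P \<longrightarrow> a \<noteq> b \<and> (b, a) \<notin> P) \<and>
     edges H = (\<lambda>(a, b). {a, b}) ` P"

lemma exists_orientation:
  assumes "simple_graph H" shows "\<exists>P. orientation H P"
proof -
  have "\<forall>e\<in>edges H. \<exists>p. e = {fst p, snd p} \<and> fst p \<noteq> snd p"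
    using simple_edgeE[OF assms] by (metis fst_conv snd_conv)
  then obtain f where f: "\<And>e. e \<in> edges H \<Longrightarrow> e = {fst (f e), snd (f e)} \<and> fst (f e) \<noteq> snd (f e)"
    by metis
  have "orientation H (f ` edges H)"
    unfolding orientation_def
  proof (intro conjI allI impI)
    show "f ` edges H \<subseteq> verts H \<times> verts H"
    proof
      fix p assume "p \<in> f ` edges H"
      then obtain e where "e \<in> edges H" "p = f e" by auto
      then show "p \<in> verts H \<times> verts H"
        using f[of e] simple_edge_sub[OF assms, of e] by (cases p) force
    qed
    show "edges H = (\<lambda>(a, b). {a, b}) ` f ` edges H"
      using f by (auto simp: image_image case_prod_unfold)
    fix a b assume "(a, b) \<in> f ` edges H"
    then obtain e where e: "e \<in> edges H" "f e = (a, b)" by force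
    then show ab: "a \<noteq> b" using f[of e] by auto
    show "(b, a) \<notin> f ` edges H"
    proof
      assume "(b, a) \<in> f ` edges H"
      then obtain e' where e': "e' \<in> edges H" "f e' = (b, a)" by force
      then have "e = e'" using f[of e] f[of e'] e by auto
      then show False using e e' ab by auto
    qed
  qed
  then show ?thesis by blast
qed

lemma finite_orientation: "simple_graph H \<Longrightarrow> orientation H P \<Longrightarrow> finite P"
  by (rule finite_subset[of _ "verts H \<times> verts H"]) (auto simp: orientation_def simple_graph_def)

lemma is_hom_orientation:
  assumes "orientation H P" "x \<in> verts H \<rightarrow>\<^sub>E verts G"
  shows "is_hom x H G \<longleftrightarrow> (\<forall>(a, b)\<in>P. {x a, x b} \<in> edges G)"
  using assms by (auto simp: orientation_def is_hom_def case_prod_unfold)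

lemma prod_adj_orientation:
  assumes "simple_graph H" "orientation H P" "x \<in> verts H \<rightarrow>\<^sub>E verts G"
  shows "(\<Prod>(a, b)\<in>P. adj G (x a) (x b)) = of_bool (is_hom x H G)"
proof (cases "is_hom x H G")
  case True
  then show ?thesis using is_hom_orientation[OF assms(2,3)] by (auto intro!: prod.neutral simp: adj_def)
next
  case False
  then obtain a b where "(a, b) \<in> P" "{x a, x b} \<notin> edges G"
    using is_hom_orientation[OF assms(2,3)] by auto
  then show ?thesis using False finite_orientation[OF assms(1,2)]
    by (auto intro!: prod_zero bexI[of _ "(a, b)"] simp: adj_def)
qed

lemma card_cut_le:
  assumes "finite I" shows "card (nbhd G ` x ` (I - {a, b})) \<le> card I"
  by (meson assms card_image_le card_mono Diff_subset finite_Diff finite_imageI le_trans)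

lemma mem_cell_iff: "y \<in> cell V S x \<longleftrightarrow> y \<in> V \<and> cell V S y = cell V S x"
  using cell_self cell_eqI cell_sub by (metis subsetD)

lemma dens_cell_cong:
  "cell V S y = cell V S y' \<Longrightarrow> cell V S z = cell V S z' \<Longrightarrow> dens V g S y z = dens V g S y' z'"
  by (simp add: dens_def cell_avg_def)

text \<open>The set \<open>R\<close> consists of tuples of vertices and is a union of products of cells between which
  \<open>G\<close> is dense along \<open>P\<close>. If all densities survived the passage to actual edges, a
  proportion \<open>\<tau> ^ card P\<close> of \<open>R\<close> would be homomorphisms.\<close>

lemma homs_ge_cell_tuples:
  fixes H :: "'a graph" and G :: "'v graph" and \<tau> :: real
  assumes H: "simple_graph H" and G: "simple_graph G" and P: "orientation H P" and \<tau>: "\<tau> \<ge> 0"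
    and R: "R \<subseteq> verts H \<rightarrow>\<^sub>E verts G"
    and R_step: "\<And>x x'. x \<in> R \<Longrightarrow> x' \<in> verts H \<rightarrow>\<^sub>E verts G \<Longrightarrow>
      (\<And>i. i \<in> verts H \<Longrightarrow> cell (verts G) S (x i) = cell (verts G) S (x' i)) \<Longrightarrow> x' \<in> R"
    and R_dens: "\<And>x a b. x \<in> R \<Longrightarrow> (a, b) \<in> P \<Longrightarrow> \<tau> \<le> dens (verts G) (adj G) S (x a) (x b)"
  shows "\<tau> ^ card P * card R \<le> card (hom_set H G) +
    (\<Sum>(a, b)\<in>P. \<Sum>x\<in>R. \<bar>dens_change (verts G) G S (verts H) x a b (x a) (x b)\<bar>)"
proof -
  let ?V = "verts G" and ?I = "verts H" and ?d = "dens (verts G) (adj G) S"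
  let ?X = "?I \<rightarrow>\<^sub>E ?V" and ?r = "\<lambda>x. of_bool (x \<in> R) :: real"
  have V: "finite ?V" and I: "finite ?I" using G H by (auto simp: simple_graph_def)
  have fX: "finite ?X" using V I by (simp add: finite_PiE)
  have P1: "P \<subseteq> ?I \<times> ?I" "\<And>a b. (a, b) \<in> P \<Longrightarrow> a \<noteq> b \<and> (b, a) \<notin> P" using P by (auto simp: orientation_def)
  have onR: "(\<Sum>x\<in>?X. ?r x * f x) = (\<Sum>x\<in>R. f x)" for f
    using fX R by (intro sum.mono_neutral_cong_right) auto
  have "\<tau> ^ card P * card R = (\<Sum>x\<in>R. \<Prod>p\<in>P. \<tau>)" by simp
  also have "\<dots> \<le> (\<Sum>x\<in>R. \<Prod>(a, b)\<in>P. ?d (x a) (x b))"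
    using R_dens \<tau> by (intro sum_mono prod_mono) auto
  finally have low: "\<tau> ^ card P * card R \<le> (\<Sum>x\<in>R. \<Prod>(a, b)\<in>P. ?d (x a) (x b))" .
  have "(\<Sum>x\<in>R. \<Prod>(a, b)\<in>P. adj G (x a) (x b)) = (\<Sum>x\<in>?X. ?r x * of_bool (is_hom x H G))"
    unfolding onR using R by (intro sum.cong refl prod_adj_orientation[OF H P]) auto
  also have "\<dots> \<le> (\<Sum>x\<in>?X. of_bool (is_hom x H G))" by (intro sum_mono) auto
  also have "\<dots> = card (hom_set H G)" using fX by (simp add: hom_set_def Int_def)
  finally have up: "(\<Sum>x\<in>R. \<Prod>(a, b)\<in>P. adj G (x a) (x b)) \<le> card (hom_set H G)" .
  have "\<bar>(\<Sum>x\<in>?X. ?r x * (\<Prod>(a, b)\<in>P. adj G (x a) (x b)) * (\<Prod>(a, b)\<in>P - P. ?d (x a) (x b)))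
      - (\<Sum>x\<in>?X. ?r x * (\<Prod>(a, b)\<in>P. ?d (x a) (x b)))\<bar>
    \<le> (\<Sum>(a, b)\<in>P. \<Sum>x\<in>?X. ?r x * \<bar>dens_change ?V G S ?I x a b (x a) (x b)\<bar>)"
  proof (rule counting_lemma[OF V I P1])
    fix x x' assume "x \<in> ?X" "x' \<in> ?X" "\<And>i. i \<in> ?I \<Longrightarrow> cell ?V S (x i) = cell ?V S (x' i)"
    then show "?r x = ?r x'" using R_step[of x x'] R_step[of x' x] by auto
  qed auto
  then show ?thesis using low up by (simp add: onR)
qed

text \<open>When there are no homomorphisms, the error terms have to carry the whole main term. Their second moment is
  an average of energy gains, which stability bounds by \<open>\<Gamma> n\<^sup>2\<close>. The density changes
  are summed over tuples in \<open>R\<close> only, so that the bound is linear in \<open>1/\<delta>\<close>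
  when \<open>R\<close> makes up a proportion \<open>\<delta>\<close> of all tuples.\<close>

lemma cell_tuples_le_energy_gain:
  fixes H :: "'a graph" and G :: "'v graph" and \<tau> \<Gamma> :: real
  assumes H: "simple_graph H" "edges H \<noteq> {}" and G: "simple_graph G" "hom_free H G" and P: "orientation H P"
    and n: "verts G \<noteq> {}" and \<tau>: "\<tau> > 0"
    and R: "R \<subseteq> verts H \<rightarrow>\<^sub>E verts G"
    and R_step: "\<And>x x'. x \<in> R \<Longrightarrow> x' \<in> verts H \<rightarrow>\<^sub>E verts G \<Longrightarrow>
      (\<And>i. i \<in> verts H \<Longrightarrow> cell (verts G) S (x i) = cell (verts G) S (x' i)) \<Longrightarrow> x' \<in> R"
    and R_dens: "\<And>x a b. x \<in> R \<Longrightarrow> (a, b) \<in> P \<Longrightarrow> \<tau> \<le> dens (verts G) (adj G) S (x a) (x b)"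
    and stable: "\<And>W. finite W \<Longrightarrow> card W \<le> card (verts H) \<Longrightarrow>
      energy (verts G) (adj G) (S \<union> W) \<le> energy (verts G) (adj G) S + \<Gamma> * real (card (verts G)) ^ 2"
  shows "\<tau> ^ (2 * card P) * card R \<le> (card P)\<^sup>2 * \<Gamma> * real (card (verts G)) ^ card (verts H)"
proof -
  let ?V = "verts G" and ?I = "verts H" and ?e = "card P" and ?n = "real (card (verts G))"
  let ?X = "?I \<rightarrow>\<^sub>E ?V" and ?D = "\<lambda>a b x. dens_change ?V G S ?I x a b"
  have V: "finite ?V" and I: "finite ?I" using G H by (auto simp: simple_graph_def)
  have fX: "finite ?X" using V I by (simp add: finite_PiE)
  have n0: "?n > 0" using n V by (simp add: card_gt_0_iff)
  have e0: "?e > 0"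
    using finite_orientation[OF H(1) P] P H(2) by (auto simp: orientation_def card_gt_0_iff)
  \<comment> \<open>With this weight the first term of the AM-GM bound below, summed over \<open>P\<close>, is half of the left-hand side.\<close>
  define \<kappa> where "\<kappa> = \<tau> ^ ?e / ?e"
  have k0: "\<kappa> > 0" using \<tau> e0 by (simp add: \<kappa>_def)
  have "hom_set H G = {}" using G(2) by (auto simp: hom_set_def hom_free_def)
  then have "\<tau> ^ ?e * card R \<le> (\<Sum>(a, b)\<in>P. \<Sum>x\<in>R. \<bar>?D a b x (x a) (x b)\<bar>)"
    using homs_ge_cell_tuples[OF H(1) G(1) P less_imp_le[OF \<tau>] R R_step R_dens] by simp
  also have "\<dots> \<le> (\<Sum>(a, b)\<in>P. \<kappa> / 2 * card R + ?n ^ card ?I * \<Gamma> / (2 * \<kappa>))"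
  proof (rule sum_mono, clarify)
    fix a b assume ab: "(a, b) \<in> P"
    then have abI: "a \<in> ?I" "b \<in> ?I" "a \<noteq> b" using P by (auto simp: orientation_def)
    have "?n * (?n * (\<Sum>x\<in>?X. (?D a b x (x a) (x b))\<^sup>2)) = (\<Sum>x\<in>?X. \<Sum>y\<in>?V. \<Sum>z\<in>?V. (?D a b x y z)\<^sup>2)"
      using sum_PiE_resample2[OF I abI(1,2), where V="\<lambda>_. ?V" and f="\<lambda>x. (?D a b x (x a) (x b))\<^sup>2"] abI(3)
      by (simp add: dens_change_upd)
    also have "\<dots> \<le> (\<Sum>x\<in>?X. \<Gamma> * ?n ^ 2)"
    proof (rule sum_mono)
      fix x
      show "(\<Sum>y\<in>?V. \<Sum>z\<in>?V. (?D a b x y z)\<^sup>2) \<le> \<Gamma> * ?n ^ 2"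
        using energy_gain[OF V, of S "cut_family G S ?I x a b" "adj G"]
          stable[OF _ card_cut_le[OF I, of G x a b]] I by (simp add: cut_family_def dens_change_def)
    qed
    also have "\<dots> = ?n * (?n * (?n ^ card ?I * \<Gamma>))"
      using I by (simp add: card_PiE power2_eq_square)
    finally have sq: "(\<Sum>x\<in>?X. (?D a b x (x a) (x b))\<^sup>2) \<le> ?n ^ card ?I * \<Gamma>" using n0 by simp
    have amgm: "\<bar>t\<bar> \<le> \<kappa> / 2 + t\<^sup>2 / (2 * \<kappa>)" for t
    proof -
      have "0 \<le> (\<kappa> - \<bar>t\<bar>)\<^sup>2 / (2 * \<kappa>)" using k0 by simp
      also have "\<dots> = \<kappa> / 2 + t\<^sup>2 / (2 * \<kappa>) - \<bar>t\<bar>"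
        using k0 by (simp add: power2_diff field_simps power2_eq_square)
      finally show ?thesis by simp
    qed
    have "(\<Sum>x\<in>R. \<bar>?D a b x (x a) (x b)\<bar>) \<le> (\<Sum>x\<in>R. \<kappa> / 2 + (?D a b x (x a) (x b))\<^sup>2 / (2 * \<kappa>))"
      by (intro sum_mono amgm)
    also have "\<dots> = \<kappa> / 2 * card R + (\<Sum>x\<in>R. (?D a b x (x a) (x b))\<^sup>2) / (2 * \<kappa>)"
      by (simp add: sum.distrib sum_divide_distrib)
    also have "\<dots> \<le> \<kappa> / 2 * card R + (\<Sum>x\<in>?X. (?D a b x (x a) (x b))\<^sup>2) / (2 * \<kappa>)"
      using k0 by (intro add_mono divide_right_mono sum_mono2 fX R) auto
    also have "\<dots> \<le> \<kappa> / 2 * card R + ?n ^ card ?I * \<Gamma> / (2 * \<kappa>)"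
      using sq k0 by (simp add: divide_right_mono)
    finally show "(\<Sum>x\<in>R. \<bar>?D a b x (x a) (x b)\<bar>) \<le> \<kappa> / 2 * card R + ?n ^ card ?I * \<Gamma> / (2 * \<kappa>)" .
  qed
  also have "\<dots> = \<tau> ^ ?e * card R / 2 + ?e * (?n ^ card ?I * \<Gamma> / (2 * \<kappa>))"
    using e0 by (simp add: \<kappa>_def distrib_left)
  finally have "\<tau> ^ ?e * card R \<le> ?e * (?n ^ card ?I * \<Gamma> / \<kappa>)" by (simp add: field_simps)
  then have "\<tau> ^ ?e * card R * \<kappa> \<le> ?e * (?n ^ card ?I * \<Gamma>)" using k0 by (simp add: field_simps)
  then have "\<tau> ^ ?e * (\<tau> ^ ?e * card R) \<le> ?e * (?e * (?n ^ card ?I * \<Gamma>))"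
    using e0 by (simp add: \<kappa>_def field_simps)
  moreover have "\<tau> ^ (2 * ?e) = \<tau> ^ ?e * \<tau> ^ ?e" by (simp add: mult_2 power_add)
  ultimately show ?thesis by (simp add: power2_eq_square algebra_simps)
qed

text \<open>Regularity is expressed through refinements: no \<open>h\<close> further cuts change the density between the
  two cells by more than \<open>\<eta>\<close> on average. This is the form in which the counting lemma
  consumes it.\<close>

definition regular_pair :: "'v graph \<Rightarrow> 'v set set \<Rightarrow> nat \<Rightarrow> real \<Rightarrow> 'v \<Rightarrow> 'v \<Rightarrow> bool" where
  "regular_pair G S h \<eta> y z \<longleftrightarrow> (\<forall>W. finite W \<and> card W \<le> h \<longrightarrow>
     dens (verts G) (\<lambda>y z. \<bar>dens (verts G) (adj G) (S \<union> W) y z - dens (verts G) (adj G) S y z\<bar>) S y z \<le> \<eta>)"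

text \<open>The product of the cells of \<open>\<psi>\<close> is a set of tuples as in
  \<open>homs_ge_cell_tuples\<close>, and each error term is an average density change over a regular pair.\<close>

lemma homs_ge_regular:
  fixes H :: "'a graph" and G :: "'v graph" and \<tau> \<eta> :: real
  assumes H: "simple_graph H" and G: "simple_graph G" and P: "orientation H P"
    and \<tau>: "\<tau> \<ge> 0" and \<psi>: "\<psi> \<in> verts H \<rightarrow> verts G"
    and reg: "\<And>a b. (a, b) \<in> P \<Longrightarrow> regular_pair G S (card (verts H)) \<eta> (\<psi> a) (\<psi> b)"
    and dense: "\<And>a b. (a, b) \<in> P \<Longrightarrow> \<tau> \<le> dens (verts G) (adj G) S (\<psi> a) (\<psi> b)"
  shows "(\<tau> ^ card P - card P * \<eta>) * (\<Prod>i\<in>verts H. card (cell (verts G) S (\<psi> i))) \<le> card (hom_set H G)"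
proof -
  let ?V = "verts G" and ?I = "verts H" and ?D = "\<lambda>a b x. dens_change (verts G) G S (verts H) x a b"
  let ?c = "\<lambda>i. cell ?V S (\<psi> i)"
  define R where "R = Pi\<^sub>E ?I ?c"
  have V: "finite ?V" and I: "finite ?I" using G H by (auto simp: simple_graph_def)
  have cR: "card R = (\<Prod>i\<in>?I. card (?c i))" by (simp add: R_def card_PiE I)
  have PI: "a \<in> ?I" "b \<in> ?I" "a \<noteq> b" if "(a, b) \<in> P" for a b using P that by (auto simp: orientation_def)
  have inR: "x \<in> R \<longleftrightarrow> x \<in> ?I \<rightarrow>\<^sub>E ?V \<and> (\<forall>i\<in>?I. cell ?V S (x i) = ?c i)" for x
    by (auto simp: R_def PiE_iff mem_cell_iff)
  have "\<tau> ^ card P * card R \<le> card (hom_set H G) + (\<Sum>(a, b)\<in>P. \<Sum>x\<in>R. \<bar>?D a b x (x a) (x b)\<bar>)"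
  proof (rule homs_ge_cell_tuples[OF H G P \<tau>])
    show "R \<subseteq> ?I \<rightarrow>\<^sub>E ?V" using inR by blast
    show "\<tau> \<le> dens ?V (adj G) S (x a) (x b)" if "x \<in> R" "(a, b) \<in> P" for x a b
    proof -
      have "dens ?V (adj G) S (x a) (x b) = dens ?V (adj G) S (\<psi> a) (\<psi> b)"
        using that PI[OF that(2)] by (intro dens_cell_cong) (auto simp: inR)
      then show ?thesis using dense[OF that(2)] by simp
    qed
  qed (auto simp: inR)
  also have "(\<Sum>(a, b)\<in>P. \<Sum>x\<in>R. \<bar>?D a b x (x a) (x b)\<bar>) \<le> (\<Sum>(a, b)\<in>P. \<eta> * card R)"
  proof (rule sum_mono, clarify)
    fix a b assume ab: "(a, b) \<in> P"
    let ?m = "real (card (?c a)) * real (card (?c b))"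
    have "\<psi> a \<in> ?V" "\<psi> b \<in> ?V" using \<psi> PI[OF ab] by auto
    then have cpos: "card (?c a) > 0" "card (?c b) > 0" using card_cell_pos[OF V] by blast+
    then have m: "?m > 0" by simp
    have "?m * (\<Sum>x\<in>R. \<bar>?D a b x (x a) (x b)\<bar>) = (\<Sum>x\<in>R. \<Sum>y\<in>?c a. \<Sum>z\<in>?c b. \<bar>?D a b x y z\<bar>)"
      using sum_PiE_resample2[OF I PI(1,2)[OF ab], where V="?c" and f="\<lambda>x. \<bar>?D a b x (x a) (x b)\<bar>"] PI(3)[OF ab]
      by (simp add: dens_change_upd R_def)
    also have "\<dots> = (\<Sum>x\<in>R. ?m * dens ?V (\<lambda>y z. \<bar>?D a b x y z\<bar>) S (\<psi> a) (\<psi> b))"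
      using cpos by (intro sum.cong refl) (simp add: dens_eq)
    also have "\<dots> \<le> (\<Sum>x\<in>R. ?m * \<eta>)"
    proof (intro sum_mono mult_left_mono)
      fix x
      show "dens ?V (\<lambda>y z. \<bar>?D a b x y z\<bar>) S (\<psi> a) (\<psi> b) \<le> \<eta>"
        using reg[OF ab, unfolded regular_pair_def, THEN spec, of "nbhd G ` x ` (?I - {a, b})"]
          card_cut_le[OF I, of G x a b] I by (simp add: cut_family_def dens_change_def)
    qed simp
    finally have "?m * (\<Sum>x\<in>R. \<bar>?D a b x (x a) (x b)\<bar>) \<le> ?m * (\<eta> * card R)" by (simp add: mult_ac)
    then show "(\<Sum>x\<in>R. \<bar>?D a b x (x a) (x b)\<bar>) \<le> \<eta> * card R" using m by (simp only: mult_le_cancel_left_pos)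
  qed
  finally show ?thesis by (simp add: cR left_diff_distrib)
qed

lemma low_density_pairs:
  assumes G: "finite (verts G)" and \<tau>: "\<tau> \<ge> 0"
  shows "card {(x, y) \<in> verts G \<times> verts G. {x, y} \<in> edges G \<and> dens (verts G) (adj G) S x y < \<tau>} \<le> \<tau> * real (card (verts G)) ^ 2"
proof -
  let ?V = "verts G" and ?d = "dens (verts G) (adj G) S"
  let ?u = "\<lambda>x y. of_bool (?d x y < \<tau>) :: real"
  have st: "step_fun ?V S ?u" unfolding step_fun_def
  proof (intro ballI impI)
    fix x x' y y' assume "cell ?V S x = cell ?V S x'" "cell ?V S y = cell ?V S y'"
    then have "?d x y = ?d x' y'" by (rule dens_cell_cong)
    then show "?u x y = ?u x' y'" by simp
  qed
  have "real (card {(x, y) \<in> ?V \<times> ?V. {x, y} \<in> edges G \<and> ?d x y < \<tau>})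
     = (\<Sum>p\<in>?V \<times> ?V. of_bool ({fst p, snd p} \<in> edges G \<and> ?d (fst p) (snd p) < \<tau>))"
    using G by (simp add: Int_def case_prod_unfold conj_assoc mem_Times_iff)
  also have "\<dots> = (\<Sum>x\<in>?V. \<Sum>y\<in>?V. adj G x y * ?u x y)"
    unfolding sum.cartesian_product by (intro sum.cong refl) (auto simp: adj_def)
  also have "\<dots> = (\<Sum>x\<in>?V. \<Sum>y\<in>?V. ?d x y * ?u x y)" by (simp add: dens_proj[OF G st])
  also have "\<dots> \<le> (\<Sum>x\<in>?V. \<Sum>y\<in>?V. \<tau>)" by (intro sum_mono) (use \<tau> in auto)
  finally show ?thesis by (simp add: power2_eq_square algebra_simps)
qed

section \<open>Regular pairs and the graph removal lemma\<close>

lemma dens_commute: "(\<And>x y. g x y = g y x) \<Longrightarrow> dens V g S x y = dens V g S y x"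
  unfolding dens_eq by (subst sum.swap) (simp add: mult.commute)

lemma dens_mono:
  assumes "\<And>x' y'. x' \<in> cell V S x \<Longrightarrow> y' \<in> cell V S y \<Longrightarrow> f x' y' \<le> g x' y'"
  shows "dens V f S x y \<le> dens V g S x y"
  unfolding dens_eq by (intro divide_right_mono sum_mono assms) auto

lemma dens_nonneg: "(\<And>x' y'. 0 \<le> f x' y') \<Longrightarrow> 0 \<le> dens V f S x y"
  unfolding dens_eq by (intro divide_nonneg_nonneg sum_nonneg) auto

lemma dens_affine:
  assumes "finite V" "x \<in> V" "y \<in> V"
  shows "dens V (\<lambda>x y. c * f x y - d) S x y = c * dens V f S x y - d"
  using card_cell_pos[OF assms(1,2), of S] card_cell_pos[OF assms(1,3), of S]
  unfolding dens_eq by (simp add: sum_subtractf sum_distrib_left[symmetric] field_simps)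

text \<open>The local form, on one pair of cells, of the fact that refining increases the energy gain.\<close>

lemma dens_square_refine_mono:
  assumes V: "finite V" "x \<in> V" "y \<in> V" and S: "S \<subseteq> S'" "S' \<subseteq> S''"
  shows "dens V (\<lambda>y z. (dens V g S' y z - dens V g S y z)\<^sup>2) S x y
     \<le> dens V (\<lambda>y z. (dens V g S'' y z - dens V g S y z)\<^sup>2) S x y"
proof -
  let ?w = "\<lambda>y' z'. of_bool (y' \<in> cell V S x \<and> z' \<in> cell V S y) :: real"
  have st: "step_fun V S ?w" unfolding step_fun_def by (auto simp: mem_cell_iff)
  have *: "(\<Sum>x'\<in>V. \<Sum>y'\<in>V. ?w x' y' * f x' y') = (\<Sum>x'\<in>cell V S x. \<Sum>y'\<in>cell V S y. f x' y')" for f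
  proof -
    have "(\<Sum>x'\<in>V. \<Sum>y'\<in>V. ?w x' y' * f x' y') = (\<Sum>x'\<in>V. if x' \<in> cell V S x then \<Sum>y'\<in>V. if y' \<in> cell V S y then f x' y' else 0 else 0)"
      by (intro sum.cong refl) (auto intro!: sum.cong)
    also have "\<dots> = (\<Sum>x'\<in>V \<inter> cell V S x. \<Sum>y'\<in>V. if y' \<in> cell V S y then f x' y' else 0)"
      by (rule sum.inter_restrict[OF V(1), symmetric])
    also have "\<dots> = (\<Sum>x'\<in>V \<inter> cell V S x. \<Sum>y'\<in>V \<inter> cell V S y. f x' y')"
      by (intro sum.cong refl sum.inter_restrict[OF V(1), symmetric])
    finally show ?thesis using cell_sub[of V S] by (simp add: Int_absorb1)
  qed
  show ?thesis
    using dens_refine_mono[OF V(1) S st, of g] unfolding * dens_eq[of V _ S x y]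
    by (intro divide_right_mono) auto
qed

text \<open>A witness of irregularity changes the density by more than \<open>\<eta>\<close> on average, hence by more
  than \<open>\<eta>\<^sup>2\<close> in mean square, and keeps doing so after further refinement. Adding the
  witnesses of all pairs of cells, at most \<open>h\<close> cuts for each of \<open>4 ^ card S\<close> pairs,
  collects all these gains simultaneously.\<close>

lemma irregular_pairs_le:
  fixes \<eta> \<Gamma> :: real
  assumes V: "finite (verts G)" and S: "finite S" and \<eta>: "\<eta> > 0"
    and stable: "\<And>W. finite W \<Longrightarrow> card W \<le> h * 4 ^ card S \<Longrightarrow>
      energy (verts G) (adj G) (S \<union> W) \<le> energy (verts G) (adj G) S + \<Gamma>"
  shows "\<eta>\<^sup>2 * card {(x, y) \<in> verts G \<times> verts G. \<not> regular_pair G S h \<eta> x y} \<le> \<Gamma>"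
proof -
  let ?V = "verts G" and ?d = "\<lambda>S. dens (verts G) (adj G) S"
  let ?C = "cell ?V S ` ?V"
  let ?dev = "\<lambda>W. \<lambda>y z. \<bar>?d (S \<union> W) y z - ?d S y z\<bar>"
  have "\<forall>t. \<exists>W. finite W \<and> card W \<le> h \<and> (\<forall>x\<in>?V. \<forall>y\<in>?V. (cell ?V S x, cell ?V S y) = t \<longrightarrow>
      \<not> regular_pair G S h \<eta> x y \<longrightarrow> dens ?V (?dev W) S x y > \<eta>)"
  proof
    fix t
    show "\<exists>W. finite W \<and> card W \<le> h \<and> (\<forall>x\<in>?V. \<forall>y\<in>?V. (cell ?V S x, cell ?V S y) = t \<longrightarrow>
      \<not> regular_pair G S h \<eta> x y \<longrightarrow> dens ?V (?dev W) S x y > \<eta>)"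
    proof (cases "\<exists>x\<in>?V. \<exists>y\<in>?V. (cell ?V S x, cell ?V S y) = t \<and> \<not> regular_pair G S h \<eta> x y")
      case True
      then obtain x y W where 1: "(cell ?V S x, cell ?V S y) = t" "finite W" "card W \<le> h"
          "dens ?V (?dev W) S x y > \<eta>"
        unfolding regular_pair_def by fastforce
      have "dens ?V (?dev W) S x' y' > \<eta>" if "(cell ?V S x', cell ?V S y') = t" for x' y'
        using 1 that dens_cell_cong[of ?V S x' x y' y "?dev W"] by auto
      then show ?thesis using 1 by blast
    next
      case False
      then show ?thesis by (intro exI[of _ "{}"]) auto
    qed
  qed
  from choice[OF this] obtain W where W0: "\<forall>t. finite (W t) \<and> card (W t) \<le> h \<and>
      (\<forall>x\<in>?V. \<forall>y\<in>?V. (cell ?V S x, cell ?V S y) = t \<longrightarrow>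
      \<not> regular_pair G S h \<eta> x y \<longrightarrow> dens ?V (?dev (W t)) S x y > \<eta>)" ..
  have W: "\<And>t. finite (W t)" "\<And>t. card (W t) \<le> h"
    using W0 by blast+
  have W3: "dens ?V (?dev (W (cell ?V S x, cell ?V S y))) S x y > \<eta>"
    if "x \<in> ?V" "y \<in> ?V" "\<not> regular_pair G S h \<eta> x y" for x y
    using W0 that by simp
  define U where "U = (\<Union>t\<in>?C \<times> ?C. W t)"
  have fC: "finite ?C" using V by simp
  have finU: "finite U" using V W(1) by (auto simp: U_def)
  have "card U \<le> (\<Sum>t\<in>?C \<times> ?C. card (W t))" unfolding U_def using fC by (intro card_UN_le) auto
  also have "\<dots> \<le> (\<Sum>t\<in>?C \<times> ?C. h)" by (intro sum_mono W(2))
  also have "\<dots> = card ?C * card ?C * h" using fC by (simp add: card_cartesian_product)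
  also have "\<dots> \<le> 2 ^ card S * 2 ^ card S * h"
    by (intro mult_right_mono mult_mono card_cells_le S) auto
  also have "\<dots> = h * 4 ^ card S" by (simp add: power_mult_distrib[symmetric])
  finally have st: "energy ?V (adj G) (S \<union> U) \<le> energy ?V (adj G) S + \<Gamma>" by (rule stable[OF finU])
  let ?f = "\<lambda>y z. (?d (S \<union> U) y z - ?d S y z)\<^sup>2"
  have pt: "\<eta>\<^sup>2 * of_bool (\<not> regular_pair G S h \<eta> x y) \<le> dens ?V ?f S x y" if xy: "x \<in> ?V" "y \<in> ?V" for x y
  proof (cases "regular_pair G S h \<eta> x y")
    case True
    then show ?thesis by (simp add: dens_nonneg)
  next
    case False
    let ?W = "W (cell ?V S x, cell ?V S y)"
    have "\<eta>\<^sup>2 < 2 * \<eta> * dens ?V (?dev ?W) S x y - \<eta>\<^sup>2"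
      using W3[OF xy False] \<eta> by (simp add: power2_eq_square)
    also have "\<dots> = dens ?V (\<lambda>y z. 2 * \<eta> * ?dev ?W y z - \<eta>\<^sup>2) S x y"
      by (rule dens_affine[OF V xy, symmetric])
    also have "\<dots> \<le> dens ?V (\<lambda>y z. (?d (S \<union> ?W) y z - ?d S y z)\<^sup>2) S x y"
    proof (rule dens_mono)
      fix y z
      have "0 \<le> (?dev ?W y z - \<eta>)\<^sup>2" by simp
      then show "2 * \<eta> * ?dev ?W y z - \<eta>\<^sup>2 \<le> (?d (S \<union> ?W) y z - ?d S y z)\<^sup>2"
        by (simp add: power2_diff algebra_simps)
    qed
    also have "\<dots> \<le> dens ?V ?f S x y"
      using xy by (intro dens_square_refine_mono[OF V xy]) (auto simp: U_def)
    finally show ?thesis using False by simp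
  qed
  have "\<eta>\<^sup>2 * card {(x, y) \<in> ?V \<times> ?V. \<not> regular_pair G S h \<eta> x y}
     = (\<Sum>p\<in>?V \<times> ?V. \<eta>\<^sup>2 * of_bool (\<not> regular_pair G S h \<eta> (fst p) (snd p)))"
    using V by (simp add: Int_def case_prod_unfold conj_assoc mem_Times_iff sum_distrib_left[symmetric])
  also have "\<dots> = (\<Sum>x\<in>?V. \<Sum>y\<in>?V. \<eta>\<^sup>2 * of_bool (\<not> regular_pair G S h \<eta> x y))"
    unfolding sum.cartesian_product by (intro sum.cong refl) auto
  also have "\<dots> \<le> (\<Sum>x\<in>?V. \<Sum>y\<in>?V. dens ?V ?f S x y)" by (intro sum_mono pt)
  also have "\<dots> = (\<Sum>x\<in>?V. \<Sum>y\<in>?V. ?f x y)"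
    using dens_proj[OF V, of S "\<lambda>_ _. 1" ?f] by (simp add: step_fun_def)
  also have "\<dots> = energy ?V (adj G) (S \<union> U) - energy ?V (adj G) S"
    by (rule energy_gain[OF V]) auto
  finally show ?thesis using st by linarith
qed

lemma small_cells_le:
  fixes b :: real
  assumes V: "finite V" and S: "finite S" and b: "b \<ge> 0"
  shows "card {x \<in> V. card (cell V S x) < b} \<le> 2 ^ card S * b"
proof -
  let ?C = "{c \<in> cell V S ` V. card c < b}"
  have fC: "finite ?C" using V by simp
  have "{x \<in> V. card (cell V S x) < b} \<subseteq> \<Union>?C" using cell_self by fastforce
  then have "card {x \<in> V. card (cell V S x) < b} \<le> card (\<Union>?C)"
    using fC finite_cell[OF V] by (intro card_mono) auto
  also have "\<dots> \<le> (\<Sum>c\<in>?C. card c)" by (rule card_Union_le_sum_card)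
  finally have "real (card {x \<in> V. card (cell V S x) < b}) \<le> (\<Sum>c\<in>?C. real (card c))"
    by (simp flip: of_nat_sum)
  also have "\<dots> \<le> (\<Sum>c\<in>?C. b)" by (intro sum_mono) auto
  also have "\<dots> = card ?C * b" by simp
  also have "\<dots> \<le> 2 ^ card S * b"
  proof (intro mult_right_mono b)
    have "card ?C \<le> card (cell V S ` V)" using V by (intro card_mono) auto
    also have "\<dots> \<le> 2 ^ card S" by (rule card_cells_le[OF S])
    finally show "real (card ?C) \<le> 2 ^ card S" by (metis of_nat_le_iff of_nat_numeral of_nat_power)
  qed
  finally show ?thesis .
qed

lemma card_edges_le_pairs:
  assumes "finite B" "E \<subseteq> (\<lambda>(x, y). {x, y}) ` B"
  shows "card E \<le> card B"
  by (rule le_trans[OF card_mono[OF _ assms(2)] card_image_le]) (use assms(1) in auto)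

text \<open>Remove the edges in irregular pairs, in sparse pairs, and at small cells. A homomorphism that survives runs
  through regular and dense pairs of large cells, so by \<open>homs_ge_regular\<close> it is accompanied by a
  positive proportion of all \<open>n ^ h\<close> tuples.\<close>

theorem graph_removal_lemma:
  fixes H :: "'a graph" and \<epsilon> :: real
  assumes H: "simple_graph H" "edges H \<noteq> {}" "\<And>i. i \<in> verts H \<Longrightarrow> \<exists>j. {i, j} \<in> edges H" and \<epsilon>: "\<epsilon> > 0"
  shows "\<exists>\<delta>>0. \<forall>G :: 'v graph. simple_graph G \<and>
     real (card (hom_copies H G)) < \<delta> * real (card (verts G)) ^ card (verts H) \<longrightarrow>
     (\<exists>R\<subseteq>edges G. real (card R) \<le> \<epsilon> * real (card (verts G)) ^ 2 \<and> hom_free H (remove_edges G R))"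
proof -
  obtain P where P: "orientation H P" using exists_orientation[OF H(1)] by blast
  have finP: "finite P" by (rule finite_orientation[OF H(1) P])
  have PI: "\<And>a b. (a, b) \<in> P \<Longrightarrow> a \<in> verts H \<and> b \<in> verts H \<and> {a, b} \<in> edges H"
    using P by (force simp: orientation_def)
  define e where "e = card P"
  define h where "h = card (verts H)"
  define \<tau> where "\<tau> = \<epsilon> / 4"
  define \<eta> where "\<eta> = \<tau> ^ e / (2 * e)"
  define \<Gamma> where "\<Gamma> = \<eta>\<^sup>2 * \<epsilon> / 4"
  define F where "F = (\<lambda>s::nat. h * 4 ^ s)"
  have e0: "e > 0" using finP P H(2) by (auto simp: e_def orientation_def card_gt_0_iff)
  have \<tau>0: "\<tau> > 0" using \<epsilon> by (simp add: \<tau>_def)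
  have \<eta>0: "\<eta> > 0" using \<tau>0 e0 by (simp add: \<eta>_def)
  have \<Gamma>0: "\<Gamma> > 0" using \<eta>0 \<epsilon> by (simp add: \<Gamma>_def)
  have h0: "h > 0" using H by (auto simp: h_def simple_graph_def card_gt_0_iff)
  obtain N :: nat where N: "1 < N * \<Gamma>" using ex_less_of_nat_mult[OF \<Gamma>0] by blast
  \<comment> \<open>This bounds the number of cuts independently of \<open>G\<close>, hence also the size of the cells that may be discarded as small.\<close>
  define s where "s = ((\<lambda>s. s + F s) ^^ N) 0"
  define \<beta> where "\<beta> = \<epsilon> / (8 * 2 ^ s)"
  have \<beta>0: "\<beta> > 0" using \<epsilon> by (simp add: \<beta>_def)
  define \<delta> where "\<delta> = \<tau> ^ e * \<beta> ^ h / (2 * h ^ h)"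
  have \<delta>0: "\<delta> > 0" using \<tau>0 \<beta>0 h0 by (simp add: \<delta>_def)
  show ?thesis
  proof (intro exI[of _ \<delta>] conjI \<delta>0 allI impI, elim conjE)
    fix G :: "'v graph"
    assume G: "simple_graph G" and few: "real (card (hom_copies H G)) < \<delta> * real (card (verts G)) ^ card (verts H)"
    let ?V = "verts G" and ?n = "real (card (verts G))"
    have V: "finite ?V" using G by (simp add: simple_graph_def)
    have n0: "?n > 0"
    proof (rule ccontr)
      assume "\<not> ?n > 0"
      then have "?n ^ card (verts H) = 0" using h0 by (simp add: h_def)
      then show False using few by (metis mult_zero_right not_less of_nat_0_le_iff)
    qed
    have "mono F" by (auto simp: F_def mono_def intro!: mult_left_mono power_increasing)
    moreover have "?n\<^sup>2 < energy ?V (adj G) {} + real N * (\<Gamma> * ?n\<^sup>2)"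
    proof -
      have "?n\<^sup>2 * 1 < ?n\<^sup>2 * (N * \<Gamma>)" using N n0 by (intro mult_strict_left_mono) auto
      then show ?thesis using energy_bounds(1)[where g="adj G" and S="{}", OF V adj_bounds] by (simp add: algebra_simps)
    qed
    ultimately obtain S where S: "finite S" "card S \<le> ((\<lambda>s. s + F s) ^^ N) (card {})"
      "\<forall>W. finite W \<and> card W \<le> F (card S) \<longrightarrow> energy ?V (adj G) (S \<union> W) \<le> energy ?V (adj G) S + \<Gamma> * ?n\<^sup>2"
      using exists_stable_family[where g="adj G" and F=F and T="{}" and \<Gamma>="\<Gamma> * ?n\<^sup>2" and N=N, OF V adj_bounds] \<Gamma>0 n0
      by (auto simp: zero_less_mult_iff)
    have Ss: "card S \<le> s" using S(2) by (simp add: s_def)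
    let ?d = "dens ?V (adj G) S"
    define B1 where "B1 = {(x, y) \<in> ?V \<times> ?V. \<not> regular_pair G S h \<eta> x y}"
    define B2 where "B2 = {(x, y) \<in> ?V \<times> ?V. {x, y} \<in> edges G \<and> ?d x y < \<tau>}"
    define small where "small = {x \<in> ?V. card (cell ?V S x) < \<beta> * ?n}"
    define B where "B = B1 \<union> B2 \<union> small \<times> ?V \<union> ?V \<times> small"
    define R where "R = edges G \<inter> (\<lambda>(x, y). {x, y}) ` B"
    have fin: "finite B1" "finite B2" "finite small" "finite B"
      using V finite_subset[of B1 "?V \<times> ?V"] finite_subset[of B2 "?V \<times> ?V"]
      by (auto simp: B1_def B2_def small_def B_def)
    have c1: "card B1 \<le> \<epsilon> / 4 * ?n\<^sup>2"
    proof -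
      have "\<eta>\<^sup>2 * card B1 \<le> \<Gamma> * ?n\<^sup>2"
        unfolding B1_def by (rule irregular_pairs_le[OF V S(1) \<eta>0]) (use S(3) in \<open>auto simp: F_def\<close>)
      then have "\<eta>\<^sup>2 * card B1 \<le> \<eta>\<^sup>2 * (\<epsilon> / 4 * ?n\<^sup>2)" by (simp add: \<Gamma>_def)
      then show ?thesis using \<eta>0 by (simp add: mult_le_cancel_left)
    qed
    have c2: "card B2 \<le> \<epsilon> / 4 * ?n\<^sup>2"
      unfolding B2_def using low_density_pairs[OF V, of \<tau> S] \<tau>0 by (simp add: \<tau>_def)
    have c3: "card small \<le> \<epsilon> / 8 * ?n"
    proof -
      have "card small \<le> 2 ^ card S * (\<beta> * ?n)"
        unfolding small_def using \<beta>0 by (intro small_cells_le V S(1)) simp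
      also have "\<dots> \<le> 2 ^ s * (\<beta> * ?n)" using \<beta>0 Ss by (intro mult_right_mono power_increasing) auto
      also have "\<dots> = \<epsilon> / 8 * ?n" by (simp add: \<beta>_def)
      finally show ?thesis .
    qed
    have "card R \<le> card B" using fin by (intro card_edges_le_pairs) (auto simp: R_def)
    also have "\<dots> \<le> card B1 + card B2 + card small * card ?V + card ?V * card small"
      unfolding B_def using card_Un_le[of B1 B2] card_Un_le[of "B1 \<union> B2" "small \<times> ?V"]
        card_Un_le[of "B1 \<union> B2 \<union> small \<times> ?V" "?V \<times> small"]
      by (simp add: card_cartesian_product)
    finally have "real (card R) \<le> card B1 + card B2 + card small * ?n + ?n * card small"
      by (simp flip: of_nat_mult of_nat_add)
    also have "\<dots> \<le> \<epsilon> / 4 * ?n\<^sup>2 + \<epsilon> / 4 * ?n\<^sup>2 + \<epsilon> / 8 * ?n * ?n + ?n * (\<epsilon> / 8 * ?n)"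
      using c1 c2 c3 by (intro add_mono mult_right_mono mult_left_mono) auto
    also have "\<dots> \<le> \<epsilon> * ?n\<^sup>2" using \<epsilon> by (simp add: power2_eq_square)
    finally have cR: "real (card R) \<le> \<epsilon> * ?n\<^sup>2" .
    have free: "hom_free H (remove_edges G R)"
    proof (rule ccontr)
      assume "\<not> hom_free H (remove_edges G R)"
      then obtain \<psi> where \<psi>: "is_hom \<psi> H (remove_edges G R)" by (auto simp: hom_free_def)
      have \<psi>V: "\<psi> \<in> verts H \<rightarrow> ?V" using \<psi> by (auto simp: is_hom_def remove_edges_def)
      have good: "{\<psi> a, \<psi> b} \<in> edges G \<and> (\<psi> a, \<psi> b) \<notin> B" if "{a, b} \<in> edges H" for a b
        using is_hom_edge[OF \<psi> that] by (auto simp: remove_edges_def R_def)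
      have goodP: "regular_pair G S h \<eta> (\<psi> a) (\<psi> b) \<and> \<tau> \<le> ?d (\<psi> a) (\<psi> b) \<and> \<psi> a \<notin> small" if "(a, b) \<in> P" for a b
        using good[of a b] PI[OF that] \<psi>V by (auto simp: B_def B1_def B2_def)
      have big: "\<beta> * ?n \<le> card (cell ?V S (\<psi> i))" if "i \<in> verts H" for i
      proof -
        obtain j where "{i, j} \<in> edges H" using H(3)[OF \<open>i \<in> verts H\<close>] by blast
        then have "{\<psi> i, \<psi> j} \<in> edges G" "(\<psi> i, \<psi> j) \<notin> B" using good by blast+
        then show ?thesis using simple_edge_verts[OF G, of "\<psi> i" "\<psi> j"] by (auto simp: B_def small_def)
      qed
      have Ge: "\<tau> ^ e - e * \<eta> = \<tau> ^ e / 2" using e0 by (simp add: \<eta>_def)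
      have "(\<tau> ^ e / 2) * (\<beta> * ?n) ^ h = (\<tau> ^ e / 2) * (\<Prod>i\<in>verts H. \<beta> * ?n)" by (simp add: h_def)
      also have "\<dots> \<le> (\<tau> ^ e / 2) * (\<Prod>i\<in>verts H. real (card (cell ?V S (\<psi> i))))"
        using \<tau>0 \<beta>0 big by (intro mult_left_mono prod_mono) auto
      also have "\<dots> = (\<tau> ^ card P - card P * \<eta>) * (\<Prod>i\<in>verts H. card (cell ?V S (\<psi> i)))"
        using Ge by (simp add: e_def)
      also have "\<dots> \<le> card (hom_set H G)"
        by (rule homs_ge_regular[OF H(1) G P _ \<psi>V]) (use goodP \<tau>0 in \<open>auto simp: h_def\<close>)
      also have "\<dots> \<le> real (card (hom_copies H G)) * h ^ h"
        using card_hom_set_le[OF H(1) G] unfolding h_def by (metis of_nat_le_iff of_nat_mult)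
      also have "\<dots> < \<delta> * ?n ^ h * h ^ h"
        using few h0 by (intro mult_strict_right_mono) (auto simp: h_def)
      also have "\<dots> = (\<tau> ^ e / 2) * (\<beta> * ?n) ^ h"
        using h0 by (simp add: \<delta>_def power_mult_distrib)
      finally show False by simp
    qed
    show "\<exists>R\<subseteq>edges G. real (card R) \<le> \<epsilon> * ?n\<^sup>2 \<and> hom_free H (remove_edges G R)"
      using cR free by (intro exI[of _ R]) (auto simp: R_def)
  qed
qed

section \<open>From removal to approximate homomorphisms\<close>

text \<open>Edges inside a cell cannot be represented in a simple graph whose vertices are the cells; starting from
  \<open>m\<close> blocks of almost equal size makes them few.\<close>

lemma exists_small_blocks:
  assumes V: "finite V" and m: "m > 0"
  shows "\<exists>S. finite S \<and> card S \<le> m \<and> (\<forall>x\<in>V. m * (card (cell V S x) - 1) \<le> card V)"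
proof -
  obtain f where f: "bij_betw f V {0..<card V}" using ex_bij_betw_finite_nat[OF V] by blast
  define S where "S = (\<lambda>c. {x \<in> V. f x mod m = c}) ` {..<m}"
  have fin: "finite S" by (simp add: S_def)
  have "card S \<le> card {..<m}" unfolding S_def by (rule card_image_le) simp
  then have cS: "card S \<le> m" by simp
  have "m * (card (cell V S x) - 1) \<le> card V" if x: "x \<in> V" for x
  proof -
    let ?c = "f x mod m"
    have sub: "cell V S x \<subseteq> {y \<in> V. f y mod m = ?c}"
      using m x by (auto simp: cell_def S_def)
    have lt: "f y < card V" if "y \<in> V" for y using f that by (auto simp: bij_betw_def)
    have inj: "inj_on (\<lambda>y. f y div m) (cell V S x)"
    proof (rule inj_onI)
      fix y z assume "y \<in> cell V S x" "z \<in> cell V S x" and d: "f y div m = f z div m"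
      then have "y \<in> {y \<in> V. f y mod m = ?c}" "z \<in> {y \<in> V. f y mod m = ?c}" using sub by blast+
      then have "f y mod m = f z mod m" "y \<in> V" "z \<in> V" by auto
      then have "f y = f z" using d by (metis div_mult_mod_eq)
      then show "y = z" using f \<open>y \<in> V\<close> \<open>z \<in> V\<close> by (auto simp: bij_betw_def inj_on_def)
    qed
    have "(\<lambda>y. f y div m) ` cell V S x \<subseteq> {..(card V - 1) div m}"
    proof
      fix t assume "t \<in> (\<lambda>y. f y div m) ` cell V S x"
      then obtain y where "y \<in> cell V S x" and t: "t = f y div m" by auto
      then have "y \<in> V" by (simp add: cell_def)
      then have "f y \<le> card V - 1" using lt[of y] by simp
      then show "t \<in> {..(card V - 1) div m}" using t by (simp add: div_le_mono)
    qed
    from card_mono[OF _ this] have "card (cell V S x) \<le> card {..(card V - 1) div m}"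
      unfolding card_image[OF inj] by simp
    then have "card (cell V S x) - 1 \<le> (card V - 1) div m" by simp
    then have "m * (card (cell V S x) - 1) \<le> m * ((card V - 1) div m)" by simp
    also have "\<dots> \<le> card V - 1" by (rule times_div_less_eq_dividend)
    finally show ?thesis by simp
  qed
  then show ?thesis using fin cS by blast
qed

lemma card_pairs_le_edges:
  assumes "finite R" "\<And>e. e \<in> R \<Longrightarrow> card e = 2"
  shows "finite {(y, z). {y, z} \<in> R}" "card {(y, z). {y, z} \<in> R} \<le> 2 * card R"
proof -
  let ?p = "\<lambda>e. {(y, z). {y, z} = e}"
  have p: "finite (?p e) \<and> card (?p e) \<le> 2" if "e \<in> R" for e
  proof -
    obtain a b where ab: "e = {a, b}" using assms(2)[OF \<open>e \<in> R\<close>] by (auto simp: card_2_iff)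
    have sub: "?p e \<subseteq> {(a, b), (b, a)}" unfolding ab by (auto simp: doubleton_eq_iff)
    have "card (?p e) \<le> card {(a, b), (b, a)}" by (rule card_mono[OF _ sub]) simp
    also have "\<dots> \<le> 2" using card_length[of "[(a, b), (b, a)]"] by simp
    finally show ?thesis using finite_subset[OF sub] by blast
  qed
  have eq: "{(y, z). {y, z} \<in> R} = (\<Union>e\<in>R. ?p e)" by auto
  show "finite {(y, z). {y, z} \<in> R}" unfolding eq using assms(1) p by blast
  have "card {(y, z). {y, z} \<in> R} \<le> (\<Sum>e\<in>R. card (?p e))" unfolding eq by (rule card_UN_le[OF assms(1)])
  also have "\<dots> \<le> (\<Sum>e\<in>R. 2)" using p by (intro sum_mono) auto
  finally show "card {(y, z). {y, z} \<in> R} \<le> 2 * card R" by simp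
qed

text \<open>Representatives of two distinct cells are independent and uniform, so the expected value of \<open>f\<close>
  is its average over the two cells.\<close>

lemma sum_representatives:
  fixes f :: "'v \<Rightarrow> 'v \<Rightarrow> real"
  assumes V: "finite V" and yz: "y \<in> V" "z \<in> V" "cell V S y \<noteq> cell V S z"
  shows "(\<Sum>v\<in>Pi\<^sub>E (cell V S ` V) (\<lambda>c. c). f (v (cell V S y)) (v (cell V S z)))
    = card (Pi\<^sub>E (cell V S ` V) (\<lambda>c. c)) * dens V f S y z"
proof -
  let ?C = "cell V S ` V" and ?a = "cell V S y" and ?b = "cell V S z"
  have pos: "real (card ?a) > 0" "real (card ?b) > 0" using card_cell_pos[OF V] yz by auto
  have "real (card ?a) * (card ?b * (\<Sum>v\<in>Pi\<^sub>E ?C (\<lambda>c. c). f (v ?a) (v ?b)))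
    = (\<Sum>v\<in>Pi\<^sub>E ?C (\<lambda>c. c). \<Sum>y'\<in>?a. \<Sum>z'\<in>?b. f y' z')"
    using sum_PiE_resample2[where I="?C" and a="?a" and b="?b" and V="\<lambda>c. c" and f="\<lambda>v. f (v ?a) (v ?b)"] V yz
    by simp
  also have "\<dots> = card (Pi\<^sub>E ?C (\<lambda>c. c)) * (\<Sum>y'\<in>?a. \<Sum>z'\<in>?b. f y' z')" by simp
  finally show ?thesis using pos by (simp add: dens_eq field_simps)
qed

text \<open>The expected number of pairs \<open>(y, z)\<close> whose representatives span an edge of \<open>R\<close>
  is, by \<open>dens_proj\<close>, the number of pairs that span one themselves.\<close>

lemma exists_good_representatives:
  assumes V: "finite V" and R: "finite R" "\<And>e. e \<in> R \<Longrightarrow> card e = 2"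
  shows "\<exists>v\<in>Pi\<^sub>E (cell V S ` V) (\<lambda>c. c).
     card {(y, z) \<in> V \<times> V. cell V S y \<noteq> cell V S z \<and> {v (cell V S y), v (cell V S z)} \<in> R} \<le> 2 * card R"
proof -
  let ?C = "cell V S ` V" and ?c = "cell V S"
  let ?X = "Pi\<^sub>E ?C (\<lambda>c. c)"
  let ?L = "\<lambda>v. card {(y, z) \<in> V \<times> V. ?c y \<noteq> ?c z \<and> {v (?c y), v (?c z)} \<in> R}"
  let ?f = "\<lambda>y z. of_bool ({y, z} \<in> R) :: real"
  let ?u = "\<lambda>y z. of_bool (?c y \<noteq> ?c z) :: real"
  have fX: "finite ?X" using V finite_cell by (intro finite_PiE) auto
  have neX: "?X \<noteq> {}" using cell_self[of _ V S] by (fastforce simp: PiE_eq_empty_iff)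
  have st: "step_fun V S ?u" by (auto simp: step_fun_def)
  have L: "real (?L v) = (\<Sum>y\<in>V. \<Sum>z\<in>V. ?u y z * ?f (v (?c y)) (v (?c z)))" for v
  proof -
    have "real (?L v) = (\<Sum>p\<in>V \<times> V. of_bool (?c (fst p) \<noteq> ?c (snd p) \<and> {v (?c (fst p)), v (?c (snd p))} \<in> R))"
      using V by (simp add: Int_def case_prod_unfold conj_assoc mem_Times_iff)
    also have "\<dots> = (\<Sum>y\<in>V. \<Sum>z\<in>V. ?u y z * ?f (v (?c y)) (v (?c z)))"
      unfolding sum.cartesian_product by (intro sum.cong refl) auto
    finally show ?thesis .
  qed
  have "(\<Sum>v\<in>?X. real (?L v)) = (\<Sum>y\<in>V. \<Sum>z\<in>V. ?u y z * (\<Sum>v\<in>?X. ?f (v (?c y)) (v (?c z))))"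
    unfolding L sum_distrib_left by (subst sum.swap, intro sum.cong refl, subst sum.swap) (rule refl)
  also have "\<dots> = (\<Sum>y\<in>V. \<Sum>z\<in>V. card ?X * (dens V ?f S y z * ?u y z))"
  proof (intro sum.cong refl)
    fix y z assume yz: "y \<in> V" "z \<in> V"
    show "?u y z * (\<Sum>v\<in>?X. ?f (v (?c y)) (v (?c z))) = card ?X * (dens V ?f S y z * ?u y z)"
      using sum_representatives[OF V yz, of S ?f] by (cases "?c y = ?c z") simp_all
  qed
  also have "\<dots> = card ?X * (\<Sum>y\<in>V. \<Sum>z\<in>V. ?f y z * ?u y z)"
    by (simp only: sum_distrib_left[symmetric] dens_proj[OF V st])
  also have "(\<Sum>y\<in>V. \<Sum>z\<in>V. ?f y z * ?u y z) \<le> (\<Sum>p\<in>V \<times> V. of_bool ({fst p, snd p} \<in> R))"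
    unfolding sum.cartesian_product by (intro sum_mono) auto
  also have "(\<Sum>p\<in>V \<times> V. of_bool ({fst p, snd p} \<in> R)) = real (card (V \<times> V \<inter> {p. {fst p, snd p} \<in> R}))"
    using V by simp
  also have "\<dots> \<le> card {(y, z). {y, z} \<in> R}"
    using card_pairs_le_edges(1)[OF R] by (intro of_nat_mono card_mono) auto
  also have "\<dots> \<le> 2 * card R" using card_pairs_le_edges(2)[OF R] by linarith
  finally have le: "(\<Sum>v\<in>?X. real (?L v)) \<le> card ?X * (2 * card R)" by (simp add: mult_left_mono)
  show ?thesis
  proof (rule ccontr)
    assume "\<not> ?thesis"
    then have "(\<Sum>v\<in>?X. real (2 * card R)) < (\<Sum>v\<in>?X. real (?L v))"
      using fX neX by (intro sum_strict_mono) (auto simp del: of_nat_mult simp: not_le)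
    then show False using le by simp
  qed
qed

text \<open>The final graph lives on one representative per cell and inherits from the reduced graph, after removal,
  that it admits no homomorphism from \<open>H\<close>. An edge of \<open>G\<close> gets lost only if it lies
  inside a cell, or in a sparse pair, or if the representatives of its ends span a removed edge.\<close>

lemma approx_hom_of_removal:
  fixes H :: "'a graph" and G :: "'v graph" and \<epsilon> \<delta> :: real
  assumes H: "simple_graph H" "edges H \<noteq> {}" "verts H \<noteq> {}" and P: "orientation H P"
    and \<epsilon>: "\<epsilon> > 0" and \<delta>: "\<delta> > 0"
    and removal: "\<And>G :: 'v graph. simple_graph G \<Longrightarrow>
        real (card (hom_copies H G)) < \<delta> * real (card (verts G)) ^ card (verts H) \<Longrightarrow>
        \<exists>R\<subseteq>edges G. real (card R) \<le> \<epsilon> / 4 * real (card (verts G)) ^ 2 \<and> hom_free H (remove_edges G R)"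
    and m: "4 \<le> real m * \<epsilon>"
    and N: "2 * real (card P) ^ 2 < real N * \<delta> * (\<epsilon> / 4) ^ (2 * card P)"
    and G: "simple_graph G" "hom_free H G"
  shows "\<exists>(F :: 'v graph) \<phi>. simple_graph F \<and> hom_free H F \<and> card (verts F) \<le> 2 ^ (m + card (verts H) * N) \<and>
     approx_hom \<epsilon> \<phi> G F"
proof (cases "verts G = {}")
  case True
  then have "approx_hom \<epsilon> id G G" using \<epsilon> by (simp add: approx_hom_def)
  then show ?thesis using G True by (intro exI[of _ G] exI[of _ id]) auto
next
  case False
  let ?V = "verts G" and ?n = "real (card (verts G))" and ?h = "card (verts H)"
  define e where "e = card P"
  define \<tau> where "\<tau> = \<epsilon> / 4"
  \<comment> \<open>Chosen so that \<open>cell_tuples_le_energy_gain\<close> bounds the homomorphisms to the reduced graph by \<open>\<delta> / 2\<close> times \<open>n ^ h\<close>.\<close>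
  define \<Gamma> where "\<Gamma> = \<delta> * \<tau> ^ (2 * e) / (2 * (real e)\<^sup>2)"
  have V: "finite ?V" using G by (simp add: simple_graph_def)
  have finP: "finite P" by (rule finite_orientation[OF H(1) P])
  have n0: "?n > 0" using False V by (simp add: card_gt_0_iff)
  have e0: "e > 0" using finP P H(2) by (auto simp: e_def orientation_def card_gt_0_iff)
  have \<tau>0: "\<tau> > 0" using \<epsilon> by (simp add: \<tau>_def)
  have \<Gamma>0: "\<Gamma> > 0" using \<tau>0 e0 \<delta> by (simp add: \<Gamma>_def)
  have m0: "m > 0" using m by (cases m) auto
  obtain S0 where S0: "finite S0" "card S0 \<le> m" "\<And>x. x \<in> ?V \<Longrightarrow> m * (card (cell ?V S0 x) - 1) \<le> card ?V"
    using exists_small_blocks[OF V m0] by blast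
  have "?n\<^sup>2 < energy ?V (adj G) S0 + real N * (\<Gamma> * ?n\<^sup>2)"
  proof -
    have "1 < real N * \<Gamma>" using N e0 by (simp add: \<Gamma>_def e_def \<tau>_def field_simps)
    then have "?n\<^sup>2 * 1 < ?n\<^sup>2 * (N * \<Gamma>)" using n0 by (intro mult_strict_left_mono) auto
    then show ?thesis using energy_bounds(1)[where g="adj G" and S=S0, OF V adj_bounds] by (simp add: algebra_simps)
  qed
  moreover have "\<Gamma> * ?n\<^sup>2 > 0" using \<Gamma>0 n0 by simp
  moreover have "mono (\<lambda>_. ?h)" by (simp add: mono_def)
  ultimately have "\<exists>S. S0 \<subseteq> S \<and> finite S \<and> card S \<le> ((\<lambda>s. s + ?h) ^^ N) (card S0) \<and>
      (\<forall>W. finite W \<and> card W \<le> ?h \<longrightarrow> energy ?V (adj G) (S \<union> W) \<le> energy ?V (adj G) S + \<Gamma> * ?n\<^sup>2)"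
    using exists_stable_family[where g="adj G" and F="\<lambda>_. ?h", OF V adj_bounds _ S0(1)] by blast
  then obtain S where S: "S0 \<subseteq> S" "finite S" "card S \<le> ((\<lambda>s. s + ?h) ^^ N) (card S0)"
      "\<forall>W. finite W \<and> card W \<le> ?h \<longrightarrow> energy ?V (adj G) (S \<union> W) \<le> energy ?V (adj G) S + \<Gamma> * ?n\<^sup>2"
    by blast
  have it: "((\<lambda>s. s + ?h) ^^ N) t = t + ?h * N" for t by (induction N) auto
  have cS: "card S \<le> m + ?h * N" using S(3) S0(2) unfolding it by linarith
  let ?d = "dens ?V (adj G) S" and ?c = "cell ?V S"
  have dsym: "?d x y = ?d y x" for x y
    by (rule dens_commute) (simp add: adj_def insert_commute)
  \<comment> \<open>The reduced graph is kept on the vertices of \<open>G\<close>, so that cells count with their sizes and the removal property applies directly.\<close>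
  define Q where "Q = \<lparr>verts = ?V, edges = {{x, y} | x y. x \<in> ?V \<and> y \<in> ?V \<and> ?c x \<noteq> ?c y \<and> \<tau> \<le> ?d x y}\<rparr>"
  have Qv: "verts Q = ?V" by (simp add: Q_def)
  have Qe: "{x, y} \<in> edges Q \<longleftrightarrow> x \<in> ?V \<and> y \<in> ?V \<and> ?c x \<noteq> ?c y \<and> \<tau> \<le> ?d x y" for x y
  proof
    assume "{x, y} \<in> edges Q"
    then obtain x' y' where "{x, y} = {x', y'}" "x' \<in> ?V" "y' \<in> ?V" "?c x' \<noteq> ?c y'" "\<tau> \<le> ?d x' y'"
      by (auto simp: Q_def)
    then show "x \<in> ?V \<and> y \<in> ?V \<and> ?c x \<noteq> ?c y \<and> \<tau> \<le> ?d x y"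
      using dsym[of x y] by (auto simp: doubleton_eq_iff)
  qed (unfold Q_def, simp, blast)
  have Qs: "simple_graph Q" using V by (auto simp: simple_graph_def Q_def card_insert_if)
  have Qfew: "real (card (hom_copies H Q)) < \<delta> * real (card (verts Q)) ^ ?h"
  proof -
    have PI: "\<And>a b. (a, b) \<in> P \<Longrightarrow> a \<in> verts H \<and> b \<in> verts H" using P by (force simp: orientation_def)
    have ho: "x \<in> hom_set H Q \<longleftrightarrow> x \<in> verts H \<rightarrow>\<^sub>E ?V \<and> (\<forall>(a, b)\<in>P. ?c (x a) \<noteq> ?c (x b) \<and> \<tau> \<le> ?d (x a) (x b))" for x
    proof (cases "x \<in> verts H \<rightarrow>\<^sub>E ?V")
      case True
      then have "{x a, x b} \<in> edges Q \<longleftrightarrow> ?c (x a) \<noteq> ?c (x b) \<and> \<tau> \<le> ?d (x a) (x b)" if "(a, b) \<in> P" for a b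
        using PI[OF that] unfolding Qe by blast
      then show ?thesis
        using True is_hom_orientation[OF P, of x Q] unfolding hom_set_def Qv by blast
    qed (simp add: hom_set_def Qv)
    have "\<tau> ^ (2 * card P) * card (hom_set H Q) \<le> (card P)\<^sup>2 * \<Gamma> * ?n ^ ?h"
    proof (rule cell_tuples_le_energy_gain[OF H(1,2) G P False \<tau>0])
      show "hom_set H Q \<subseteq> verts H \<rightarrow>\<^sub>E ?V" by (auto simp: hom_set_def Qv)
      show "\<tau> \<le> ?d (x a) (x b)" if "x \<in> hom_set H Q" "(a, b) \<in> P" for x a b
        using that ho by auto
      show "energy ?V (adj G) (S \<union> W) \<le> energy ?V (adj G) S + \<Gamma> * ?n\<^sup>2" if "finite W" "card W \<le> ?h" for W
        using S(4) that by blast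
      fix x x' assume x: "x \<in> hom_set H Q" "x' \<in> verts H \<rightarrow>\<^sub>E ?V" "\<And>i. i \<in> verts H \<Longrightarrow> ?c (x i) = ?c (x' i)"
      have "?c (x' a) \<noteq> ?c (x' b) \<and> \<tau> \<le> ?d (x' a) (x' b)" if ab: "(a, b) \<in> P" for a b
      proof -
        have "?d (x a) (x b) = ?d (x' a) (x' b)" by (intro dens_cell_cong x(3)) (use PI[OF ab] in auto)
        then show ?thesis using x(1) ab x(3)[of a] x(3)[of b] PI[OF ab] ho[of x] by auto
      qed
      then show "x' \<in> hom_set H Q" using x(2) ho by auto
    qed
    also have "\<dots> = \<tau> ^ (2 * e) * (\<delta> / 2 * ?n ^ ?h)" using e0 by (simp add: \<Gamma>_def e_def)
    finally have "card (hom_set H Q) \<le> \<delta> / 2 * ?n ^ ?h" using \<tau>0 by (simp add: e_def)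
    moreover have "real (card (hom_copies H Q)) \<le> card (hom_set H Q)" using card_hom_copies_le[OF H(1) Qs] by simp
    moreover have "\<delta> / 2 * ?n ^ ?h < \<delta> * ?n ^ ?h" using \<delta> n0 by simp
    ultimately show ?thesis unfolding Qv by linarith
  qed
  from removal[OF Qs Qfew] obtain R where R: "R \<subseteq> edges Q" "real (card R) \<le> \<epsilon> / 4 * ?n\<^sup>2" "hom_free H (remove_edges Q R)"
    unfolding Qv by blast
  have finR: "finite R" using R(1) finite_edges[OF Qs] finite_subset by blast
  have R2: "card f = 2" if "f \<in> R" for f using that R(1) Qs by (auto simp: simple_graph_def)
  obtain v where v: "v \<in> Pi\<^sub>E (?c ` ?V) (\<lambda>c. c)"
      and vL: "card {(y, z) \<in> ?V \<times> ?V. ?c y \<noteq> ?c z \<and> {v (?c y), v (?c z)} \<in> R} \<le> 2 * card R"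
    using exists_good_representatives[OF V finR R2] by blast
  have vc: "v (?c x) \<in> ?V \<and> ?c (v (?c x)) = ?c x" if "x \<in> ?V" for x
    using v that by (auto simp: PiE_iff mem_cell_iff)
  define \<phi> where "\<phi> = (\<lambda>x. v (?c x))"
  define F where "F = \<lparr>verts = \<phi> ` ?V, edges = {f \<in> edges Q - R. f \<subseteq> \<phi> ` ?V}\<rparr>"
  have "simple_graph F" using Qs V by (auto simp: simple_graph_def F_def)
  moreover have "hom_free H F"
  proof -
    have "is_hom \<psi> H (remove_edges Q R)" if "is_hom \<psi> H F" for \<psi>
      by (rule is_hom_mono[OF that]) (use vc in \<open>auto simp: F_def \<phi>_def remove_edges_def Qv\<close>)
    then show ?thesis using R(3) by (auto simp: hom_free_def)
  qed
  moreover have "card (verts F) \<le> 2 ^ (m + ?h * N)"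
  proof -
    have "card (verts F) \<le> card (?c ` ?V)"
      using V card_image_le[of "?c ` ?V" v] by (simp add: F_def \<phi>_def image_image)
    also have "\<dots> \<le> 2 ^ card S" by (rule card_cells_le[OF S(2)])
    also have "\<dots> \<le> 2 ^ (m + ?h * N)" using cS by (intro power_increasing) auto
    finally show ?thesis .
  qed
  moreover have "approx_hom \<epsilon> \<phi> G F"
  proof -
    define A1 where "A1 = {(x, y) \<in> ?V \<times> ?V. x \<noteq> y \<and> ?c x = ?c y}"
    define A2 where "A2 = {(x, y) \<in> ?V \<times> ?V. {x, y} \<in> edges G \<and> ?d x y < \<tau>}"
    define A3 where "A3 = {(y, z) \<in> ?V \<times> ?V. ?c y \<noteq> ?c z \<and> {v (?c y), v (?c z)} \<in> R}"
    have fin: "finite A1" "finite A2" "finite A3"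
      using V by (auto simp: A1_def A2_def A3_def intro: finite_subset[of _ "?V \<times> ?V"])
    have "{f \<in> edges G. \<phi> ` f \<notin> edges F} \<subseteq> (\<lambda>(x, y). {x, y}) ` (A1 \<union> A2 \<union> A3)"
    proof
      fix f assume f: "f \<in> {f \<in> edges G. \<phi> ` f \<notin> edges F}"
      then obtain x y where xy: "f = {x, y}" "x \<noteq> y" "x \<in> ?V" "y \<in> ?V" using simple_edgeE[OF G(1)] by blast
      have "(x, y) \<in> A1 \<union> A2 \<union> A3"
      proof (rule ccontr)
        assume no: "(x, y) \<notin> A1 \<union> A2 \<union> A3"
        have 1: "?c x \<noteq> ?c y" using no xy by (auto simp: A1_def)
        have 2: "\<tau> \<le> ?d x y" using no xy f by (auto simp: A2_def)
        have 3: "{\<phi> x, \<phi> y} \<notin> R" using no xy 1 by (auto simp: A3_def \<phi>_def)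
        have "?d (\<phi> x) (\<phi> y) = ?d x y" using vc xy by (intro dens_cell_cong) (auto simp: \<phi>_def)
        then have "{\<phi> x, \<phi> y} \<in> edges Q" using 1 2 vc xy by (simp add: Qe \<phi>_def)
        then have "\<phi> ` f \<in> edges F" using 3 xy by (simp add: F_def)
        then show False using f by simp
      qed
      then show "f \<in> (\<lambda>(x, y). {x, y}) ` (A1 \<union> A2 \<union> A3)" unfolding xy(1) by (intro image_eqI[of _ _ "(x, y)"]) auto
    qed
    then have "card {f \<in> edges G. \<phi> ` f \<notin> edges F} \<le> card (A1 \<union> A2 \<union> A3)"
      using fin by (intro card_edges_le_pairs) auto
    also have "\<dots> \<le> card A1 + card A2 + card A3"
      using card_Un_le[of A1 A2] card_Un_le[of "A1 \<union> A2" A3] by linarith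
    finally have "real (card {f \<in> edges G. \<phi> ` f \<notin> edges F}) \<le> real (card A1) + card A2 + card A3" by linarith
    moreover have "real (card A1) \<le> \<epsilon> / 4 * ?n\<^sup>2"
    proof -
      have "A1 = (\<Union>x\<in>?V. Pair x ` (?c x - {x}))" by (auto simp: A1_def mem_cell_iff)
      then have "card A1 \<le> (\<Sum>x\<in>?V. card (Pair x ` (?c x - {x})))" using card_UN_le[OF V] by metis
      also have "\<dots> = (\<Sum>x\<in>?V. card (?c x) - 1)"
        by (intro sum.cong refl) (simp add: card_image inj_on_def card_Diff_singleton cell_self)
      finally have "m * card A1 \<le> m * (\<Sum>x\<in>?V. card (?c x) - 1)" by simp
      also have "\<dots> = (\<Sum>x\<in>?V. m * (card (?c x) - 1))" by (simp add: sum_distrib_left)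
      also have "\<dots> \<le> (\<Sum>x\<in>?V. card ?V)"
      proof (rule sum_mono)
        fix x assume x: "x \<in> ?V"
        have "?c x \<subseteq> cell ?V S0 x" using S(1) by (auto simp: cell_def)
        then have "card (?c x) \<le> card (cell ?V S0 x)" by (rule card_mono[OF finite_cell[OF V]])
        then have "m * (card (?c x) - 1) \<le> m * (card (cell ?V S0 x) - 1)" by (intro mult_left_mono diff_le_mono) auto
        then show "m * (card (?c x) - 1) \<le> card ?V" using S0(3)[OF x] by linarith
      qed
      finally have "real m * real (card A1) \<le> ?n\<^sup>2"
        by (simp add: power2_eq_square flip: of_nat_mult)
      have "4 * real (card A1) \<le> (real m * \<epsilon>) * real (card A1)" using m by (intro mult_right_mono) auto
      also have "\<dots> = \<epsilon> * (real m * real (card A1))" by simp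
      also have "\<dots> \<le> \<epsilon> * ?n\<^sup>2" using \<open>real m * real (card A1) \<le> ?n\<^sup>2\<close> \<epsilon> by (intro mult_left_mono) auto
      finally show ?thesis by simp
    qed
    moreover have "real (card A2) \<le> \<epsilon> / 4 * ?n\<^sup>2"
      unfolding A2_def using low_density_pairs[OF V, of \<tau> S] \<tau>0 by (simp add: \<tau>_def)
    moreover have "real (card A3) \<le> 2 * (\<epsilon> / 4 * ?n\<^sup>2)"
      using vL R(2) unfolding A3_def by linarith
    ultimately show ?thesis by (simp add: approx_hom_def F_def)
  qed
  ultimately show ?thesis by blast
qed

section \<open>The core\<close>

lemma is_hom_id: "is_hom id H H" by (simp add: is_hom_def)

text \<open>Among the endomorphic images with the fewest vertices, one with the fewest edges also has the fewest edges
  among all images: any other image \<open>K'\<close> maps onto a subgraph of it, which has the same number of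
  vertices.\<close>

lemma exists_is_core:
  assumes H: "simple_graph H" shows "\<exists>K. is_core K H"
proof -
  have fin: "finite (verts H)" "finite (edges H)" using H finite_edges by (auto simp: simple_graph_def)
  define a where "a = (LEAST n. \<exists>\<phi>. is_hom \<phi> H H \<and> card (\<phi> ` verts H) = n)"
  have ex: "\<exists>n. \<exists>\<phi>. is_hom \<phi> H H \<and> card (\<phi> ` verts H) = n" using is_hom_id by blast
  have a: "\<exists>\<phi>. is_hom \<phi> H H \<and> card (\<phi> ` verts H) = a" unfolding a_def by (rule LeastI_ex[OF ex])
  have a_le: "a \<le> card (\<phi> ` verts H)" if "is_hom \<phi> H H" for \<phi>
    unfolding a_def using that by (intro Least_le) blast
  let ?E = "\<lambda>\<phi>. (\<lambda>e. \<phi> ` e) ` edges H"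
  obtain \<phi> where \<phi>: "is_hom \<phi> H H" "card (\<phi> ` verts H) = a"
    and min: "\<And>\<psi>. is_hom \<psi> H H \<Longrightarrow> card (\<psi> ` verts H) = a \<Longrightarrow> card (?E \<phi>) \<le> card (?E \<psi>)"
    using ex_has_least_nat[of "\<lambda>\<phi>. is_hom \<phi> H H \<and> card (\<phi> ` verts H) = a" _ "\<lambda>\<phi>. card (?E \<phi>)"] a by blast
  have "is_core (hom_image \<phi> H) H"
    unfolding is_core_def
  proof (intro conjI ballI)
    show "hom_image \<phi> H \<in> hom_copies H H" using \<phi> by (auto simp: hom_copies_def)
    fix K' assume "K' \<in> hom_copies H H"
    then obtain \<psi> where \<psi>: "is_hom \<psi> H H" "K' = hom_image \<psi> H" by (auto simp: hom_copies_def)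
    show "card (verts (hom_image \<phi> H)) \<le> card (verts K')" using \<phi> a_le[OF \<psi>(1)] \<psi>(2) by (simp add: hom_image_def)
    have c: "is_hom (\<phi> \<circ> \<psi>) H H" by (rule is_hom_comp[OF \<psi>(1) \<phi>(1)])
    have "(\<phi> \<circ> \<psi>) ` verts H \<subseteq> \<phi> ` verts H" using \<psi>(1) by (auto simp: is_hom_def)
    then have "card ((\<phi> \<circ> \<psi>) ` verts H) \<le> a" using \<phi>(2) fin by (metis card_mono finite_imageI)
    then have "card ((\<phi> \<circ> \<psi>) ` verts H) = a" using a_le[OF c] by simp
    then have "card (?E \<phi>) \<le> card (?E (\<phi> \<circ> \<psi>))" by (rule min[OF c])
    also have "?E (\<phi> \<circ> \<psi>) = (\<lambda>e. \<phi> ` e) ` (?E \<psi>)" by (simp add: image_image image_comp)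
    also have "card \<dots> \<le> card (?E \<psi>)" using fin by (intro card_image_le) auto
    finally show "card (edges (hom_image \<phi> H)) \<le> card (edges K')" by (simp add: hom_image_def \<psi>(2))
  qed
  then show ?thesis by blast
qed

lemma core_retraction:
  assumes H: "simple_graph H"
  obtains \<rho> where "is_hom \<rho> H (core H)" "is_hom \<rho> H H" "verts (core H) = \<rho> ` verts H" "edges (core H) = (\<lambda>e. \<rho> ` e) ` edges H"
proof -
  have "is_core (core H) H" unfolding core_def using exists_is_core[OF H] by (rule someI_ex)
  then obtain \<rho> where "is_hom \<rho> H H" "core H = hom_image \<rho> H" by (auto simp: is_core_def hom_copies_def)
  then show thesis by (intro that[of \<rho>]) (auto simp: is_hom_def hom_image_def)
qed

lemma core_subgraph:
  assumes H: "simple_graph H"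
  shows "verts (core H) \<subseteq> verts H" "edges (core H) \<subseteq> edges H" "simple_graph (core H)"
proof -
  obtain \<rho> where \<rho>: "is_hom \<rho> H H" "verts (core H) = \<rho> ` verts H" "edges (core H) = (\<lambda>e. \<rho> ` e) ` edges H"
    by (rule core_retraction[OF H])
  show v: "verts (core H) \<subseteq> verts H" and e: "edges (core H) \<subseteq> edges H" using \<rho> by (auto simp: is_hom_def)
  have "e \<subseteq> verts (core H)" if "e \<in> edges (core H)" for e
    using that simple_edge_sub[OF H] unfolding \<rho>(2,3) by blast
  then show "simple_graph (core H)" using v e H unfolding simple_graph_def by (meson finite_subset subsetD)
qed

lemma hom_free_core_iff:
  assumes H: "simple_graph H" shows "hom_free H G \<longleftrightarrow> hom_free (core H) G"
proof -
  obtain \<rho> where \<rho>: "is_hom \<rho> H (core H)" by (rule core_retraction[OF H])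
  have "is_hom \<phi> (core H) G" if "is_hom \<phi> H G" for \<phi>
    using that core_subgraph(1,2)[OF H] by (auto simp: is_hom_def)
  then show ?thesis using is_hom_comp[OF \<rho>] unfolding hom_free_def by blast
qed

text \<open>Endomorphisms of the core are automorphisms, since a smaller image would contradict minimality.\<close>

lemma core_endo_inverse:
  assumes H: "simple_graph H" and \<sigma>: "is_hom \<sigma> (core H) (core H)"
  obtains \<tau> where "is_hom \<tau> (core H) (core H)" "\<And>v. v \<in> verts (core H) \<Longrightarrow> \<sigma> (\<tau> v) = v"
proof -
  let ?K = "core H"
  have K: "simple_graph ?K" by (rule core_subgraph[OF H])
  have fin: "finite (verts ?K)" "finite (edges ?K)" using K finite_edges by (auto simp: simple_graph_def)
  obtain \<rho> where \<rho>: "is_hom \<rho> H ?K" "verts ?K = \<rho> ` verts H" by (rule core_retraction[OF H])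
  have "is_core ?K H" unfolding core_def using exists_is_core[OF H] by (rule someI_ex)
  moreover have "is_hom (\<sigma> \<circ> \<rho>) H H"
    by (rule is_hom_mono[OF is_hom_comp[OF \<rho>(1) \<sigma>]]) (use core_subgraph[OF H] in auto)
  then have "hom_image (\<sigma> \<circ> \<rho>) H \<in> hom_copies H H" by (auto simp: hom_copies_def)
  ultimately have "card (verts ?K) \<le> card (verts (hom_image (\<sigma> \<circ> \<rho>) H))" by (auto simp: is_core_def)
  also have "\<dots> = card (\<sigma> ` verts ?K)" using \<rho>(2) by (simp add: hom_image_def image_comp)
  finally have "card (\<sigma> ` verts ?K) = card (verts ?K)" using card_image_le[OF fin(1), of \<sigma>] by simp
  then have inj: "inj_on \<sigma> (verts ?K)" using fin(1) eq_card_imp_inj_on by blast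
  have sub: "\<sigma> ` verts ?K \<subseteq> verts ?K" using \<sigma> by (auto simp: is_hom_def)
  then have img: "\<sigma> ` verts ?K = verts ?K" using inj fin(1) by (simp add: endo_inj_surj)
  have "inj_on (\<lambda>e. \<sigma> ` e) (edges ?K)"
    by (rule inj_onI) (metis inj inj_on_image_eq_iff simple_edge_sub[OF K])
  moreover have "(\<lambda>e. \<sigma> ` e) ` edges ?K \<subseteq> edges ?K" using \<sigma> by (auto simp: is_hom_def)
  ultimately have eimg: "(\<lambda>e. \<sigma> ` e) ` edges ?K = edges ?K" using fin(2) by (simp add: endo_inj_surj)
  let ?\<tau> = "inv_into (verts ?K) \<sigma>"
  have "is_hom ?\<tau> ?K ?K"
    unfolding is_hom_def
  proof (intro conjI ballI)
    show "?\<tau> ` verts ?K \<subseteq> verts ?K" using img by (metis image_subsetI inv_into_into)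
    fix e assume "e \<in> edges ?K"
    then obtain e' where e': "e' \<in> edges ?K" "e = \<sigma> ` e'" using eimg by blast
    then have "?\<tau> ` e = e'" using inj simple_edge_sub[OF K e'(1)] by (simp add: inv_into_image_cancel)
    then show "?\<tau> ` e \<in> edges ?K" using e' by simp
  qed
  moreover have "\<sigma> (?\<tau> v) = v" if "v \<in> verts ?K" for v using that img by (metis f_inv_into_f)
  ultimately show thesis by (rule that)
qed

section \<open>Cycles in non-bipartite graphs\<close>

lemma bipartite_iff_coloring:
  assumes H: "simple_graph H"
  shows "bipartite H \<longleftrightarrow> (\<exists>c :: 'a \<Rightarrow> bool. \<forall>x y. {x, y} \<in> edges H \<longrightarrow> c x \<noteq> c y)"
proof
  assume "bipartite H"
  then obtain A B where AB: "A \<inter> B = {}" "\<And>e. e \<in> edges H \<Longrightarrow> \<exists>a\<in>A. \<exists>b\<in>B. e = {a, b}"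
    by (auto simp: bipartite_def)
  have "(x \<in> A) \<noteq> (y \<in> A)" if "{x, y} \<in> edges H" for x y
    using AB(2)[OF that] AB(1) by (auto simp: doubleton_eq_iff)
  then show "\<exists>c :: 'a \<Rightarrow> bool. \<forall>x y. {x, y} \<in> edges H \<longrightarrow> c x \<noteq> c y" by (intro exI[of _ "\<lambda>x. x \<in> A"] allI impI)
next
  assume "\<exists>c :: 'a \<Rightarrow> bool. \<forall>x y. {x, y} \<in> edges H \<longrightarrow> c x \<noteq> c y"
  then obtain c :: "'a \<Rightarrow> bool" where c: "\<And>x y. {x, y} \<in> edges H \<Longrightarrow> c x \<noteq> c y" by blast
  have "\<exists>a\<in>{v \<in> verts H. c v}. \<exists>b\<in>{v \<in> verts H. \<not> c v}. e = {a, b}" if "e \<in> edges H" for e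
  proof -
    obtain x y where xy: "e = {x, y}" "x \<in> verts H" "y \<in> verts H" using simple_edgeE[OF H \<open>e \<in> edges H\<close>] by blast
    have "c x \<noteq> c y" using c that xy by blast
    then show ?thesis using xy by (cases "c x") (auto simp: insert_commute)
  qed
  then show "bipartite H" unfolding bipartite_def
    by (intro exI[of _ "{v \<in> verts H. c v}"] exI[of _ "{v \<in> verts H. \<not> c v}"]) auto
qed

lemma bipartite_pullback:
  assumes "simple_graph H" "simple_graph K" "is_hom \<phi> H K" "bipartite K" shows "bipartite H"
proof -
  obtain c :: "'b \<Rightarrow> bool" where "\<And>x y. {x, y} \<in> edges K \<Longrightarrow> c x \<noteq> c y"
    using assms(2,4) bipartite_iff_coloring by blast
  then have "\<forall>x y. {x, y} \<in> edges H \<longrightarrow> (c \<circ> \<phi>) x \<noteq> (c \<circ> \<phi>) y"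
    using is_hom_edge[OF assms(3)] by auto
  then show ?thesis using assms(1) bipartite_iff_coloring by blast
qed

text \<open>Take a maximal bipartite set \<open>E\<close> of edges and an edge \<open>ab\<close> outside it. If
  \<open>a\<close> and \<open>b\<close> were not connected in \<open>E\<close>, flipping the colours on the
  component of \<open>a\<close> would allow \<open>ab\<close> to be added. A shortest path from
  \<open>a\<close> to \<open>b\<close> in \<open>E\<close> closes up with \<open>ab\<close>.\<close>

lemma exists_cycle:
  assumes K: "simple_graph K" "\<not> bipartite K"
  obtains L and v :: "nat \<Rightarrow> 'a" where "L \<ge> 2" "inj_on v {..L}"
    "\<And>t. t < L \<Longrightarrow> {v t, v (Suc t)} \<in> edges K" "{v 0, v L} \<in> edges K"
proof -
  let ?proper = "\<lambda>E (c :: 'a \<Rightarrow> bool). \<forall>x y. {x, y} \<in> E \<longrightarrow> c x \<noteq> c y"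
  define B where "B = {E. E \<subseteq> edges K \<and> (\<exists>c. ?proper E c)}"
  have "finite B" using finite_edges[OF K(1)] by (auto simp: B_def intro: finite_subset[of _ "Pow (edges K)"])
  moreover have "B \<noteq> {}" by (auto simp: B_def)
  ultimately obtain E where E: "E \<in> B" and max: "\<And>E'. E' \<in> B \<Longrightarrow> E \<subseteq> E' \<Longrightarrow> E = E'"
    using finite_has_maximal[of B] by auto
  from E obtain c where Ec: "E \<subseteq> edges K" "?proper E c" by (auto simp: B_def)
  have "E \<noteq> edges K" using K Ec bipartite_iff_coloring by blast
  then obtain f where f: "f \<in> edges K" "f \<notin> E" using Ec by blast
  then obtain a b where ab: "f = {a, b}" "a \<noteq> b" using simple_edgeE[OF K(1)] by blast
  let ?r = "{(x, y). {x, y} \<in> E}"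
  have conn: "(a, b) \<in> ?r\<^sup>*"
  proof (rule ccontr)
    assume nc: "(a, b) \<notin> ?r\<^sup>*"
    let ?C = "{x. (a, x) \<in> ?r\<^sup>*}"
    have CC: "x \<in> ?C \<longleftrightarrow> y \<in> ?C" if "{x, y} \<in> E" for x y
    proof -
      have "(x, y) \<in> ?r" "(y, x) \<in> ?r" using that by (auto simp: insert_commute)
      then show ?thesis by (auto intro: rtrancl_into_rtrancl)
    qed
    define c' where "c' = (\<lambda>x. if x \<in> ?C \<and> c a = c b then \<not> c x else c x)"
    \<comment> \<open>When \<open>c a \<noteq> c b\<close> already holds, \<open>c'\<close> is \<open>c\<close> and \<open>ab\<close> is properly coloured.\<close>
    have "?proper (insert f E) c'"
    proof (intro allI impI)
      fix x y assume "{x, y} \<in> insert f E"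
      then consider "{x, y} = {a, b}" | "{x, y} \<in> E" using ab by auto
      then show "c' x \<noteq> c' y"
      proof cases
        case 1
        have "a \<in> ?C" "b \<notin> ?C" using nc by auto
        then have "c' a \<noteq> c' b" by (auto simp: c'_def)
        then show ?thesis using 1 by (auto simp: doubleton_eq_iff)
      next
        case 2
        then have "c x \<noteq> c y" "x \<in> ?C \<longleftrightarrow> y \<in> ?C" using Ec CC by blast+
        then show ?thesis by (auto simp: c'_def)
      qed
    qed
    then have "insert f E \<in> B" using f Ec unfolding B_def by blast
    then show False using max[of "insert f E"] f by blast
  qed
  then have ex: "\<exists>n. (a, b) \<in> ?r ^^ n" by (simp add: rtrancl_power)
  define n where "n = (LEAST n. (a, b) \<in> ?r ^^ n)"
  have n: "(a, b) \<in> ?r ^^ n" unfolding n_def by (rule LeastI_ex[OF ex])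
  have n_le: "n \<le> m" if "(a, b) \<in> ?r ^^ m" for m unfolding n_def using that by (rule Least_le)
  obtain v where v: "v 0 = a" "v n = b" "\<And>i. i < n \<Longrightarrow> (v i, v (Suc i)) \<in> ?r"
    using n by (auto simp: relpow_fun_conv)
  have seg: "(v i, v (i + k)) \<in> ?r ^^ k" if "i + k \<le> n" for i k
    unfolding relpow_fun_conv using v(3) that by (intro exI[of _ "\<lambda>t. v (i + t)"]) auto
  have inj: "inj_on v {..n}"
  proof (rule linorder_inj_onI)
    fix i j assume ij: "i < j" "i \<in> {..n}" "j \<in> {..n}"
    show "v i \<noteq> v j"
    proof
      assume eq: "v i = v j"
      have "(a, v i) \<in> ?r ^^ i" using seg[of 0 i] ij v(1) by simp
      moreover have "(v i, b) \<in> ?r ^^ (n - j)" using seg[of j "n - j"] ij v(2) eq by simp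
      ultimately have "(a, b) \<in> ?r ^^ (i + (n - j))" by (auto simp: relpow_add)
      then show False using n_le[of "i + (n - j)"] ij by simp
    qed
  qed auto
  have "n \<noteq> 0"
  proof
    assume "n = 0"
    then have "a = b" using v(1,2) by simp
    then show False using ab by simp
  qed
  moreover have "n \<noteq> 1" using v(3)[of 0] v(1,2) f ab by auto
  ultimately have "n \<ge> 2" by simp
  then show thesis
    using inj v f ab Ec by (intro that[of n v]) auto
qed

section \<open>Extending partial homomorphisms\<close>

lemma connected_exit_edge:
  assumes H: "simple_graph H" "connected_graph H" and S: "S \<subseteq> verts H" "S \<noteq> {}" "S \<noteq> verts H"
  obtains i j where "{i, j} \<in> edges H" "i \<in> S" "j \<in> verts H - S"
proof -
  obtain u w where uw: "u \<in> S" "w \<in> verts H" "w \<notin> S" using S by blast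
  then have "(u, w) \<in> {(x, y). {x, y} \<in> edges H}\<^sup>*" using H(2) S(1) by (auto simp: connected_graph_def)
  then have "w \<notin> S \<Longrightarrow> \<exists>i j. {i, j} \<in> edges H \<and> i \<in> S \<and> j \<notin> S"
    by (induction rule: rtrancl_induct) (use uw in auto)
  then obtain i j where "{i, j} \<in> edges H" "i \<in> S" "j \<notin> S" using uw by blast
  then show thesis using simple_edge_verts[OF H(1), of i j] by (intro that) auto
qed

text \<open>By connectivity there is always a new vertex adjacent to one whose image is already fixed, which leaves at
  most \<open>\<Delta>\<close> choices for its image.\<close>

lemma card_hom_extensions_le:
  assumes H: "simple_graph H" "connected_graph H" and G: "simple_graph G"
    and \<Delta>: "\<And>u. u \<in> verts G \<Longrightarrow> card (nbhd G u) \<le> \<Delta>"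
  shows "S \<subseteq> verts H \<Longrightarrow> S \<noteq> {} \<Longrightarrow> card {\<theta> \<in> hom_set H G. \<forall>i\<in>S. \<theta> i = g i} \<le> \<Delta> ^ card (verts H - S)"
proof (induction "card (verts H - S)" arbitrary: S g)
  case 0
  then have S: "S = verts H" using H(1) by (auto simp: simple_graph_def)
  have "{\<theta> \<in> hom_set H G. \<forall>i\<in>S. \<theta> i = g i} \<subseteq> {restrict g (verts H)}"
    by (auto simp: S hom_set_def intro!: PiE_ext)
  then have "card {\<theta> \<in> hom_set H G. \<forall>i\<in>S. \<theta> i = g i} \<le> 1"
    using card_mono[of "{restrict g (verts H)}"] by fastforce
  then show ?case using 0 by simp
next
  case (Suc k)
  have fin: "finite (verts H)" using H by (simp add: simple_graph_def)
  have "S \<noteq> verts H" using Suc.hyps(2) by auto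
  then obtain i j where ij: "{i, j} \<in> edges H" "i \<in> S" "j \<in> verts H - S"
    using connected_exit_edge[OF H Suc.prems] by blast
  have k: "k = card (verts H - insert j S)"
  proof -
    have eq: "verts H - S = insert j (verts H - insert j S)" using ij by auto
    have "card (insert j (verts H - insert j S)) = Suc (card (verts H - insert j S))" using fin by simp
    then show ?thesis using Suc.hyps(2) unfolding eq[symmetric] by simp
  qed
  let ?E = "\<lambda>w. {\<theta> \<in> hom_set H G. \<forall>l\<in>insert j S. \<theta> l = (g(j := w)) l}"
  have fN: "finite (nbhd G (g i))"
    by (rule finite_subset[of _ "verts G"]) (use simple_edge_verts[OF G] G in \<open>auto simp: nbhd_def simple_graph_def\<close>)
  have sub: "{\<theta> \<in> hom_set H G. \<forall>l\<in>S. \<theta> l = g l} \<subseteq> (\<Union>w\<in>nbhd G (g i). ?E w)"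
  proof
    fix \<theta> assume \<theta>: "\<theta> \<in> {\<theta> \<in> hom_set H G. \<forall>l\<in>S. \<theta> l = g l}"
    then have "is_hom \<theta> H G" "\<theta> i = g i" using ij by (auto simp: hom_set_def)
    then have "\<theta> j \<in> nbhd G (g i)" using is_hom_edge[of \<theta> H G i j] ij by (simp add: nbhd_def)
    moreover have "\<theta> \<in> ?E (\<theta> j)" using \<theta> ij by auto
    ultimately show "\<theta> \<in> (\<Union>w\<in>nbhd G (g i). ?E w)" by blast
  qed
  show ?case
  proof (cases "nbhd G (g i) = {}")
    case True
    then have "{\<theta> \<in> hom_set H G. \<forall>l\<in>S. \<theta> l = g l} = {}" using sub by blast
    then show ?thesis by (simp only: card.empty zero_le)
  next
    case False
    then have gi: "g i \<in> verts G" using simple_edge_verts[OF G] by (auto simp: nbhd_def)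
    have "card {\<theta> \<in> hom_set H G. \<forall>l\<in>S. \<theta> l = g l} \<le> card (\<Union>w\<in>nbhd G (g i). ?E w)"
      using fN finite_hom_set[OF H(1) G] by (intro card_mono sub) auto
    also have "\<dots> \<le> (\<Sum>w\<in>nbhd G (g i). card (?E w))" by (rule card_UN_le[OF fN])
    also have "\<dots> \<le> (\<Sum>w\<in>nbhd G (g i). \<Delta> ^ k)"
    proof (rule sum_mono)
      fix w
      have "card (?E w) \<le> \<Delta> ^ card (verts H - insert j S)"
        by (rule Suc.hyps(1)[OF k]) (use Suc.prems ij in auto)
      then show "card (?E w) \<le> \<Delta> ^ k" using k by simp
    qed
    also have "\<dots> \<le> \<Delta> * \<Delta> ^ k" using \<Delta>[OF gi] by simp
    finally show ?thesis using Suc.hyps(2)[symmetric] by simp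
  qed
qed

section \<open>Relabelling the vertices by natural numbers\<close>

text \<open>The constructions below live on types of their own, whereas the quantities in the theorem quantify over
  graphs on natural numbers.\<close>

lemma copy_on_nat:
  fixes G :: "'b graph"
  assumes G: "simple_graph G"
  obtains G' :: "nat graph" and f where "simple_graph G'" "bij_betw f (verts G) (verts G')"
    "edges G' = (\<lambda>e. f ` e) ` edges G"
proof -
  have fin: "finite (verts G)" using G by (simp add: simple_graph_def)
  obtain f where f: "bij_betw f (verts G) {0..<card (verts G)}" using ex_bij_betw_finite_nat[OF fin] by blast
  let ?G' = "\<lparr>verts = {0..<card (verts G)}, edges = (\<lambda>e. f ` e) ` edges G\<rparr>"
  have "f ` e \<subseteq> {0..<card (verts G)} \<and> card (f ` e) = 2" if "e \<in> edges G" for e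
  proof -
    have e: "e \<subseteq> verts G" "card e = 2" using G that by (auto simp: simple_graph_def)
    then have "inj_on f e" using f by (meson bij_betw_def inj_on_subset)
    then show ?thesis using e f by (auto simp: card_image bij_betw_def)
  qed
  then have "simple_graph ?G'" by (auto simp: simple_graph_def)
  then show thesis using f by (intro that[of ?G' f]) auto
qed

text \<open>One vertex whose image is a function of the images of two adjacent vertices saves a factor
  \<open>\<Delta>\<close> over the trivial bound \<open>n \<Delta> ^ (h - 1)\<close>.\<close>

lemma card_homs_determined_le:
  assumes H: "simple_graph H" "connected_graph H" and G: "simple_graph G"
    and \<Delta>: "\<And>u. u \<in> verts G \<Longrightarrow> card (nbhd G u) \<le> \<Delta>"
    and det: "\<And>\<theta>. \<theta> \<in> hom_set H G \<Longrightarrow> \<exists>\<alpha> \<beta> \<gamma>. {\<alpha>, \<beta>} \<in> edges H \<and> \<gamma> \<in> verts H \<and> \<gamma> \<noteq> \<alpha> \<and> \<gamma> \<noteq> \<beta> \<and> \<theta> \<gamma> = f (\<theta> \<alpha>) (\<theta> \<beta>)"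
  shows "card (hom_set H G) \<le> card (verts H) ^ 3 * (card (verts G) * \<Delta> ^ (card (verts H) - 2))"
proof -
  let ?h = "card (verts H)"
  have finH: "finite (verts H)" and finG: "finite (verts G)" using H G by (auto simp: simple_graph_def)
  have fin: "finite (hom_set H G)" by (rule finite_hom_set[OF H(1) G])
  let ?T = "{(\<alpha>, \<beta>, \<gamma>). {\<alpha>, \<beta>} \<in> edges H \<and> \<gamma> \<in> verts H \<and> \<gamma> \<noteq> \<alpha> \<and> \<gamma> \<noteq> \<beta>}"
  let ?X = "\<lambda>(\<alpha>, \<beta>, \<gamma>). {\<theta> \<in> hom_set H G. \<theta> \<gamma> = f (\<theta> \<alpha>) (\<theta> \<beta>)}"
  have Tsub: "?T \<subseteq> verts H \<times> verts H \<times> verts H" using simple_edge_verts[OF H(1)] by auto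
  have finT: "finite ?T" by (rule finite_subset[OF Tsub]) (simp add: finH)
  have X: "card (?X t) \<le> card (verts G) * \<Delta> ^ (?h - 2)" if t: "t \<in> ?T" for t
  proof -
    obtain \<alpha> \<beta> \<gamma> where t': "t = (\<alpha>, \<beta>, \<gamma>)" by (cases t)
    have abc: "{\<alpha>, \<beta>} \<in> edges H" "\<gamma> \<in> verts H" "\<gamma> \<noteq> \<alpha>" "\<gamma> \<noteq> \<beta>" using t t' by auto
    have ab: "\<alpha> \<noteq> \<beta>" "\<alpha> \<in> verts H" "\<beta> \<in> verts H" using abc(1) simple_edge_neq[OF H(1)] simple_edge_verts[OF H(1)] by blast+
    let ?P = "Sigma (verts G) (nbhd G)"
    let ?Y = "\<lambda>(u, w). {\<theta> \<in> hom_set H G. \<forall>i\<in>{\<alpha>, \<beta>, \<gamma>}. \<theta> i = (if i = \<alpha> then u else if i = \<beta> then w else f u w)}"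
    have finN: "finite (nbhd G u)" for u
      by (rule finite_subset[OF _ finG]) (use simple_edge_verts[OF G] in \<open>auto simp: nbhd_def\<close>)
    have finP: "finite ?P" using finG finN by blast
    have "?X t \<subseteq> (\<Union>p\<in>?P. ?Y p)"
    proof
      fix \<theta> assume "\<theta> \<in> ?X t"
      then have \<theta>: "\<theta> \<in> hom_set H G" "\<theta> \<gamma> = f (\<theta> \<alpha>) (\<theta> \<beta>)" by (auto simp: t')
      have e: "{\<theta> \<alpha>, \<theta> \<beta>} \<in> edges G" using \<theta>(1) is_hom_edge[OF _ abc(1)] by (auto simp: hom_set_def)
      then have "(\<theta> \<alpha>, \<theta> \<beta>) \<in> ?P" using simple_edge_verts[OF G e] by (auto simp: nbhd_def)
      moreover have "\<theta> \<in> ?Y (\<theta> \<alpha>, \<theta> \<beta>)" using \<theta> abc ab by auto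
      ultimately show "\<theta> \<in> (\<Union>p\<in>?P. ?Y p)" by blast
    qed
    then have "card (?X t) \<le> card (\<Union>p\<in>?P. ?Y p)" using fin finP by (intro card_mono) auto
    also have "\<dots> \<le> (\<Sum>p\<in>?P. card (?Y p))" by (rule card_UN_le[OF finP])
    also have "\<dots> \<le> (\<Sum>p\<in>?P. \<Delta> ^ (?h - 3))"
    proof (rule sum_mono)
      fix p :: "'b \<times> 'b"
      obtain u w where p: "p = (u, w)" by force
      have "card (verts H - {\<alpha>, \<beta>, \<gamma>}) = ?h - 3"
        using abc ab finH by (subst card_Diff_subset) auto
      then show "card (?Y p) \<le> \<Delta> ^ (?h - 3)"
        unfolding p using card_hom_extensions_le[OF H G \<Delta>, of "{\<alpha>, \<beta>, \<gamma>}" "\<lambda>i. if i = \<alpha> then u else if i = \<beta> then w else f u w"]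
          abc ab by simp
    qed
    also have "\<dots> = card ?P * \<Delta> ^ (?h - 3)" by simp
    also have "\<dots> \<le> (card (verts G) * \<Delta>) * \<Delta> ^ (?h - 3)"
    proof (intro mult_right_mono)
      have "card ?P = (\<Sum>u\<in>verts G. card (nbhd G u))" using finG finN by simp
      also have "\<dots> \<le> (\<Sum>u\<in>verts G. \<Delta>)" by (intro sum_mono \<Delta>)
      finally show "card ?P \<le> card (verts G) * \<Delta>" by simp
    qed simp
    also have "\<dots> = card (verts G) * \<Delta> ^ (?h - 2)"
    proof -
      have "card {\<alpha>, \<beta>, \<gamma>} \<le> ?h" using abc ab finH by (intro card_mono) auto
      then have "?h - 2 = Suc (?h - 3)" using abc ab by simp
      then show ?thesis by simp
    qed
    finally show ?thesis .
  qed
  have "hom_set H G \<subseteq> (\<Union>t\<in>?T. ?X t)"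
  proof
    fix \<theta> assume \<theta>: "\<theta> \<in> hom_set H G"
    obtain \<alpha> \<beta> \<gamma> where "(\<alpha>, \<beta>, \<gamma>) \<in> ?T" "\<theta> \<gamma> = f (\<theta> \<alpha>) (\<theta> \<beta>)" using det[OF \<theta>] by blast
    then show "\<theta> \<in> (\<Union>t\<in>?T. ?X t)" using \<theta> by (intro UN_I[of "(\<alpha>, \<beta>, \<gamma>)"]) auto
  qed
  then have "card (hom_set H G) \<le> card (\<Union>t\<in>?T. ?X t)" using finT fin by (intro card_mono) auto
  also have "\<dots> \<le> (\<Sum>t\<in>?T. card (?X t))" by (rule card_UN_le[OF finT])
  also have "\<dots> \<le> (\<Sum>t\<in>?T. card (verts G) * \<Delta> ^ (?h - 2))" by (rule sum_mono[OF X])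
  also have "\<dots> = card ?T * (card (verts G) * \<Delta> ^ (?h - 2))" by simp
  also have "\<dots> \<le> ?h ^ 3 * (card (verts G) * \<Delta> ^ (?h - 2))"
    using card_mono[OF _ Tsub] finH by (intro mult_right_mono) (auto simp: card_cartesian_product power3_eq_cube)
  finally show ?thesis .
qed

section \<open>A graph that is far from homomorphism-free but has few homomorphisms\<close>

context
  fixes K :: "'a graph" and c :: "'a \<Rightarrow> nat" and D d :: nat
begin

definition nsq :: "(nat \<Rightarrow> nat) \<Rightarrow> nat" where "nsq y = (\<Sum>t<D. (y t)\<^sup>2)"

text \<open>Each triple \<open>p = (x, s, y)\<close> gives a copy of \<open>K\<close> whose vertex \<open>i\<close> sits
  at the point \<open>(x, s) + c i (y, |y|\<^sup>2)\<close>, so its edges point in the direction of a point of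
  the paraboloid. There are \<open>d ^ D\<close> directions in a box of about \<open>d ^ (D + 2)\<close>
  points: for large \<open>D\<close> only a small power of the size of the box is lost, and strict convexity
  (\<open>rs_closing\<close>) restricts closed walks.\<close>

definition rs_emb :: "(nat \<Rightarrow> nat) \<times> nat \<times> (nat \<Rightarrow> nat) \<Rightarrow> 'a \<Rightarrow> 'a \<times> (nat \<Rightarrow> nat) \<times> nat" where
  "rs_emb = (\<lambda>(x, s, y) i. (i, restrict (\<lambda>t. x t + c i * y t) {..<D}, s + c i * nsq y))"

definition rs_param :: "((nat \<Rightarrow> nat) \<times> nat \<times> (nat \<Rightarrow> nat)) set" where
  "rs_param = ({..<D} \<rightarrow>\<^sub>E {..<d}) \<times> {..<D * d\<^sup>2} \<times> ({..<D} \<rightarrow>\<^sub>E {..<d})"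

definition rs_graph :: "('a \<times> (nat \<Rightarrow> nat) \<times> nat) graph" where
  "rs_graph = \<lparr>verts = verts K \<times> ({..<D} \<rightarrow>\<^sub>E {..<2 * card (verts K) * d}) \<times> {..<2 * card (verts K) * (D * d\<^sup>2)},
     edges = {{rs_emb p i, rs_emb p j} | p i j. p \<in> rs_param \<and> {i, j} \<in> edges K}\<rparr>"

lemma rs_emb_simp: "rs_emb (x, s, y) i = (i, restrict (\<lambda>t. x t + c i * y t) {..<D}, s + c i * nsq y)"
  by (simp add: rs_emb_def)

lemma fst_rs_emb [simp]: "fst (rs_emb p i) = i" by (simp add: rs_emb_def case_prod_unfold)

context
  assumes K: "simple_graph K" and c_lt: "\<And>i. i \<in> verts K \<Longrightarrow> c i < 2 * card (verts K)"
    and c_inj: "inj_on c (verts K)" and D: "D > 0" and d: "d > 0"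
begin

lemma rs_emb_in: "p \<in> rs_param \<Longrightarrow> i \<in> verts K \<Longrightarrow> rs_emb p i \<in> verts rs_graph"
proof -
  assume p: "p \<in> rs_param" and i: "i \<in> verts K"
  obtain x s y where xy: "p = (x, s, y)" by (cases p)
  have x: "x \<in> {..<D} \<rightarrow>\<^sub>E {..<d}" "s < D * d\<^sup>2" "y \<in> {..<D} \<rightarrow>\<^sub>E {..<d}" using p by (auto simp: rs_param_def xy)
  let ?k = "2 * card (verts K)"
  have c: "Suc (c i) \<le> ?k" using c_lt[OF i] by simp
  have 1: "x t + c i * y t < ?k * d" if "t < D" for t
  proof -
    have "x t < d" "y t < d" using x that by auto
    then have "x t + c i * y t < d + c i * d" by (intro add_less_le_mono mult_left_mono) auto
    also have "\<dots> = Suc (c i) * d" by simp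
    also have "\<dots> \<le> ?k * d" using c by (rule mult_right_mono) simp
    finally show ?thesis .
  qed
  have "y t < d" if "t < D" for t using x(3) that by auto
  then have "nsq y \<le> (\<Sum>t<D. d\<^sup>2)" unfolding nsq_def by (intro sum_mono power_mono) (simp_all add: less_imp_le)
  then have "s + c i * nsq y < D * d\<^sup>2 + c i * (D * d\<^sup>2)"
    using x(2) by (intro add_less_le_mono mult_left_mono) auto
  also have "\<dots> = Suc (c i) * (D * d\<^sup>2)" by simp
  also have "\<dots> \<le> ?k * (D * d\<^sup>2)" using c by (rule mult_right_mono) simp
  finally show ?thesis using 1 i by (simp add: xy rs_emb_simp rs_graph_def)
qed

lemma rs_edgeE:
  assumes "{u, w} \<in> edges rs_graph"
  obtains p where "p \<in> rs_param" "{fst u, fst w} \<in> edges K" "u = rs_emb p (fst u)" "w = rs_emb p (fst w)"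
proof -
  obtain p i j where "p \<in> rs_param" "{i, j} \<in> edges K" "{u, w} = {rs_emb p i, rs_emb p j}"
    using assms by (auto simp: rs_graph_def)
  then consider "u = rs_emb p i" "w = rs_emb p j" | "u = rs_emb p j" "w = rs_emb p i"
    by (auto simp: doubleton_eq_iff)
  then show thesis
  proof cases
    case 1
    then show thesis using \<open>p \<in> rs_param\<close> \<open>{i, j} \<in> edges K\<close> by (intro that[of p]) simp_all
  next
    case 2
    then show thesis using \<open>p \<in> rs_param\<close> \<open>{i, j} \<in> edges K\<close> by (intro that[of p]) (simp_all add: insert_commute)
  qed
qed

lemma rs_simple: "simple_graph rs_graph"
  unfolding simple_graph_def
proof (intro conjI ballI)
  show "finite (verts rs_graph)" using K by (auto simp: rs_graph_def simple_graph_def intro!: finite_PiE)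
  fix e assume "e \<in> edges rs_graph"
  then obtain p i j where e: "p \<in> rs_param" "{i, j} \<in> edges K" "e = {rs_emb p i, rs_emb p j}" by (auto simp: rs_graph_def)
  have ij: "i \<noteq> j" "i \<in> verts K" "j \<in> verts K" using e(2) simple_edge_neq[OF K] simple_edge_verts[OF K] by blast+
  show "e \<subseteq> verts rs_graph" using e ij rs_emb_in by auto
  have "rs_emb p i \<noteq> rs_emb p j" using ij(1) fst_rs_emb by metis
  then show "card e = 2" using e by simp
qed

text \<open>Two distinct labels turn an edge into two independent linear equations for the parameters. Hence the copies
  are edge-disjoint.\<close>

lemma rs_emb_determines:
  assumes p: "p \<in> rs_param" "p' \<in> rs_param" and ij: "i \<in> verts K" "j \<in> verts K" "i \<noteq> j"
    and eq: "rs_emb p i = rs_emb p' i" "rs_emb p j = rs_emb p' j"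
  shows "p = p'"
proof -
  obtain x s y x' s' y' where xy: "p = (x, s, y)" "p' = (x', s', y')" by (cases p, cases p')
  have cc: "c i \<noteq> c j" using c_inj ij by (auto simp: inj_on_def)
  have e: "x t + c i * y t = x' t + c i * y' t" "x t + c j * y t = x' t + c j * y' t" if "t < D" for t
    using eq that by (auto simp: xy rs_emb_simp restrict_def fun_eq_iff) metis+
  have yt: "y t = y' t \<and> x t = x' t" if "t < D" for t
  proof -
    have 1: "int (x t) + int (c i) * int (y t) = int (x' t) + int (c i) * int (y' t)"
      "int (x t) + int (c j) * int (y t) = int (x' t) + int (c j) * int (y' t)"
      using e[OF that] by (metis of_nat_add of_nat_mult)+
    then have "(int (c i) - int (c j)) * (int (y t) - int (y' t)) = 0" by (simp add: algebra_simps)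
    then have "y t = y' t" using cc by simp
    then show ?thesis using e(1)[OF that] by simp
  qed
  have "x \<in> {..<D} \<rightarrow>\<^sub>E {..<d}" "x' \<in> {..<D} \<rightarrow>\<^sub>E {..<d}" "y \<in> {..<D} \<rightarrow>\<^sub>E {..<d}" "y' \<in> {..<D} \<rightarrow>\<^sub>E {..<d}"
    using p by (auto simp: rs_param_def xy)
  then have "x = x'" "y = y'" using yt by (metis PiE_ext lessThan_iff)+
  then show ?thesis using eq(1) by (simp add: xy rs_emb_simp)
qed

text \<open>Every one of the edge-disjoint copies has to lose an edge.\<close>

lemma rs_removal_hard:
  assumes R: "R \<subseteq> edges rs_graph" "card R < card rs_param"
  obtains \<phi> where "is_hom \<phi> K (remove_edges rs_graph R)"
proof (rule ccontr)
  assume "\<not> thesis"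
  then have no: "\<not> is_hom \<phi> K (remove_edges rs_graph R)" for \<phi> using that by blast
  have hit: "\<exists>e. e \<in> R \<and> (\<exists>i j. {i, j} \<in> edges K \<and> e = {rs_emb p i, rs_emb p j})" if p: "p \<in> rs_param" for p
  proof (rule ccontr)
    assume n: "\<not> ?thesis"
    have "is_hom (rs_emb p) K (remove_edges rs_graph R)"
    proof (rule is_homI[OF K])
      show "rs_emb p v \<in> verts (remove_edges rs_graph R)" if "v \<in> verts K" for v
        using rs_emb_in[OF p that] by (simp add: remove_edges_def)
      show "{rs_emb p a, rs_emb p b} \<in> edges (remove_edges rs_graph R)" if "{a, b} \<in> edges K" for a b
      proof -
        have "{rs_emb p a, rs_emb p b} \<in> edges rs_graph" unfolding rs_graph_def graph.select_convs using p that by blast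
        then show ?thesis using n that by (auto simp: remove_edges_def)
      qed
    qed
    then show False using no by blast
  qed
  then obtain f where f: "\<And>p. p \<in> rs_param \<Longrightarrow> f p \<in> R \<and> (\<exists>i j. {i, j} \<in> edges K \<and> f p = {rs_emb p i, rs_emb p j})"
    by metis
  have inj: "inj_on f rs_param"
  proof (rule inj_onI)
    fix p p' assume p: "p \<in> rs_param" "p' \<in> rs_param" "f p = f p'"
    obtain i j where ij: "{i, j} \<in> edges K" "f p = {rs_emb p i, rs_emb p j}" using f p(1) by blast
    obtain i' j' where ij': "{i', j'} \<in> edges K" "f p' = {rs_emb p' i', rs_emb p' j'}" using f p(2) by blast
    have "rs_emb p i = rs_emb p' i \<and> rs_emb p j = rs_emb p' j"
      using p(3) ij(2) ij'(2) fst_rs_emb by (metis doubleton_eq_iff)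
    then show "p = p'"
      using rs_emb_determines[OF p(1,2)] simple_edge_verts[OF K ij(1)] simple_edge_neq[OF K ij(1)] by blast
  qed
  have "finite R" using finite_edges[OF rs_simple] R(1) finite_subset by blast
  then have "card rs_param \<le> card R" using card_inj_on_le[OF inj] f by blast
  then show False using R(2) by simp
qed

lemma card_rs_param: "card rs_param = d ^ D * (D * d\<^sup>2 * d ^ D)"
  by (simp add: rs_param_def card_cartesian_product card_PiE)

lemma card_rs_verts: "card (verts rs_graph) =
    card (verts K) * ((2 * card (verts K) * d) ^ D * (2 * card (verts K) * (D * d\<^sup>2)))"
  by (simp add: rs_graph_def card_cartesian_product card_PiE)

lemma rs_degree: "card (nbhd rs_graph u) \<le> card (verts K) * d ^ D"
proof -
  obtain i p s where u: "u = (i, p, s)" by (cases u)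
  let ?Y = "{..<D} \<rightarrow>\<^sub>E {..<d}"
  let ?f = "\<lambda>(j, y). (j, restrict (\<lambda>t. (p t - c i * y t) + c j * y t) {..<D}, (s - c i * nsq y) + c j * nsq y)"
  have finK: "finite (verts K)" using K by (simp add: simple_graph_def)
  have "nbhd rs_graph u \<subseteq> ?f ` (verts K \<times> ?Y)"
  proof
    fix w assume "w \<in> nbhd rs_graph u"
    then have "{u, w} \<in> edges rs_graph" by (simp add: nbhd_def)
    then obtain q where q: "q \<in> rs_param" "{fst u, fst w} \<in> edges K" "u = rs_emb q (fst u)" "w = rs_emb q (fst w)"
      by (rule rs_edgeE)
    obtain x r y where xy: "q = (x, r, y)" by (cases q)
    have y: "y \<in> ?Y" using q(1) by (simp add: rs_param_def xy)
    have "p = restrict (\<lambda>t. x t + c i * y t) {..<D}" "s = r + c i * nsq y"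
      using q(3) by (auto simp: u xy rs_emb_simp)
    then have "w = ?f (fst w, y)"
      by (subst q(4)) (auto simp: xy rs_emb_simp restrict_def fun_eq_iff)
    then show "w \<in> ?f ` (verts K \<times> ?Y)" using y simple_edge_verts[OF K q(2)] by blast
  qed
  then have "card (nbhd rs_graph u) \<le> card (verts K \<times> ?Y)"
    using finK by (intro surj_card_le) (auto intro!: finite_PiE)
  then show ?thesis by (simp add: card_cartesian_product card_PiE)
qed

text \<open>Let a cycle be labelled \<open>0, ..., L\<close> along a path that is closed by one edge. Its image walks
  along vectors \<open>z 0, ..., z (L - 1)\<close>, and the closing edge forces \<open>L y\<close> to be their
  sum and \<open>L |y|\<^sup>2\<close> the sum of their squared lengths. Then \<open>|z r - y|\<^sup>2\<close>
  sums to zero, so all steps equal \<open>y\<close>, and the second vertex of the cycle can be computed from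
  its first and last.\<close>

lemma rs_closing:
  assumes v: "\<And>t. t < L \<Longrightarrow> {u t, u (Suc t)} \<in> edges rs_graph" "{u 0, u L} \<in> edges rs_graph"
    and L: "L > 0" and c: "\<And>t. t \<le> L \<Longrightarrow> c (fst (u t)) = t"
  shows "u 1 = (fst (u 1),
      restrict (\<lambda>t. fst (snd (u 0)) t + (fst (snd (u L)) t - fst (snd (u 0)) t) div L) {..<D},
      snd (snd (u 0)) + (snd (snd (u L)) - snd (snd (u 0))) div L)"
proof -
  have "\<exists>p. p \<in> rs_param \<and> u t = rs_emb p (fst (u t)) \<and> u (Suc t) = rs_emb p (fst (u (Suc t)))" if "t < L" for t
    using rs_edgeE[OF v(1)[OF that]] by metis
  then obtain p where p: "\<And>t. t < L \<Longrightarrow> p t \<in> rs_param \<and> u t = rs_emb (p t) (fst (u t)) \<and> u (Suc t) = rs_emb (p t) (fst (u (Suc t)))"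
    by metis
  obtain q where q: "q \<in> rs_param" "u 0 = rs_emb q (fst (u 0))" "u L = rs_emb q (fst (u L))"
    using rs_edgeE[OF v(2)] by metis
  obtain x s y where xy: "q = (x, s, y)" by (cases q)
  define z where "z t = snd (snd (p t))" for t
  let ?P = "\<lambda>t. fst (snd (u t))" and ?S = "\<lambda>t. snd (snd (u t))"
  have step: "(l < D \<longrightarrow> ?P (Suc t) l = ?P t l + z t l) \<and> ?S (Suc t) = ?S t + nsq (z t)" if "t < L" for t l
  proof -
    obtain a b where ab: "p t = (a, b, z t)" unfolding z_def by (metis prod.collapse)
    have e: "u t = rs_emb (a, b, z t) (fst (u t))" "u (Suc t) = rs_emb (a, b, z t) (fst (u (Suc t)))" using p[OF that] ab by metis+
    have ct: "c (fst (u t)) = t" "c (fst (u (Suc t))) = Suc t" using c that by auto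
    have "?P t = restrict (\<lambda>l. a l + t * z t l) {..<D}" "?S t = b + t * nsq (z t)"
      "?P (Suc t) = restrict (\<lambda>l. a l + Suc t * z t l) {..<D}" "?S (Suc t) = b + Suc t * nsq (z t)"
      by (subst e, simp add: rs_emb_simp ct)+
    then show ?thesis by simp
  qed
  have P: "?P t l = ?P 0 l + (\<Sum>r<t. z r l)" if "t \<le> L" "l < D" for t l
    using that by (induction t) (auto simp: step)
  have S: "?S t = ?S 0 + (\<Sum>r<t. nsq (z r))" if "t \<le> L" for t
    using that by (induction t) (auto simp: step)
  have c0: "c (fst (u 0)) = 0" "c (fst (u L)) = L" using c by auto
  have end0: "?P 0 = restrict (\<lambda>l. x l) {..<D}" "?S 0 = s" "?P L = restrict (\<lambda>l. x l + L * y l) {..<D}" "?S L = s + L * nsq y"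
    by (subst q(2), simp add: rs_emb_simp xy c0)+ (subst q(3), simp add: rs_emb_simp xy c0)+
  have sumz: "(\<Sum>r<L. z r l) = L * y l" if "l < D" for l
    using P[of L l] that end0 by simp
  have sumn: "(\<Sum>r<L. nsq (z r)) = L * nsq y" using S[of L] end0 by simp
  have "(\<Sum>r<L. \<Sum>l<D. (int (z r l) - int (y l))\<^sup>2)
     = (\<Sum>r<L. int (nsq (z r))) - 2 * (\<Sum>l<D. int (y l) * (\<Sum>r<L. int (z r l))) + int L * int (nsq y)"
  proof -
    have "(\<Sum>r<L. \<Sum>l<D. (int (z r l) - int (y l))\<^sup>2)
      = (\<Sum>r<L. (\<Sum>l<D. (int (z r l))\<^sup>2) - 2 * (\<Sum>l<D. int (y l) * int (z r l)) + (\<Sum>l<D. (int (y l))\<^sup>2))"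
      by (simp add: power2_diff sum.distrib sum_subtractf sum_distrib_left mult_ac)
    also have "\<dots> = (\<Sum>r<L. int (nsq (z r))) - 2 * (\<Sum>r<L. \<Sum>l<D. int (y l) * int (z r l)) + int L * int (nsq y)"
      by (simp add: sum.distrib sum_subtractf sum_distrib_left nsq_def)
    also have "(\<Sum>r<L. \<Sum>l<D. int (y l) * int (z r l)) = (\<Sum>l<D. int (y l) * (\<Sum>r<L. int (z r l)))"
      by (subst sum.swap) (simp add: sum_distrib_left)
    finally show ?thesis .
  qed
  also have "(\<Sum>r<L. int (nsq (z r))) = int L * int (nsq y)" using sumn by (metis of_nat_mult of_nat_sum)
  also have "(\<Sum>l<D. int (y l) * (\<Sum>r<L. int (z r l))) = (\<Sum>l<D. int L * (int (y l))\<^sup>2)"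
  proof (rule sum.cong[OF refl])
    fix l assume "l \<in> {..<D}"
    then have "(\<Sum>r<L. int (z r l)) = int L * int (y l)" using sumz[of l] by (simp flip: of_nat_sum)
    then show "int (y l) * (\<Sum>r<L. int (z r l)) = int L * (int (y l))\<^sup>2" by (simp add: power2_eq_square)
  qed
  also have "\<dots> = int L * int (nsq y)" by (simp add: nsq_def sum_distrib_left)
  finally have zero: "(\<Sum>r<L. \<Sum>l<D. (int (z r l) - int (y l))\<^sup>2) = 0" by simp
  have "(\<Sum>l<D. (int (z 0 l) - int (y l))\<^sup>2) = 0"
    using zero L by (subst (asm) sum_nonneg_eq_0_iff) (auto intro: sum_nonneg)
  then have zy: "z 0 l = y l" if "l < D" for l
    using that by (subst (asm) sum_nonneg_eq_0_iff) auto
  then have nz: "nsq (z 0) = nsq y" by (simp add: nsq_def)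
  have P1: "?P 1 l = ?P 0 l + y l" if "l < D" for l using step[of 0 l] L zy that by simp
  have S1: "?S 1 = s + nsq y" using step[of 0] L nz end0 by simp
  have ext: "?P 1 = restrict (?P 1) {..<D}"
  proof -
    obtain a b w where "p 0 = (a, b, w)" by (cases "p 0")
    then have "u 1 = rs_emb (a, b, w) (fst (u 1))" using p[of 0] L by simp
    from arg_cong[OF this, of "\<lambda>w. fst (snd w)"]
    have "?P 1 = restrict (\<lambda>t. a t + c (fst (u 1)) * w t) {..<D}" by (simp only: rs_emb_simp fst_conv snd_conv)
    then show ?thesis by simp
  qed
  have "?P 1 = restrict (\<lambda>t. ?P 0 t + (?P L t - ?P 0 t) div L) {..<D}"
    by (subst ext) (rule restrict_ext, use P1 end0 L in simp)
  moreover have "?S 1 = ?S 0 + (?S L - ?S 0) div L" using S1 end0 L by simp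
  ultimately show ?thesis by (metis prod.collapse)
qed

end

end

text \<open>The ratio of the squared number of vertices of the graph \<open>rs_graph\<close> to \<open>d\<^sup>2\<close>
  times the number of its edge-disjoint copies of a graph on \<open>k\<close> vertices.\<close>

definition hard_const :: "nat \<Rightarrow> nat \<Rightarrow> nat" where
  "hard_const k D = D * k\<^sup>2 * (2 * k) ^ (2 * D + 2)"

lemma core_nonbipartite:
  assumes H: "simple_graph H" "\<not> bipartite H"
  shows "\<not> bipartite (core H)" "edges (core H) \<noteq> {}" "card (verts (core H)) > 0" "edges H \<noteq> {}"
proof -
  obtain \<rho> where \<rho>: "is_hom \<rho> H (core H)" by (rule core_retraction[OF H(1)])
  have K: "simple_graph (core H)" by (rule core_subgraph[OF H(1)])
  show nb: "\<not> bipartite (core H)" using bipartite_pullback[OF H(1) K \<rho>] H(2) by blast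
  then show e: "edges (core H) \<noteq> {}" using bipartite_iff_coloring[OF K] by auto
  then show "edges H \<noteq> {}" using core_subgraph(2)[OF H(1)] by auto
  obtain x where "x \<in> edges (core H)" using e by blast
  then have "verts (core H) \<noteq> {}" using simple_edgeE[OF K] by (metis empty_iff)
  then show "card (verts (core H)) > 0" using K by (simp add: simple_graph_def card_gt_0_iff)
qed

text \<open>The labels along the cycle are prescribed; all others are placed above them to keep the labelling injective.\<close>

lemma exists_cycle_labelling:
  assumes K: "simple_graph K" and v: "inj_on v {..L}" "v ` {..L} \<subseteq> verts K"
  obtains c :: "'a \<Rightarrow> nat" where "\<And>i. i \<in> verts K \<Longrightarrow> c i < 2 * card (verts K)" "inj_on c (verts K)"
    "\<And>t. t \<le> L \<Longrightarrow> c (v t) = t"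
proof -
  have fin: "finite (verts K)" using K by (simp add: simple_graph_def)
  obtain f where f: "bij_betw f (verts K) {0..<card (verts K)}" using ex_bij_betw_finite_nat[OF fin] by blast
  have Lk: "Suc L \<le> card (verts K)" using card_inj_on_le[OF v(1) v(2) fin] by simp
  \<comment> \<open>The default \<open>Suc L + f x\<close> exceeds all labels on the cycle.\<close>
  define c where "c = (\<lambda>x. if x \<in> v ` {..L} then inv_into {..L} v x else Suc L + f x)"
  have ct: "c (v t) = t" if "t \<le> L" for t using that v(1) by (simp add: c_def)
  have "c i < 2 * card (verts K)" if "i \<in> verts K" for i
  proof (cases "i \<in> v ` {..L}")
    case True
    then obtain t where "t \<le> L" "i = v t" by auto
    then show ?thesis using ct Lk by simp
  next
    case False
    have "f i < card (verts K)" using f that by (auto simp: bij_betw_def)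
    then show ?thesis using False Lk by (simp add: c_def)
  qed
  moreover have "inj_on c (verts K)"
  proof (rule inj_onI)
    fix x y assume xy: "x \<in> verts K" "y \<in> verts K" "c x = c y"
    have lt: "c (v t) < Suc L" if "t \<le> L" for t using ct[OF that] that by simp
    show "x = y"
    proof (cases "x \<in> v ` {..L}"; cases "y \<in> v ` {..L}")
      assume "x \<in> v ` {..L}" "y \<in> v ` {..L}"
      then show ?thesis using ct xy(3) by auto
    next
      assume "x \<in> v ` {..L}" "y \<notin> v ` {..L}"
      then show ?thesis using lt xy(3) by (fastforce simp: c_def[THEN fun_cong, of y])
    next
      assume "x \<notin> v ` {..L}" "y \<in> v ` {..L}"
      then show ?thesis using lt xy(3) by (fastforce simp: c_def[THEN fun_cong, of x])
    next
      assume "x \<notin> v ` {..L}" "y \<notin> v ` {..L}"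
      then have "f x = f y" using xy(3) by (simp add: c_def)
      then show ?thesis using f xy by (auto simp: bij_betw_def inj_on_def)
    qed
  qed
  ultimately show thesis using ct by (rule that)
qed

text \<open>A homomorphism from \<open>H\<close> to the graph induces an endomorphism, hence an automorphism, of the
  core, so some vertices of \<open>H\<close> take the roles of the cycle and \<open>rs_closing\<close> applies
  to them. The factor \<open>\<Delta>\<close> saved in this way is what makes the number of homomorphisms
  small, at most \<open>n ^ h / d ^ D\<close> up to a constant, while a number of edges of order
  \<open>n\<^sup>2 / d\<^sup>2\<close> has to be removed.\<close>

lemma exists_hard_graph:
  fixes H :: "'a graph"
  assumes H: "simple_graph H" "connected_graph H" "\<not> bipartite H" and D: "D > 0" and d: "d > 0"
  obtains G :: "nat graph" where "simple_graph G" "card (verts G) > 0"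
    "card (hom_copies H G) * d ^ D \<le> card (verts H) ^ 3 * card (verts G) ^ card (verts H)"
    "\<And>R. R \<subseteq> edges G \<Longrightarrow> card R * (hard_const (card (verts (core H))) D * d\<^sup>2) < (card (verts G))\<^sup>2 \<Longrightarrow>
      \<not> hom_free H (remove_edges G R)"
proof -
  let ?K = "core H" and ?k = "card (verts (core H))" and ?h = "card (verts H)"
  have K: "simple_graph ?K" "verts ?K \<subseteq> verts H" "edges ?K \<subseteq> edges H" by (rule core_subgraph[OF H(1)])+
  note Kf = core_nonbipartite[OF H(1,3)]
  obtain L and v :: "nat \<Rightarrow> 'a" where L: "L \<ge> 2" and v: "inj_on v {..L}"
      "\<And>t. t < L \<Longrightarrow> {v t, v (Suc t)} \<in> edges ?K" "{v 0, v L} \<in> edges ?K"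
    using exists_cycle[OF K(1) Kf(1)] by metis
  have vK: "v t \<in> verts ?K" if "t \<le> L" for t
  proof (cases "t < L")
    case True
    show ?thesis using simple_edge_verts[OF K(1) v(2)[OF True]] by simp
  next
    case False
    then show ?thesis using simple_edge_verts[OF K(1) v(3)] that by simp
  qed
  obtain c :: "'a \<Rightarrow> nat" where c: "\<And>i. i \<in> verts ?K \<Longrightarrow> c i < 2 * ?k" "inj_on c (verts ?K)"
      "\<And>t. t \<le> L \<Longrightarrow> c (v t) = t"
    using exists_cycle_labelling[OF K(1) v(1)] vK by (metis atMost_iff image_subsetI)
  define Q where "Q = rs_graph ?K c D d"
  have Q: "simple_graph Q" unfolding Q_def by (rule rs_simple[OF K(1) c(1,2) D d])
  \<comment> \<open>The position of the vertex \<open>v 1\<close> as a function of those of \<open>v 0\<close> and \<open>v L\<close>: one \<open>L\<close>-th of the way.\<close>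
  define F :: "'a \<times> (nat \<Rightarrow> nat) \<times> nat \<Rightarrow> 'a \<times> (nat \<Rightarrow> nat) \<times> nat \<Rightarrow> 'a \<times> (nat \<Rightarrow> nat) \<times> nat"
    where "F = (\<lambda>a b. (v 1, restrict (\<lambda>t. fst (snd a) t + (fst (snd b) t - fst (snd a) t) div L) {..<D},
      snd (snd a) + (snd (snd b) - snd (snd a)) div L))"
  have deg: "card (nbhd Q u) \<le> ?k * d ^ D" for u
    unfolding Q_def by (rule rs_degree[OF K(1) c(1,2) D d])
  have homs: "card (hom_set H Q) \<le> ?h ^ 3 * (card (verts Q) * (?k * d ^ D) ^ (?h - 2))"
  proof (rule card_homs_determined_le[OF H(1,2) Q deg, where f=F])
    fix \<theta> assume "\<theta> \<in> hom_set H Q"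
    then have \<theta>: "is_hom \<theta> H Q" by (simp add: hom_set_def)
    have \<sigma>: "is_hom (fst \<circ> \<theta>) ?K ?K"
    proof (rule is_homI[OF K(1)])
      show "(fst \<circ> \<theta>) x \<in> verts ?K" if "x \<in> verts ?K" for x
        using that K(2) \<theta> by (fastforce simp: is_hom_def Q_def rs_graph_def)
      show "{(fst \<circ> \<theta>) a, (fst \<circ> \<theta>) b} \<in> edges ?K" if "{a, b} \<in> edges ?K" for a b
      proof -
        have "{\<theta> a, \<theta> b} \<in> edges (rs_graph ?K c D d)" using is_hom_edge[OF \<theta>, of a b] that K(3) by (auto simp: Q_def)
        from rs_edgeE[OF K(1) c(1,2) D d this] show ?thesis by (metis comp_apply)
      qed
    qed
    obtain \<tau> where \<tau>: "is_hom \<tau> ?K ?K" "\<And>x. x \<in> verts ?K \<Longrightarrow> (fst \<circ> \<theta>) (\<tau> x) = x"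
      using core_endo_inverse[OF H(1) \<sigma>] by blast
    let ?u = "\<lambda>t. \<theta> (\<tau> (v t))"
    have fu: "fst (?u t) = v t" if "t \<le> L" for t using \<tau>(2)[OF vK[OF that]] by simp
    have ed: "{\<tau> a, \<tau> b} \<in> edges H" if "{a, b} \<in> edges ?K" for a b
      using is_hom_edge[OF \<tau>(1) that] K(3) by blast
    have ed': "{\<theta> (\<tau> a), \<theta> (\<tau> b)} \<in> edges (rs_graph ?K c D d)" if "{a, b} \<in> edges ?K" for a b
      using is_hom_edge[OF \<theta> ed[OF that]] by (simp add: Q_def)
    have "?u 1 = F (?u 0) (?u L)"
      using rs_closing[OF K(1) c(1,2) D d, of L ?u] ed'[OF v(2)] ed'[OF v(3)] L fu c(3)
      by (simp add: F_def)
    moreover have "\<tau> (v 1) \<noteq> \<tau> (v 0)" "\<tau> (v 1) \<noteq> \<tau> (v L)"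
    proof -
      have "v 1 \<noteq> v 0" "v 1 \<noteq> v L"
        using inj_on_eq_iff[OF v(1), of 1 0] inj_on_eq_iff[OF v(1), of 1 L] L by auto
      then show "\<tau> (v 1) \<noteq> \<tau> (v 0)" "\<tau> (v 1) \<noteq> \<tau> (v L)" using fu[of 0] fu[of 1] fu[of L] L by auto
    qed
    moreover have "\<tau> (v 1) \<in> verts H" using vK[of 1] L \<tau>(1) K(2) by (auto simp: is_hom_def)
    ultimately show "\<exists>\<alpha> \<beta> \<gamma>. {\<alpha>, \<beta>} \<in> edges H \<and> \<gamma> \<in> verts H \<and> \<gamma> \<noteq> \<alpha> \<and> \<gamma> \<noteq> \<beta> \<and> \<theta> \<gamma> = F (\<theta> \<alpha>) (\<theta> \<beta>)"
      using ed[OF v(3)] by blast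
  qed
  let ?n = "card (verts Q)"
  have nQ: "?n = ?k * ((2 * ?k * d) ^ D * (2 * ?k * (D * d\<^sup>2)))"
    unfolding Q_def by (rule card_rs_verts[OF K(1) c(1,2) D d])
  have n0: "?n > 0" unfolding nQ using Kf(3) D d by simp
  have h2: "?h \<ge> 2"
  proof -
    have "{v 0, v L} \<subseteq> verts H" using vK K(2) by auto
    then have "card {v 0, v L} \<le> ?h" using H(1) by (intro card_mono) (auto simp: simple_graph_def)
    moreover have "v 0 \<noteq> v L" using simple_edge_neq[OF K(1) v(3)] .
    ultimately show ?thesis by simp
  qed
  have "card (hom_set H Q) * d ^ D \<le> ?h ^ 3 * (?n * (?k * d ^ D) ^ (?h - 2)) * (?k * d ^ D)"
    using Kf(3) by (intro mult_mono homs) auto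
  also have "\<dots> = ?h ^ 3 * ?n * (?k * d ^ D) ^ Suc (?h - 2)" by (simp add: mult_ac)
  also have "\<dots> \<le> ?h ^ 3 * ?n * ?n ^ Suc (?h - 2)"
  proof (intro mult_left_mono power_mono)
    have "d ^ D * 1 \<le> (2 * ?k * d) ^ D * (2 * ?k * (D * d\<^sup>2))"
      using Kf(3) D d by (intro mult_mono power_mono) auto
    then show "?k * d ^ D \<le> ?n" unfolding nQ by simp
  qed auto
  also have "\<dots> = ?h ^ 3 * ?n ^ ?h"
  proof -
    have "?h = Suc (Suc (?h - 2))" using h2 by simp
    then have "?n * ?n ^ Suc (?h - 2) = ?n ^ ?h" by (metis power_Suc)
    then show ?thesis by (simp add: mult.assoc)
  qed
  finally have few: "card (hom_set H Q) * d ^ D \<le> ?h ^ 3 * ?n ^ ?h" .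
  have sq: "?n\<^sup>2 = card (rs_param D d) * (hard_const ?k D * d\<^sup>2)"
  proof -
    have cp: "card (rs_param D d) = d ^ D * (D * d\<^sup>2 * d ^ D)"
      by (rule card_rs_param[OF K(1) c(1,2) D d])
    show ?thesis unfolding nQ hard_const_def cp
      by (simp add: power_mult_distrib power_add power_mult power2_eq_square mult_ac)
  qed
  obtain \<rho> where \<rho>: "is_hom \<rho> H ?K" by (rule core_retraction[OF H(1)])
  obtain G :: "nat graph" and f where G: "simple_graph G" "bij_betw f (verts Q) (verts G)"
    "edges G = (\<lambda>e. f ` e) ` edges Q" by (rule copy_on_nat[OF Q])
  have nG: "card (verts G) = ?n" using bij_betw_same_card[OF G(2)] by simp
  let ?g = "inv_into (verts Q) f"
  have gf: "?g (f x) = x" if "x \<in> verts Q" for x using G(2) that by (simp add: bij_betw_inv_into_left)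
  have gfe: "?g ` f ` e = e" if "e \<in> edges Q" for e
    using G(2) simple_edge_sub[OF Q that] by (simp add: bij_betw_def inv_into_image_cancel)
  have g: "is_hom ?g G Q"
    unfolding is_hom_def using G gfe by (auto simp: bij_betw_def inv_into_into)
  show thesis
  proof (rule that[OF G(1)])
    show "card (verts G) > 0" using n0 nG by simp
    have "card (hom_copies H G) \<le> card (hom_set H G)" by (rule card_hom_copies_le[OF H(1) G(1)])
    also have "\<dots> \<le> card (hom_set H Q)"
    proof (rule card_inj_on_le[of "\<lambda>\<theta>. restrict (?g \<circ> \<theta>) (verts H)"])
      show "inj_on (\<lambda>\<theta>. restrict (?g \<circ> \<theta>) (verts H)) (hom_set H G)"
      proof (rule inj_onI)
        fix \<theta> \<theta>' assume a: "\<theta> \<in> hom_set H G" "\<theta>' \<in> hom_set H G"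
          "restrict (?g \<circ> \<theta>) (verts H) = restrict (?g \<circ> \<theta>') (verts H)"
        have "\<theta> x = \<theta>' x" if x: "x \<in> verts H" for x
        proof -
          have "?g (\<theta> x) = ?g (\<theta>' x)" using fun_cong[OF a(3), of x] x by simp
          moreover have "\<theta> x \<in> verts G" "\<theta>' x \<in> verts G" using a(1,2) x by (auto simp: hom_set_def)
          ultimately show ?thesis using G(2) by (metis bij_betw_inv_into_right)
        qed
        moreover have "\<theta> \<in> verts H \<rightarrow>\<^sub>E verts G" "\<theta>' \<in> verts H \<rightarrow>\<^sub>E verts G"
          using a(1,2) by (auto simp: hom_set_def)
        ultimately show "\<theta> = \<theta>'" using PiE_ext by blast
      qed
      show "(\<lambda>\<theta>. restrict (?g \<circ> \<theta>) (verts H)) ` hom_set H G \<subseteq> hom_set H Q"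
        by (intro image_subsetI restrict_in_hom_set[OF H(1) is_hom_comp[OF _ g]]) (simp add: hom_set_def)
      show "finite (hom_set H Q)" by (rule finite_hom_set[OF H(1) Q])
    qed
    finally show "card (hom_copies H G) * d ^ D \<le> ?h ^ 3 * card (verts G) ^ ?h"
      using few unfolding nG by (meson le_trans mult_le_mono1)
    fix R assume R: "R \<subseteq> edges G" "card R * (hard_const ?k D * d\<^sup>2) < (card (verts G))\<^sup>2"
    let ?R = "(\<lambda>e. ?g ` e) ` R"
    have finR: "finite R" using R(1) finite_edges[OF G(1)] finite_subset by blast
    have "card ?R \<le> card R" by (rule card_image_le[OF finR])
    moreover have "card R < card (rs_param D d)" using R(2) unfolding nG sq by simp
    ultimately have "card ?R < card (rs_param D d)" by simp
    moreover have "?R \<subseteq> edges Q" using R(1) G(3) gfe by auto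
    ultimately obtain \<phi> where \<phi>: "is_hom \<phi> ?K (remove_edges Q ?R)"
      using rs_removal_hard[OF K(1) c(1,2) D d] unfolding Q_def by blast
    have "is_hom f (remove_edges Q ?R) (remove_edges G R)"
      unfolding is_hom_def
    proof (intro conjI ballI)
      show "f ` verts (remove_edges Q ?R) \<subseteq> verts (remove_edges G R)"
        using G(2) by (auto simp: remove_edges_def bij_betw_def)
      fix e assume "e \<in> edges (remove_edges Q ?R)"
      then have e: "e \<in> edges Q" "e \<notin> ?R" by (auto simp: remove_edges_def)
      have "f ` e \<notin> R"
      proof
        assume "f ` e \<in> R"
        then have "?g ` f ` e \<in> ?R" by (rule imageI)
        then show False using e gfe[OF e(1)] by simp
      qed
      then show "f ` e \<in> edges (remove_edges G R)" using e G(3) by (auto simp: remove_edges_def)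
    qed
    from is_hom_comp[OF \<rho> is_hom_comp[OF \<phi> this]] show "\<not> hom_free H (remove_edges G R)"
      by (auto simp: hom_free_def)
  qed
qed

section \<open>Partitions of the cube into fibres with few disagreements\<close>

text \<open>The generating function of the Hamming distance to \<open>a\<close> on the coordinates in \<open>U\<close>.\<close>

lemma sum_Pow_weight:
  fixes w :: real
  assumes "finite T" "U \<subseteq> T" "a \<subseteq> U"
  shows "(\<Sum>s\<in>Pow T. w ^ card {x \<in> U. (x \<in> s) \<noteq> (x \<in> a)}) = 2 ^ (card T - card U) * (1 + w) ^ card U"
proof -
  let ?f = "\<lambda>x. if x \<in> U \<and> x \<notin> a then w else 1" and ?g = "\<lambda>x. if x \<in> U \<and> x \<in> a then w else 1"
  have finU: "finite U" using assms finite_subset by blast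
  have "(\<Sum>s\<in>Pow T. w ^ card {x \<in> U. (x \<in> s) \<noteq> (x \<in> a)}) = (\<Sum>s\<in>Pow T. prod ?f s * prod ?g (T - s))"
  proof (rule sum.cong[OF refl])
    fix s assume s: "s \<in> Pow T"
    have "prod ?f s * prod ?g (T - s) = (\<Prod>x\<in>T. if x \<in> s then ?f x else ?g x)"
    proof -
      have "(\<Prod>x\<in>T. if x \<in> s then ?f x else ?g x) = prod ?f (T \<inter> s) * prod ?g (T \<inter> - s)"
        using prod.If_cases[OF assms(1), of "\<lambda>x. x \<in> s" ?f ?g] by simp
      then show ?thesis using s by (simp add: Int_absorb1 Diff_eq)
    qed
    also have "\<dots> = (\<Prod>x\<in>T. if (x \<in> U \<and> (x \<in> s) \<noteq> (x \<in> a)) then w else 1)"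
      by (intro prod.cong refl) auto
    also have "\<dots> = w ^ card (T \<inter> {x. x \<in> U \<and> (x \<in> s) \<noteq> (x \<in> a)})"
      using assms(1) by (simp add: prod.If_cases)
    also have "T \<inter> {x. x \<in> U \<and> (x \<in> s) \<noteq> (x \<in> a)} = {x \<in> U. (x \<in> s) \<noteq> (x \<in> a)}" using assms(2) by auto
    finally show "w ^ card {x \<in> U. (x \<in> s) \<noteq> (x \<in> a)} = prod ?f s * prod ?g (T - s)" by simp
  qed
  also have "\<dots> = (\<Prod>x\<in>T. ?f x + ?g x)" by (rule prod_add[OF assms(1), symmetric])
  also have "\<dots> = (\<Prod>x\<in>T. if x \<in> U then 1 + w else 2)" by (intro prod.cong refl) auto
  also have "\<dots> = 2 ^ (card T - card U) * (1 + w) ^ card U"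
    using assms finU by (simp add: prod.If_cases Int_absorb1 Diff_eq[symmetric] card_Diff_subset)
  finally show ?thesis .
qed

text \<open>Within a fibre of \<open>f\<close> all points agree with a common set \<open>a\<close> on the coordinates
  that are not lost, so the distance from \<open>a\<close> is at most the number of lost coordinates. Compare
  the sum of \<open>exp (- lost)\<close> over the cube, which is large by convexity, with the sum of
  \<open>exp (- distance)\<close> for each fibre, which is at most \<open>exp (- card U / 4)\<close> times the
  size of the cube.\<close>

lemma fibres_bound:
  assumes T: "finite T" "U \<subseteq> T" and Y: "finite Y" and f: "f ` Pow T \<subseteq> Y"
    and lost: "(\<Sum>s\<in>Pow T. real (card {x \<in> U. lost x s})) \<le> card U / 20 * 2 ^ card T"
    and agree: "\<And>s s' x. s \<subseteq> T \<Longrightarrow> s' \<subseteq> T \<Longrightarrow> f s = f s' \<Longrightarrow> x \<in> U \<Longrightarrow> \<not> lost x s \<Longrightarrow> \<not> lost x s' \<Longrightarrow> x \<in> s \<Longrightarrow> x \<in> s'"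
  shows "exp (card U / 5) \<le> real (card Y)"
proof -
  let ?q = "2 ^ card T :: real" and ?l = "\<lambda>s. card {x \<in> U. lost x s}" and ?w = "exp (-1) :: real"
  \<comment> \<open>The common value of the fibre over \<open>y\<close> on the coordinates that are not lost.\<close>
  define a where "a = (\<lambda>y. {x \<in> U. \<exists>s\<subseteq>T. f s = y \<and> \<not> lost x s \<and> x \<in> s})"
  let ?\<mu> = "card U / 20 :: real"
  have finU: "finite U" using T finite_subset by blast
  have cP: "real (card (Pow T)) = ?q" using T by (simp add: card_Pow)
  have "?q * exp (- ?\<mu>) \<le> exp (- ?\<mu>) * (\<Sum>s\<in>Pow T. 1 + (?\<mu> - real (?l s)))"
  proof -
    have "?q \<le> (\<Sum>s\<in>Pow T. 1 + (?\<mu> - real (?l s)))"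
      using lost by (simp add: sum.distrib sum_subtractf cP mult.commute card_Pow T)
    then show ?thesis by (simp add: mult.commute)
  qed
  also have "\<dots> \<le> (\<Sum>s\<in>Pow T. ?w ^ ?l s)"
    unfolding sum_distrib_left
  proof (rule sum_mono)
    fix s
    have "exp (- ?\<mu>) * (1 + (?\<mu> - real (?l s))) \<le> exp (- ?\<mu>) * exp (?\<mu> - real (?l s))"
      by (intro mult_left_mono exp_ge_add_one_self) simp
    also have "\<dots> = ?w ^ ?l s" by (simp add: exp_of_nat_mult[symmetric] exp_add[symmetric])
    finally show "exp (- ?\<mu>) * (1 + (?\<mu> - real (?l s))) \<le> ?w ^ ?l s" .
  qed
  also have "\<dots> \<le> (\<Sum>s\<in>Pow T. \<Sum>y\<in>Y. ?w ^ card {x \<in> U. (x \<in> s) \<noteq> (x \<in> a y)})"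
  proof (rule sum_mono)
    fix s assume s: "s \<in> Pow T"
    have "{x \<in> U. (x \<in> s) \<noteq> (x \<in> a (f s))} \<subseteq> {x \<in> U. lost x s}"
      using s agree[of _ s] by (auto simp: a_def)
    then have "card {x \<in> U. (x \<in> s) \<noteq> (x \<in> a (f s))} \<le> ?l s" using finU by (intro card_mono) auto
    then have "?w ^ ?l s \<le> ?w ^ card {x \<in> U. (x \<in> s) \<noteq> (x \<in> a (f s))}" by (intro power_decreasing) auto
    also have "\<dots> \<le> (\<Sum>y\<in>Y. ?w ^ card {x \<in> U. (x \<in> s) \<noteq> (x \<in> a y)})"
      using s f Y by (intro member_le_sum[where f="\<lambda>y. ?w ^ card {x \<in> U. (x \<in> s) \<noteq> (x \<in> a y)}"]) auto
    finally show "?w ^ ?l s \<le> (\<Sum>y\<in>Y. ?w ^ card {x \<in> U. (x \<in> s) \<noteq> (x \<in> a y)})" .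
  qed
  also have "\<dots> = (\<Sum>y\<in>Y. \<Sum>s\<in>Pow T. ?w ^ card {x \<in> U. (x \<in> s) \<noteq> (x \<in> a y)})" by (rule sum.swap)
  also have "\<dots> = (\<Sum>y\<in>Y. 2 ^ (card T - card U) * (1 + ?w) ^ card U)"
    by (intro sum.cong refl sum_Pow_weight T) (auto simp: a_def)
  also have "\<dots> = card Y * (2 ^ (card T - card U) * (1 + ?w) ^ card U)" by simp
  also have "\<dots> \<le> card Y * (?q * exp (- (card U / 4)))"
  proof (rule mult_left_mono)
    have "2 \<le> exp (1::real)" using exp_ge_add_one_self[of "1::real"] by simp
    then have w: "?w \<le> 1 / 2" by (simp add: exp_minus field_simps)
    have "(3 / 4 :: real) \<le> exp (- (1 / 4))" using exp_ge_add_one_self[of "- (1 / 4) :: real"] by simp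
    then have "1 + ?w \<le> 2 * exp (- (1 / 4))" using w by linarith
    then have "(1 + ?w) ^ card U \<le> (2 * exp (- (1 / 4))) ^ card U" by (intro power_mono) (auto intro: add_nonneg_nonneg)
    also have "\<dots> = 2 ^ card U * exp (- (card U / 4))"
      by (simp add: power_mult_distrib exp_of_nat_mult[symmetric])
    finally have "2 ^ (card T - card U) * (1 + ?w) ^ card U \<le> 2 ^ (card T - card U) * (2 ^ card U * exp (- (card U / 4)))"
      by (rule mult_left_mono) simp
    also have "\<dots> = ?q * exp (- (card U / 4))"
      using card_mono[OF T] by (simp add: power_add[symmetric] mult.assoc[symmetric])
    finally show "2 ^ (card T - card U) * (1 + ?w) ^ card U \<le> ?q * exp (- (card U / 4))" .
  qed simp
  finally have "exp (- ?\<mu>) \<le> card Y * exp (- (card U / 4))" by simp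
  then have "exp (- ?\<mu>) * exp (card U / 4) \<le> card Y * exp (- (card U / 4)) * exp (card U / 4)"
    by (rule mult_right_mono) simp
  then show ?thesis by (simp add: exp_add[symmetric] mult.assoc)
qed

section \<open>The switching blow-up\<close>

definition unique_copies :: "'a graph \<Rightarrow> 'v graph \<Rightarrow> bool" where
  "unique_copies K G \<longleftrightarrow> (\<forall>e \<in> edges G. \<exists>!T. T \<in> hom_copies K G \<and> e \<in> edges T)"

definition chosen_hom :: "'a graph \<Rightarrow> 'v graph \<Rightarrow> 'v graph \<Rightarrow> 'a \<Rightarrow> 'v" where
  "chosen_hom K G T = (SOME \<psi>. is_hom \<psi> K G \<and> T = hom_image \<psi> K)"

text \<open>The clone \<open>s\<close> of the vertex in role \<open>i0\<close> keeps the edge towards \<open>j0\<close>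
  of the copy \<open>T\<close> only if \<open>T \<notin> s\<close>, and the edge towards \<open>j1\<close>
  only if \<open>T \<in> s\<close>. All other edges of \<open>T\<close> are kept.\<close>

definition switch :: "'a \<Rightarrow> 'a \<Rightarrow> 'a \<Rightarrow> 'v graph \<Rightarrow> 'a \<Rightarrow> 'a \<Rightarrow> 'v graph set \<Rightarrow> bool" where
  "switch i0 j0 j1 T i j s \<longleftrightarrow> (i = i0 \<longrightarrow> (j = j0 \<longrightarrow> T \<notin> s) \<and> (j = j1 \<longrightarrow> T \<in> s))"

text \<open>Clones are indexed by sets of copies in every role, not only in the role \<open>i0\<close>, so that all
  vertices have equally many clones and no vertex of \<open>G\<close> counts more than another.\<close>

definition switch_blowup :: "'a graph \<Rightarrow> 'v graph \<Rightarrow> 'a \<Rightarrow> 'a \<Rightarrow> 'a \<Rightarrow> ('a \<times> 'v \<times> 'v graph set) graph" where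
  "switch_blowup K G i0 j0 j1 =
    \<lparr>verts = verts K \<times> verts G \<times> Pow (hom_copies K G),
     edges = {{(i, chosen_hom K G T i, s), (j, chosen_hom K G T j, s')} | T i j s s'.
        T \<in> hom_copies K G \<and> {i, j} \<in> edges K \<and> s \<subseteq> hom_copies K G \<and> s' \<subseteq> hom_copies K G \<and>
        switch i0 j0 j1 T i j s \<and> switch i0 j0 j1 T j i s'}\<rparr>"

lemma chosen_hom:
  assumes "T \<in> hom_copies K G"
  shows "is_hom (chosen_hom K G T) K G" "T = hom_image (chosen_hom K G T) K"
proof -
  have "\<exists>\<psi>. is_hom \<psi> K G \<and> T = hom_image \<psi> K" using assms by (auto simp: hom_copies_def)
  from someI_ex[OF this] show "is_hom (chosen_hom K G T) K G" "T = hom_image (chosen_hom K G T) K"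
    by (auto simp: chosen_hom_def)
qed

lemma chosen_hom_edge:
  assumes "T \<in> hom_copies K G" "{i, j} \<in> edges K"
  shows "{chosen_hom K G T i, chosen_hom K G T j} \<in> edges T" "{chosen_hom K G T i, chosen_hom K G T j} \<in> edges G"
proof -
  show "{chosen_hom K G T i, chosen_hom K G T j} \<in> edges G"
    by (rule is_hom_edge[OF chosen_hom(1)[OF assms(1)] assms(2)])
  have "chosen_hom K G T ` {i, j} \<in> edges (hom_image (chosen_hom K G T) K)"
    using assms(2) unfolding hom_image_def graph.select_convs by (rule imageI)
  then show "{chosen_hom K G T i, chosen_hom K G T j} \<in> edges T"
    using chosen_hom(2)[OF assms(1)] by simp
qed

lemma switch_blowup_edgeE:
  assumes "{x, y} \<in> edges (switch_blowup K G i0 j0 j1)"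
  obtains T where "T \<in> hom_copies K G" "{fst x, fst y} \<in> edges K"
    "fst (snd x) = chosen_hom K G T (fst x)" "fst (snd y) = chosen_hom K G T (fst y)"
    "switch i0 j0 j1 T (fst x) (fst y) (snd (snd x))" "switch i0 j0 j1 T (fst y) (fst x) (snd (snd y))"
proof -
  obtain T i j s s' where T: "T \<in> hom_copies K G" "{i, j} \<in> edges K"
    "switch i0 j0 j1 T i j s" "switch i0 j0 j1 T j i s'"
    "{x, y} = {(i, chosen_hom K G T i, s), (j, chosen_hom K G T j, s')}"
    using assms unfolding switch_blowup_def graph.select_convs mem_Collect_eq by (elim exE conjE) (rule that)
  from T(5) consider "x = (i, chosen_hom K G T i, s)" "y = (j, chosen_hom K G T j, s')" |
      "y = (i, chosen_hom K G T i, s)" "x = (j, chosen_hom K G T j, s')"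
    by (auto simp: doubleton_eq_iff)
  then show thesis
  proof cases
    case 1
    then show thesis using T by (intro that[of T]) simp_all
  next
    case 2
    then show thesis using T by (intro that[of T]) (simp_all add: insert_commute)
  qed
qed

lemma switch_blowup_edgeI:
  assumes "T \<in> hom_copies K G" "{i, j} \<in> edges K" "s \<subseteq> hom_copies K G" "s' \<subseteq> hom_copies K G"
    "switch i0 j0 j1 T i j s" "switch i0 j0 j1 T j i s'"
  shows "{(i, chosen_hom K G T i, s), (j, chosen_hom K G T j, s')} \<in> edges (switch_blowup K G i0 j0 j1)"
  unfolding switch_blowup_def graph.select_convs mem_Collect_eq using assms by blast

lemma switch_blowup_simple:
  assumes K: "simple_graph K" and G: "simple_graph G"
  shows "simple_graph (switch_blowup K G i0 j0 j1)"
  unfolding simple_graph_def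
proof (intro conjI ballI)
  have "finite (hom_copies K G)" by (simp add: hom_copies_eq[OF K] finite_hom_set[OF K G])
  then show "finite (verts (switch_blowup K G i0 j0 j1))"
    using K G by (simp add: switch_blowup_def simple_graph_def)
  fix e assume "e \<in> edges (switch_blowup K G i0 j0 j1)"
  then obtain T i j s s' where T: "T \<in> hom_copies K G" "{i, j} \<in> edges K" "s \<subseteq> hom_copies K G" "s' \<subseteq> hom_copies K G"
    "e = {(i, chosen_hom K G T i, s), (j, chosen_hom K G T j, s')}"
    unfolding switch_blowup_def graph.select_convs mem_Collect_eq by (elim exE conjE) (rule that)
  have ij: "i \<noteq> j" "i \<in> verts K" "j \<in> verts K" using T(2) simple_edge_neq[OF K] simple_edge_verts[OF K] by blast+
  have "chosen_hom K G T i \<in> verts G" "chosen_hom K G T j \<in> verts G"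
    using chosen_hom(1)[OF T(1)] ij by (auto simp: is_hom_def)
  then show "e \<subseteq> verts (switch_blowup K G i0 j0 j1)" using T ij by (simp add: switch_blowup_def)
  show "card e = 2" using T(5) ij by simp
qed

text \<open>A homomorphism from \<open>K\<close> projects to \<open>V(K)\<close> as an automorphism and to
  \<open>G\<close> as a copy \<open>T0\<close>. By uniqueness all its edges come from \<open>T0\<close>, so
  the clone in role \<open>i0\<close> would have kept both switched edges of \<open>T0\<close>.\<close>

lemma switch_blowup_hom_free:
  assumes H: "simple_graph H" and uniq: "unique_copies (core H) G"
    and ij: "{i0, j0} \<in> edges (core H)" "{i0, j1} \<in> edges (core H)"
  shows "hom_free (core H) (switch_blowup (core H) G i0 j0 j1)"
proof (rule ccontr)
  let ?K = "core H" let ?B = "switch_blowup ?K G i0 j0 j1"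
  assume "\<not> hom_free ?K ?B"
  then obtain \<theta> where \<theta>: "is_hom \<theta> ?K ?B" by (auto simp: hom_free_def)
  have K: "simple_graph ?K" by (rule core_subgraph[OF H])
  have vb: "\<theta> v \<in> verts ?B" if "v \<in> verts ?K" for v using \<theta> that by (auto simp: is_hom_def)
  have \<sigma>: "is_hom (fst \<circ> \<theta>) ?K ?K"
  proof (rule is_homI[OF K])
    show "(fst \<circ> \<theta>) v \<in> verts ?K" if "v \<in> verts ?K" for v
      using vb[OF that] by (auto simp: switch_blowup_def)
    show "{(fst \<circ> \<theta>) a, (fst \<circ> \<theta>) b} \<in> edges ?K" if "{a, b} \<in> edges ?K" for a b
      using switch_blowup_edgeE[OF is_hom_edge[OF \<theta> that]] by (metis comp_apply)
  qed
  define \<eta> where "\<eta> = fst \<circ> snd \<circ> \<theta>"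
  have \<eta>: "is_hom \<eta> ?K G"
  proof (rule is_homI[OF K])
    show "\<eta> v \<in> verts G" if "v \<in> verts ?K" for v
      using vb[OF that] by (auto simp: switch_blowup_def \<eta>_def)
    show "{\<eta> a, \<eta> b} \<in> edges G" if "{a, b} \<in> edges ?K" for a b
    proof -
      obtain T where "T \<in> hom_copies ?K G" "{fst (\<theta> a), fst (\<theta> b)} \<in> edges ?K"
        "fst (snd (\<theta> a)) = chosen_hom ?K G T (fst (\<theta> a))" "fst (snd (\<theta> b)) = chosen_hom ?K G T (fst (\<theta> b))"
        by (rule switch_blowup_edgeE[OF is_hom_edge[OF \<theta> \<open>{a, b} \<in> edges ?K\<close>]])
      then show ?thesis using chosen_hom_edge(2)[of T ?K G "fst (\<theta> a)" "fst (\<theta> b)"] by (simp add: \<eta>_def)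
    qed
  qed
  define T0 where "T0 = hom_image \<eta> ?K"
  have T0: "T0 \<in> hom_copies ?K G" using \<eta> by (auto simp: hom_copies_def T0_def)
  have sw: "switch i0 j0 j1 T0 (fst (\<theta> a)) (fst (\<theta> b)) (snd (snd (\<theta> a)))" if ab: "{a, b} \<in> edges ?K" for a b
  proof -
    obtain T where T: "T \<in> hom_copies ?K G" "{fst (\<theta> a), fst (\<theta> b)} \<in> edges ?K"
      "fst (snd (\<theta> a)) = chosen_hom ?K G T (fst (\<theta> a))" "fst (snd (\<theta> b)) = chosen_hom ?K G T (fst (\<theta> b))"
      "switch i0 j0 j1 T (fst (\<theta> a)) (fst (\<theta> b)) (snd (snd (\<theta> a)))"
      by (rule switch_blowup_edgeE[OF is_hom_edge[OF \<theta> ab]])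
    have "{\<eta> a, \<eta> b} \<in> edges T" using chosen_hom_edge(1)[OF T(1,2)] T(3,4) by (simp add: \<eta>_def)
    moreover have "\<eta> ` {a, b} \<in> edges T0" unfolding T0_def hom_image_def graph.select_convs using ab by (rule imageI)
    then have "{\<eta> a, \<eta> b} \<in> edges T0" by simp
    moreover have "{\<eta> a, \<eta> b} \<in> edges G" by (rule is_hom_edge[OF \<eta> ab])
    ultimately have "T = T0" using uniq T(1) T0 unfolding unique_copies_def by blast
    then show ?thesis using T(5) by simp
  qed
  obtain \<tau> where \<tau>: "is_hom \<tau> ?K ?K" "\<And>x. x \<in> verts ?K \<Longrightarrow> (fst \<circ> \<theta>) (\<tau> x) = x"
    using core_endo_inverse[OF H \<sigma>] by blast
  have v: "i0 \<in> verts ?K" "j0 \<in> verts ?K" "j1 \<in> verts ?K" using ij simple_edge_verts[OF K] by blast+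
  have f: "fst (\<theta> (\<tau> i0)) = i0" "fst (\<theta> (\<tau> j0)) = j0" "fst (\<theta> (\<tau> j1)) = j1" using \<tau>(2) v by auto
  have "T0 \<notin> snd (snd (\<theta> (\<tau> i0)))"
    using sw[OF is_hom_edge[OF \<tau>(1) ij(1)]] f by (simp add: switch_def)
  moreover have "T0 \<in> snd (snd (\<theta> (\<tau> i0)))"
    using sw[OF is_hom_edge[OF \<tau>(1) ij(2)]] f by (simp add: switch_def)
  ultimately show False by simp
qed

section \<open>The lower bound\<close>

text \<open>Choose one random clone per role. Every bad edge belongs to exactly one copy and one edge of
  \<open>K\<close>, and is hit with probability \<open>1/Q\<^sup>2\<close>, where \<open>Q\<close> is the
  number of clones; letting the clone in role \<open>i0\<close> range over all \<open>Q\<close> possibilities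
  multiplies the expectation by \<open>Q\<close>.\<close>

lemma exists_good_slice:
  fixes K :: "'a graph" and G :: "'v graph"
  assumes K: "simple_graph K" and G: "simple_graph G" and uniq: "unique_copies K G" and i0: "i0 \<in> verts K"
    and Bad: "finite Bad"
  shows "\<exists>x \<in> verts K \<rightarrow>\<^sub>E Pow (hom_copies K G).
    (\<Sum>s\<in>Pow (hom_copies K G). \<Sum>T\<in>hom_copies K G. of_bool (\<exists>i j. {i, j} \<in> edges K \<and>
        {(i, chosen_hom K G T i, (x(i0 := s)) i), (j, chosen_hom K G T j, (x(i0 := s)) j)} \<in> Bad))
    \<le> card Bad / 2 ^ card (hom_copies K G)"
proof -
  let ?T = "hom_copies K G" and ?\<psi> = "chosen_hom K G"
  let ?Q = "2 ^ card ?T :: real" and ?X = "verts K \<rightarrow>\<^sub>E Pow ?T"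
  obtain P where P: "orientation K P" using exists_orientation[OF K] by blast
  have finP: "finite P" by (rule finite_orientation[OF K P])
  have PE: "{i, j} \<in> edges K" "i \<in> verts K" "j \<in> verts K" "i \<noteq> j" if "(i, j) \<in> P" for i j
    using P that by (force simp: orientation_def)+
  have Panti: "(j, i) \<notin> P" if "(i, j) \<in> P" for i j using P that by (auto simp: orientation_def)
  have EP: "(i, j) \<in> P \<or> (j, i) \<in> P" if "{i, j} \<in> edges K" for i j
    using P that by (auto simp: orientation_def doubleton_eq_iff)
  have finK: "finite (verts K)" using K by (simp add: simple_graph_def)
  have finT: "finite ?T" by (simp add: hom_copies_eq[OF K] finite_hom_set[OF K G])
  have finX: "finite ?X" using finK finT by (intro finite_PiE) auto
  have neX: "?X \<noteq> {}" by (auto simp: PiE_eq_empty_iff)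
  have cQ: "real (card (Pow ?T)) = ?Q" using finT by (simp add: card_Pow)
  define pos :: "('a \<Rightarrow> 'v graph set) \<Rightarrow> 'v graph \<Rightarrow> 'a \<Rightarrow> 'a \<times> 'v \<times> 'v graph set"
    where "pos = (\<lambda>x T i. (i, ?\<psi> T i, x i))"
  define lost where "lost = (\<lambda>x T. \<exists>i j. {i, j} \<in> edges K \<and> {pos x T i, pos x T j} \<in> Bad)"
  define L :: "('a \<Rightarrow> 'v graph set) \<Rightarrow> real" where "L = (\<lambda>x. \<Sum>T\<in>?T. of_bool (lost x T))"
  define b :: "'v graph \<Rightarrow> 'a \<times> 'a \<Rightarrow> 'v graph set \<Rightarrow> 'v graph set \<Rightarrow> real"
    where "b = (\<lambda>T p s s'. of_bool ({(fst p, ?\<psi> T (fst p), s), (snd p, ?\<psi> T (snd p), s')} \<in> Bad))"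
  have Lb: "L x \<le> (\<Sum>T\<in>?T. \<Sum>p\<in>P. b T p (x (fst p)) (x (snd p)))" for x
    unfolding L_def
  proof (rule sum_mono)
    fix T assume "T \<in> ?T"
    show "of_bool (lost x T) \<le> (\<Sum>p\<in>P. b T p (x (fst p)) (x (snd p)))"
    proof (cases "lost x T")
      case True
      then obtain i j where ij: "{i, j} \<in> edges K" "{pos x T i, pos x T j} \<in> Bad" by (auto simp: lost_def)
      obtain p where p: "p \<in> P" "b T p (x (fst p)) (x (snd p)) = 1"
        using EP[OF ij(1)] ij(2) by (auto simp: b_def pos_def insert_commute)
      have "b T p (x (fst p)) (x (snd p)) \<le> (\<Sum>p\<in>P. b T p (x (fst p)) (x (snd p)))"
        using p(1) finP by (intro member_le_sum) (auto simp: b_def)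
      then show ?thesis using True p(2) by simp
    next
      case False
      then show ?thesis by (simp add: b_def sum_nonneg)
    qed
  qed
  have res: "?Q * (?Q * (\<Sum>x\<in>?X. b T p (x (fst p)) (x (snd p)))) = card ?X * (\<Sum>s\<in>Pow ?T. \<Sum>s'\<in>Pow ?T. b T p s s')"
    if "p \<in> P" for T p
    using sum_PiE_resample2[where I="verts K" and a="fst p" and b="snd p" and V="\<lambda>_. Pow ?T" and f="\<lambda>x. b T p (x (fst p)) (x (snd p))"]
      PE[of "fst p" "snd p"] that finK by (simp add: cQ)
  have inj: "(\<Sum>T\<in>?T. \<Sum>p\<in>P. \<Sum>s\<in>Pow ?T. \<Sum>s'\<in>Pow ?T. b T p s s') \<le> card Bad"
  proof -
    let ?A = "?T \<times> P \<times> Pow ?T \<times> Pow ?T"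
    let ?e = "\<lambda>(T, p, s, s'). {(fst p, ?\<psi> T (fst p), s), (snd p, ?\<psi> T (snd p), s')}"
    have "(\<Sum>T\<in>?T. \<Sum>p\<in>P. \<Sum>s\<in>Pow ?T. \<Sum>s'\<in>Pow ?T. b T p s s') = (\<Sum>z\<in>?A. of_bool (?e z \<in> Bad))"
      by (simp add: sum.cartesian_product case_prod_unfold b_def)
    also have "\<dots> = card {z \<in> ?A. ?e z \<in> Bad}" using finT finP by (simp add: Int_def)
    also have "card {z \<in> ?A. ?e z \<in> Bad} \<le> card Bad"
    proof (rule card_inj_on_le[where f="?e"])
      show "inj_on ?e {z \<in> ?A. ?e z \<in> Bad}"
      proof (rule inj_onI)
        fix z z' assume z: "z \<in> {z \<in> ?A. ?e z \<in> Bad}" "z' \<in> {z \<in> ?A. ?e z \<in> Bad}" and eq: "?e z = ?e z'"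
        obtain T i j s r where z1: "z = (T, (i, j), s, r)" by (metis prod.collapse)
        obtain T' i' j' s' r' where z2: "z' = (T', (i', j'), s', r')" by (metis prod.collapse)
        have P12: "(i, j) \<in> P" "(i', j') \<in> P" "T \<in> ?T" "T' \<in> ?T" using z by (auto simp: z1 z2)
        have "{(i, ?\<psi> T i, s), (j, ?\<psi> T j, r)} = {(i', ?\<psi> T' i', s'), (j', ?\<psi> T' j', r')}"
          using eq by (simp add: z1 z2)
        then consider "(i, ?\<psi> T i, s) = (i', ?\<psi> T' i', s')" "(j, ?\<psi> T j, r) = (j', ?\<psi> T' j', r')"
          | "(i, j) = (j', i')" by (auto simp: doubleton_eq_iff)
        then show "z = z'"
        proof cases
          case 1
          have e: "{?\<psi> T i, ?\<psi> T j} \<in> edges T" "{?\<psi> T i, ?\<psi> T j} \<in> edges G"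
            using chosen_hom_edge[OF P12(3) PE(1)[OF P12(1)]] by blast+
          have "{?\<psi> T' i', ?\<psi> T' j'} \<in> edges T'" using chosen_hom_edge(1)[OF P12(4) PE(1)[OF P12(2)]] .
          then have "T = T'" using uniq e P12 1 unfolding unique_copies_def by auto
          then show ?thesis using 1 by (simp add: z1 z2)
        next
          case 2
          then show ?thesis using P12 Panti by auto
        qed
      qed
      show "?e ` {z \<in> ?A. ?e z \<in> Bad} \<subseteq> Bad" by auto
    qed (rule Bad)
    finally show ?thesis by simp
  qed
  have "?Q * (?Q * (\<Sum>x\<in>?X. L x)) \<le> ?Q * (?Q * (\<Sum>x\<in>?X. \<Sum>T\<in>?T. \<Sum>p\<in>P. b T p (x (fst p)) (x (snd p))))"
    by (intro mult_left_mono sum_mono Lb) auto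
  also have "\<dots> = (\<Sum>T\<in>?T. \<Sum>p\<in>P. ?Q * (?Q * (\<Sum>x\<in>?X. b T p (x (fst p)) (x (snd p)))))"
  proof -
    have "(\<Sum>x\<in>?X. \<Sum>T\<in>?T. \<Sum>p\<in>P. b T p (x (fst p)) (x (snd p))) = (\<Sum>T\<in>?T. \<Sum>p\<in>P. \<Sum>x\<in>?X. b T p (x (fst p)) (x (snd p)))"
      by (subst sum.swap, intro sum.cong refl, subst sum.swap) (rule refl)
    then show ?thesis by (simp add: sum_distrib_left)
  qed
  also have "\<dots> = (\<Sum>T\<in>?T. \<Sum>p\<in>P. card ?X * (\<Sum>s\<in>Pow ?T. \<Sum>s'\<in>Pow ?T. b T p s s'))"
    by (intro sum.cong refl res)
  also have "\<dots> = card ?X * (\<Sum>T\<in>?T. \<Sum>p\<in>P. \<Sum>s\<in>Pow ?T. \<Sum>s'\<in>Pow ?T. b T p s s')"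
    by (simp add: sum_distrib_left)
  also have "\<dots> \<le> real (card ?X) * real (card Bad)" using inj by (intro mult_left_mono) auto
  finally have avg: "?Q * (?Q * (\<Sum>x\<in>?X. L x)) \<le> real (card ?X) * real (card Bad)" .
  have slice: "(\<Sum>x\<in>?X. \<Sum>s\<in>Pow ?T. L (x(i0 := s))) = ?Q * (\<Sum>x\<in>?X. L x)"
    using sum_PiE_resample[OF finK i0, where V="\<lambda>_. Pow ?T" and f=L] by (simp add: cQ)
  have "\<exists>x\<in>?X. (\<Sum>s\<in>Pow ?T. L (x(i0 := s))) \<le> card Bad / ?Q"
  proof (rule ccontr)
    assume "\<not> ?thesis"
    then have "(\<Sum>x\<in>?X. card Bad / ?Q) < (\<Sum>x\<in>?X. \<Sum>s\<in>Pow ?T. L (x(i0 := s)))"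
      using finX neX by (intro sum_strict_mono) (auto simp: not_le)
    then have "card ?X * (card Bad / ?Q) < ?Q * (\<Sum>x\<in>?X. L x)" by (simp add: slice)
    then have "?Q * (card ?X * (card Bad / ?Q)) < ?Q * (?Q * (\<Sum>x\<in>?X. L x))"
      by (rule mult_strict_left_mono) simp
    moreover have "?Q * (card ?X * (card Bad / ?Q)) = real (card ?X) * real (card Bad)" by simp
    ultimately show False using avg by linarith
  qed
  then show ?thesis by (simp add: L_def lost_def pos_def)
qed

lemma approx_hom_any_type:
  fixes G :: "'b graph" and H :: "'a graph"
  assumes M: "\<And>G :: nat graph. simple_graph G \<Longrightarrow> hom_free H G \<Longrightarrow>
      \<exists>(F :: nat graph) \<phi>. simple_graph F \<and> hom_free H F \<and> card (verts F) \<le> M \<and> approx_hom \<epsilon> \<phi> G F"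
    and G: "simple_graph G" "hom_free H G"
  shows "\<exists>(F :: nat graph) \<phi>. simple_graph F \<and> hom_free H F \<and> card (verts F) \<le> M \<and> approx_hom \<epsilon> \<phi> G F"
proof -
  obtain G' :: "nat graph" and f where G': "simple_graph G'" "bij_betw f (verts G) (verts G')"
    "edges G' = (\<lambda>e. f ` e) ` edges G" by (rule copy_on_nat[OF G(1)])
  let ?g = "inv_into (verts G) f"
  have gfe: "?g ` f ` e = e" if "e \<in> edges G" for e
    using G'(2) simple_edge_sub[OF G(1) that] by (simp add: bij_betw_def inv_into_image_cancel)
  have "is_hom ?g G' G"
    unfolding is_hom_def using G' gfe by (auto simp: bij_betw_def inv_into_into)
  then have "hom_free H G'" using G(2) is_hom_comp unfolding hom_free_def by blast
  from M[OF G'(1) this] obtain F :: "nat graph" and \<phi> where F: "simple_graph F" "hom_free H F" "card (verts F) \<le> M"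
    and \<phi>: "approx_hom \<epsilon> \<phi> G' F" by blast
  have "approx_hom \<epsilon> (\<phi> \<circ> f) G F"
    unfolding approx_hom_def
  proof
    show "(\<phi> \<circ> f) ` verts G \<subseteq> verts F" using \<phi> G'(2) by (auto simp: approx_hom_def bij_betw_def)
    have "card {e \<in> edges G. (\<phi> \<circ> f) ` e \<notin> edges F} \<le> card {e \<in> edges G'. \<phi> ` e \<notin> edges F}"
    proof (rule card_inj_on_le[where f="\<lambda>e. f ` e"])
      show "inj_on (\<lambda>e. f ` e) {e \<in> edges G. (\<phi> \<circ> f) ` e \<notin> edges F}"
        by (rule inj_on_inverseI[where g="\<lambda>e. ?g ` e"]) (use gfe in auto)
      show "(\<lambda>e. f ` e) ` {e \<in> edges G. (\<phi> \<circ> f) ` e \<notin> edges F} \<subseteq> {e \<in> edges G'. \<phi> ` e \<notin> edges F}"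
        using G'(3) by (auto simp: image_comp)
      show "finite {e \<in> edges G'. \<phi> ` e \<notin> edges F}" using finite_edges[OF G'(1)] by simp
    qed
    moreover have "card (verts G) = card (verts G')" by (rule bij_betw_same_card[OF G'(2)])
    ultimately show "real (card {e \<in> edges G. (\<phi> \<circ> f) ` e \<notin> edges F}) \<le> \<epsilon> * (real (card (verts G)))\<^sup>2"
      using \<phi> unfolding approx_hom_def by simp
  qed
  then show ?thesis using F by blast
qed

text \<open>On the slice from \<open>exists_good_slice\<close> only a small proportion of the pairs of a copy
  \<open>T\<close> and a clone \<open>s\<close> is lost, so some vertex \<open>w\<close> of \<open>G\<close>
  that plays the role \<open>i0\<close> in many copies loses few of them. If its clones \<open>s\<close> and
  \<open>s'\<close> had the same image and disagreed on a copy \<open>T\<close> that neither of them lost, the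
  edge towards \<open>j0\<close> could be taken from the one and all other edges from the other, which gives a
  homomorphism to \<open>F\<close>.\<close>

lemma lower_bound:
  fixes H :: "'a graph" and G :: "'v graph" and \<epsilon> C :: real
  assumes H: "simple_graph H" "\<not> bipartite H"
    and M: "\<And>G :: nat graph. simple_graph G \<Longrightarrow> hom_free H G \<Longrightarrow>
      \<exists>(F :: nat graph) \<phi>. simple_graph F \<and> hom_free H F \<and> card (verts F) \<le> M \<and> approx_hom \<epsilon> \<phi> G F"
    and G: "simple_graph G" "unique_copies (core H) G"
    and many: "C * \<epsilon> * real (card (verts G)) ^ 2 < card (edges G)"
    and \<epsilon>: "\<epsilon> > 0" and C: "80 * real (card (verts (core H))) ^ 2 * card (edges (core H)) \<le> C"
  shows "exp (C * \<epsilon> * card (verts G) / (10 * real (card (edges (core H))))) \<le> M"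
proof -
  let ?K = "core H"
  let ?T = "hom_copies ?K G" and ?\<psi> = "chosen_hom ?K G"
  let ?V = "verts G"
  define n where "n = real (card ?V)"
  define e where "e = real (card (edges ?K))"
  define k where "k = real (card (verts ?K))"
  define m where "m = real (card ?T)"
  define Q where "Q = (2 ^ card ?T :: real)"
  have K: "simple_graph ?K" by (rule core_subgraph[OF H(1)])
  note Kf = core_nonbipartite[OF H]
  have V: "finite ?V" using G by (simp add: simple_graph_def)
  have finT: "finite ?T" by (simp add: hom_copies_eq[OF K] finite_hom_set[OF K G(1)])
  have e0: "e > 0" using Kf(2) finite_edges[OF K] by (simp add: e_def card_gt_0_iff)
  have k0: "k > 0" using Kf(3) by (simp add: k_def)
  have Q0: "Q > 0" by (simp add: Q_def)
  have C0: "C > 0"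
  proof -
    have "0 < 80 * k\<^sup>2 * e" using k0 e0 by simp
    then show ?thesis using C unfolding k_def e_def by linarith
  qed
  have n0: "n > 0"
  proof (rule ccontr)
    assume "\<not> n > 0"
    then have "?V = {}" using V by (simp add: n_def)
    then have "edges G = {}" using G(1) by (auto simp: simple_graph_def)
    then have "real (card (edges G)) = 0" by simp
    moreover have "0 \<le> C * \<epsilon> * real (card ?V) ^ 2" using C0 \<epsilon> by simp
    ultimately show False using many by linarith
  qed
  have em: "card (edges G) \<le> m * e"
  proof -
    have "edges G \<subseteq> (\<Union>T\<in>?T. edges T)" using G(2) by (fastforce simp: unique_copies_def)
    moreover have finE: "finite (edges T)" "card (edges T) \<le> card (edges ?K)" if "T \<in> ?T" for T
      using chosen_hom(2)[OF that] finite_edges[OF K] by (metis (no_types, lifting) card_image_le finite_imageI graph.select_convs(2) hom_image_def)+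
    ultimately have "card (edges G) \<le> card (\<Union>T\<in>?T. edges T)" using finT by (intro card_mono) auto
    also have "\<dots> \<le> (\<Sum>T\<in>?T. card (edges T))" by (rule card_UN_le[OF finT])
    also have "\<dots> \<le> (\<Sum>T\<in>?T. card (edges ?K))" by (intro sum_mono finE)
    finally have "card (edges G) \<le> card ?T * card (edges ?K)" by simp
    then show ?thesis unfolding m_def e_def by (metis of_nat_le_iff of_nat_mult)
  qed
  have me: "C * \<epsilon> * n\<^sup>2 < m * e" using em many by (simp add: n_def)
  have m0: "m > 0"
  proof -
    have "0 < C * \<epsilon> * n\<^sup>2" using C0 \<epsilon> n0 by simp
    then have "0 < m * e" using me by linarith
    then show ?thesis using e0 by (simp add: zero_less_mult_iff)
  qed
  obtain L and v :: "nat \<Rightarrow> 'a" where v: "L \<ge> 2" "inj_on v {..L}" "\<And>t. t < L \<Longrightarrow> {v t, v (Suc t)} \<in> edges ?K"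
    using exists_cycle[OF K Kf(1)] by metis
  define i0 j0 j1 where "i0 = v 1" and "j0 = v 0" and "j1 = v 2"
  have ij: "{i0, j0} \<in> edges ?K" "{i0, j1} \<in> edges ?K" "j0 \<noteq> j1"
    using v(1) v(3)[of 0] v(3)[of 1] inj_on_eq_iff[OF v(2), of 0 2]
    by (auto simp: i0_def j0_def j1_def insert_commute numeral_2_eq_2)
  have i0: "i0 \<in> verts ?K" using simple_edge_verts[OF K ij(1)] by simp
  define B where "B = switch_blowup ?K G i0 j0 j1"
  have Bs: "simple_graph B" unfolding B_def by (rule switch_blowup_simple[OF K G(1)])
  have "hom_free H B" using switch_blowup_hom_free[OF H(1) G(2) ij(1,2)] hom_free_core_iff[OF H(1)] by (auto simp: B_def)
  from approx_hom_any_type[OF M Bs this] obtain F :: "nat graph" and \<phi> where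
    F: "simple_graph F" "hom_free H F" "card (verts F) \<le> M" and \<phi>: "approx_hom \<epsilon> \<phi> B F" by blast
  have FK: "hom_free ?K F" using F(2) hom_free_core_iff[OF H(1)] by blast
  define Bad where "Bad = {f \<in> edges B. \<phi> ` f \<notin> edges F}"
  have finBad: "finite Bad" using finite_edges[OF Bs] by (simp add: Bad_def)
  have nB: "real (card (verts B)) = k * n * Q"
    using finT by (simp add: B_def switch_blowup_def card_cartesian_product card_Pow k_def n_def Q_def)
  have cBad: "card Bad \<le> \<epsilon> * (k * n * Q)\<^sup>2" using \<phi> by (simp add: approx_hom_def Bad_def nB)
  obtain x where x: "x \<in> verts ?K \<rightarrow>\<^sub>E Pow ?T" and
    xl: "(\<Sum>s\<in>Pow ?T. \<Sum>T\<in>?T. of_bool (\<exists>i j. {i, j} \<in> edges ?K \<and>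
        {(i, ?\<psi> T i, (x(i0 := s)) i), (j, ?\<psi> T j, (x(i0 := s)) j)} \<in> Bad)) \<le> card Bad / Q"
    using exists_good_slice[OF K G(1,2) i0 finBad] unfolding Q_def by blast
  define lost where "lost = (\<lambda>T s. \<exists>i j. {i, j} \<in> edges ?K \<and>
        {(i, ?\<psi> T i, (x(i0 := s)) i), (j, ?\<psi> T j, (x(i0 := s)) j)} \<in> Bad)"
  have tot: "(\<Sum>s\<in>Pow ?T. \<Sum>T\<in>?T. of_bool (lost T s)) \<le> m * Q / 80"
  proof -
    have "(\<Sum>s\<in>Pow ?T. \<Sum>T\<in>?T. of_bool (lost T s)) \<le> card Bad / Q" using xl by (simp add: lost_def)
    also have "\<dots> \<le> \<epsilon> * (k * n * Q)\<^sup>2 / Q" using cBad Q0 by (intro divide_right_mono) auto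
    also have "\<dots> = k\<^sup>2 * (\<epsilon> * n\<^sup>2) * Q" using Q0 by (simp add: power2_eq_square)
    also have "\<dots> \<le> k\<^sup>2 * (m * e / C) * Q"
      using me C0 Q0 by (intro mult_right_mono mult_left_mono) (auto simp: field_simps)
    also have "\<dots> = (k\<^sup>2 * e) * (m * Q / C)" by simp
    also have "\<dots> \<le> (C / 80) * (m * Q / C)"
      using C m0 Q0 C0 by (intro mult_right_mono) (auto simp: k_def e_def)
    also have "\<dots> = m * Q / 80" using C0 by simp
    finally show ?thesis .
  qed
  \<comment> \<open>The copies in which \<open>w\<close> plays the role \<open>i0\<close>; over all \<open>w\<close> they partition the copies.\<close>
  define U where "U = (\<lambda>w. {T \<in> ?T. ?\<psi> T i0 = w})"
  have UV: "(\<lambda>T. ?\<psi> T i0) ` ?T \<subseteq> ?V" using chosen_hom(1)[of _ ?K G] i0 by (fastforce simp: is_hom_def)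
  define lv where "lv = (\<lambda>w. \<Sum>s\<in>Pow ?T. real (card {T \<in> U w. lost T s}))"
  have finU: "finite (U w)" for w using finT by (simp add: U_def)
  have sumU: "(\<Sum>w\<in>?V. real (card (U w))) = m"
    using sum.group[OF finT V UV, of "\<lambda>_. 1 :: real"] by (simp add: U_def m_def)
  have suml: "(\<Sum>w\<in>?V. lv w) \<le> m * Q / 80"
  proof -
    have "(\<Sum>w\<in>?V. lv w) = (\<Sum>s\<in>Pow ?T. \<Sum>w\<in>?V. real (card {T \<in> U w. lost T s}))"
      unfolding lv_def by (rule sum.swap)
    also have "\<dots> = (\<Sum>s\<in>Pow ?T. \<Sum>w\<in>?V. \<Sum>T\<in>U w. of_bool (lost T s))"
      using finU by (simp add: Int_def)
    also have "\<dots> = (\<Sum>s\<in>Pow ?T. \<Sum>T\<in>?T. of_bool (lost T s))"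
      unfolding U_def by (intro sum.cong refl sum.group[OF finT V UV])
    finally show ?thesis using tot by simp
  qed
  have "\<exists>w\<in>?V. m / (2 * n) \<le> card (U w) \<and> lv w \<le> card (U w) / 20 * Q"
  proof (rule ccontr)
    assume no: "\<not> ?thesis"
    have "m = (\<Sum>w\<in>?V. real (card (U w)))" by (simp add: sumU)
    also have "\<dots> \<le> (\<Sum>w\<in>?V. m / (2 * n) + 20 / Q * lv w)"
    proof (rule sum_mono)
      fix w assume "w \<in> ?V"
      then have "card (U w) < m / (2 * n) \<or> card (U w) / 20 * Q < lv w" using no by force
      moreover have "0 \<le> lv w" by (simp add: lv_def sum_nonneg)
      moreover have "0 \<le> m / (2 * n)" using m0 n0 by simp
      moreover have "real (card (U w)) \<le> 20 / Q * lv w" if "card (U w) / 20 * Q < lv w"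
        using that Q0 by (simp add: field_simps)
      moreover have "0 \<le> 20 / Q * lv w" using Q0 \<open>0 \<le> lv w\<close> by simp
      ultimately show "real (card (U w)) \<le> m / (2 * n) + 20 / Q * lv w" by linarith
    qed
    also have "\<dots> = n * (m / (2 * n)) + 20 / Q * (\<Sum>w\<in>?V. lv w)"
      by (simp add: sum.distrib sum_distrib_left n_def)
    also have "\<dots> \<le> m / 2 + 20 / Q * (m * Q / 80)"
      using suml Q0 n0 by (intro add_mono mult_left_mono) auto
    also have "\<dots> = m / 2 + m / 4" using Q0 by simp
    finally show False using m0 by simp
  qed
  then obtain w where w: "w \<in> ?V" "m / (2 * n) \<le> card (U w)" "lv w \<le> card (U w) / 20 * Q" by blast
  have "exp (card (U w) / 5) \<le> card (verts F)"
  proof (rule fibres_bound[where T="?T" and f="\<lambda>s. \<phi> (i0, w, s)" and lost=lost])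
    show "finite ?T" by (rule finT)
    show "U w \<subseteq> ?T" by (auto simp: U_def)
    show "finite (verts F)" using F(1) by (simp add: simple_graph_def)
    show "(\<lambda>s. \<phi> (i0, w, s)) ` Pow ?T \<subseteq> verts F"
      using \<phi> w(1) i0 by (auto simp: approx_hom_def B_def switch_blowup_def)
    show "(\<Sum>s\<in>Pow ?T. real (card {T \<in> U w. lost T s})) \<le> card (U w) / 20 * 2 ^ card ?T"
      using w(3) by (simp add: lv_def Q_def)
    fix s s' T assume s: "s \<subseteq> ?T" "s' \<subseteq> ?T" and eq: "\<phi> (i0, w, s) = \<phi> (i0, w, s')" and T: "T \<in> U w"
      and nl: "\<not> lost T s" "\<not> lost T s'" and Ts: "T \<in> s"
    have TT: "T \<in> ?T" and Tw: "?\<psi> T i0 = w" using T by (auto simp: U_def)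
    show "T \<in> s'"
    proof (rule ccontr)
      assume Ts': "T \<notin> s'"
      define \<chi> where "\<chi> = (\<lambda>i. if i = i0 then \<phi> (i0, w, s) else \<phi> (i, ?\<psi> T i, x i))"
      have xs: "x i \<subseteq> ?T" if "i \<in> verts ?K" for i using x that by auto
      have kept: "{\<phi> (i, ?\<psi> T i, (x(i0 := r)) i), \<phi> (j, ?\<psi> T j, (x(i0 := r)) j)} \<in> edges F"
        if r: "r \<subseteq> ?T" "\<not> lost T r" and ed: "{i, j} \<in> edges ?K"
          and sw: "switch i0 j0 j1 T i j ((x(i0 := r)) i)" "switch i0 j0 j1 T j i ((x(i0 := r)) j)" for r i j
      proof -
        have vij: "i \<in> verts ?K" "j \<in> verts ?K" using simple_edge_verts[OF K ed] by auto
        have "{(i, ?\<psi> T i, (x(i0 := r)) i), (j, ?\<psi> T j, (x(i0 := r)) j)} \<in> edges B"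
          unfolding B_def by (rule switch_blowup_edgeI[OF TT ed _ _ sw]) (use r xs vij in auto)
        moreover have "{(i, ?\<psi> T i, (x(i0 := r)) i), (j, ?\<psi> T j, (x(i0 := r)) j)} \<notin> Bad"
          using r(2) ed by (auto simp: lost_def)
        ultimately show ?thesis by (simp add: Bad_def)
      qed
      have at_i0: "{\<chi> i0, \<chi> j} \<in> edges F" if ed: "{i0, j} \<in> edges ?K" for j
      proof -
        have j: "j \<noteq> i0" using simple_edge_neq[OF K ed] by simp
        \<comment> \<open>The copy \<open>T\<close> is in \<open>s\<close> but not in \<open>s'\<close>: the edge towards \<open>j0\<close> exists at the clone \<open>s'\<close>, all the others at the clone \<open>s\<close>.\<close>
        define r where "r = (if j = j0 then s' else s)"
        have "{\<phi> (i0, ?\<psi> T i0, (x(i0 := r)) i0), \<phi> (j, ?\<psi> T j, (x(i0 := r)) j)} \<in> edges F"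
          by (rule kept) (use s nl ed j ij(3) Ts Ts' in \<open>auto simp: r_def switch_def\<close>)
        moreover have "\<phi> (i0, w, r) = \<phi> (i0, w, s)" using eq by (simp add: r_def)
        ultimately show ?thesis using j Tw by (simp add: \<chi>_def)
      qed
      have "is_hom \<chi> ?K F"
      proof (rule is_homI[OF K])
        fix i assume i: "i \<in> verts ?K"
        have "(i0, w, s) \<in> verts B" using i0 w(1) s by (simp add: B_def switch_blowup_def)
        moreover have "?\<psi> T i \<in> ?V" using chosen_hom(1)[OF TT] i by (auto simp: is_hom_def)
        then have "(i, ?\<psi> T i, x i) \<in> verts B" using i xs[OF i] by (simp add: B_def switch_blowup_def)
        ultimately show "\<chi> i \<in> verts F" using \<phi> by (auto simp: approx_hom_def \<chi>_def)
      next
        fix a b assume ab: "{a, b} \<in> edges ?K"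
        consider "a = i0" | "b = i0" | "a \<noteq> i0" "b \<noteq> i0" by blast
        then show "{\<chi> a, \<chi> b} \<in> edges F"
        proof cases
          case 1
          then show ?thesis using at_i0 ab by simp
        next
          case 2
          then show ?thesis using at_i0[of a] ab by (simp add: insert_commute)
        next
          case 3
          then show ?thesis using kept[OF s(1) nl(1) ab] by (simp add: \<chi>_def switch_def)
        qed
      qed
      then show False using FK by (auto simp: hom_free_def)
    qed
  qed
  moreover have "C * \<epsilon> * card ?V / (10 * real (card (edges ?K))) \<le> card (U w) / 5"
  proof -
    have "C * \<epsilon> * n / (2 * e) \<le> m / (2 * n)" using me n0 e0 by (simp add: field_simps power2_eq_square)
    then have "C * \<epsilon> * n / (2 * e) \<le> card (U w)" using w(2) by linarith
    then show ?thesis by (simp add: n_def e_def)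
  qed
  then have "exp (C * \<epsilon> * card ?V / (10 * real (card (edges ?K)))) \<le> exp (card (U w) / 5)" by simp
  ultimately show ?thesis using F(3) by linarith
qed

section \<open>The functions delta, M and N\<close>

definition removable :: "'a graph \<Rightarrow> real \<Rightarrow> real \<Rightarrow> bool" where
  "removable H \<epsilon> \<delta> \<longleftrightarrow> (\<forall>G :: nat graph. simple_graph G \<and>
     real (card (hom_copies H G)) < \<delta> * real (card (verts G)) ^ card (verts H) \<longrightarrow>
     (\<exists>R \<subseteq> edges G. real (card R) \<le> \<epsilon> * real (card (verts G)) ^ 2 \<and> hom_free H (remove_edges G R)))"

lemma connected_no_isolated:
  assumes H: "simple_graph H" "connected_graph H" "edges H \<noteq> {}" and i: "i \<in> verts H"
  shows "\<exists>j. {i, j} \<in> edges H"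
proof -
  obtain f where "f \<in> edges H" using H(3) by blast
  then obtain a b where "a \<noteq> b" "a \<in> verts H" "b \<in> verts H" by (rule simple_edgeE[OF H(1)])
  then have "{i} \<noteq> verts H" by (metis singletonD)
  then obtain i' j where "{i', j} \<in> edges H" "i' \<in> {i}"
    using connected_exit_edge[OF H(1,2), of "{i}"] i by blast
  then show ?thesis by blast
qed

text \<open>Any admissible \<open>\<delta>\<close> is at most the homomorphism density of the graph from
  \<open>exists_hard_graph\<close> in dimension \<open>2 q\<close>, where \<open>d\<close> is as large as
  \<open>\<epsilon> d\<^sup>2 < const\<close> permits.\<close>

lemma removable_bound:
  fixes H :: "'a graph" and \<epsilon> \<delta> :: real
  assumes H: "simple_graph H" "connected_graph H" "\<not> bipartite H" and q: "q > 0"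
    and \<epsilon>: "\<epsilon> > 0" "\<epsilon> * hard_const (card (verts (core H))) (2 * q) < 1"
    and \<delta>: "removable H \<epsilon> \<delta>"
  shows "\<delta> \<le> real (card (verts H)) ^ 3 * (4 * hard_const (card (verts (core H))) (2 * q) * \<epsilon>) ^ q"
proof -
  let ?h = "card (verts H)"
  define c where "c = hard_const (card (verts (core H))) (2 * q)"
  have c0: "c > 0" using core_nonbipartite(3)[OF H(1,3)] q by (simp add: c_def hard_const_def)
  define y where "y = 1 / (\<epsilon> * c)"
  have y1: "y > 1" using \<epsilon> c0 by (simp add: y_def c_def)
  \<comment> \<open>The largest natural number strictly below \<open>sqrt y\<close>; it is positive as \<open>y > 1\<close>, so it is at least half of \<open>sqrt y\<close>.\<close>
  define d where "d = nat (\<lceil>sqrt y\<rceil> - 1)"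
  have s1: "sqrt y > 1" using y1 by simp
  have ceil: "\<lceil>sqrt y\<rceil> \<ge> 1" using s1 by linarith
  then have d_ceil: "real d = of_int \<lceil>sqrt y\<rceil> - 1" by (simp add: d_def)
  have d12: "real d < sqrt y" "sqrt y \<le> real d + 1" unfolding d_ceil by linarith+
  have "real d > 0" using d12 s1 by linarith
  then have d1: "real d < sqrt y" "sqrt y \<le> real d + 1" "d \<ge> 1" using d12 by simp_all
  have "(real d)\<^sup>2 < (sqrt y)\<^sup>2" using d1 by (intro power_strict_mono) auto
  then have dy: "(real d)\<^sup>2 < y" using y1 by simp
  have "(sqrt y)\<^sup>2 \<le> (2 * real d)\<^sup>2" using d1 y1 by (intro power_mono) auto
  then have "y \<le> 4 * (real d)\<^sup>2" using y1 by (simp add: power_mult_distrib)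
  then have dinv: "1 / (real d)\<^sup>2 \<le> 4 * c * \<epsilon>" using d1(3) \<epsilon>(1) c0 by (simp add: y_def field_simps)
  obtain G :: "nat graph" where G: "simple_graph G" "card (verts G) > 0"
    "card (hom_copies H G) * d ^ (2 * q) \<le> ?h ^ 3 * card (verts G) ^ ?h"
    "\<And>R. R \<subseteq> edges G \<Longrightarrow> card R * (c * d\<^sup>2) < (card (verts G))\<^sup>2 \<Longrightarrow> \<not> hom_free H (remove_edges G R)"
    using exists_hard_graph[OF H, of "2 * q" d] q d1(3) unfolding c_def by auto
  let ?n = "real (card (verts G))"
  have n0: "?n > 0" using G(2) by simp
  have "\<delta> * ?n ^ ?h \<le> real (card (hom_copies H G))"
  proof (rule ccontr)
    assume "\<not> ?thesis"
    then obtain R where R: "R \<subseteq> edges G" "real (card R) \<le> \<epsilon> * ?n\<^sup>2" "hom_free H (remove_edges G R)"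
      using \<delta> G(1) unfolding removable_def by (auto simp: not_le)
    have "real (card R * (c * d\<^sup>2)) = card R * (c * (real d)\<^sup>2)" by simp
    also have "\<dots> \<le> (\<epsilon> * ?n\<^sup>2) * (c * (real d)\<^sup>2)" by (intro mult_right_mono R(2)) simp
    also have "\<dots> = ?n\<^sup>2 * (\<epsilon> * c * (real d)\<^sup>2)" by simp
    also have "\<dots> < ?n\<^sup>2 * 1"
      using dy \<epsilon> c0 n0 by (intro mult_strict_left_mono) (auto simp: y_def field_simps)
    finally have "card R * (c * d\<^sup>2) < (card (verts G))\<^sup>2" by (metis mult_1_right of_nat_less_iff of_nat_power)
    then show False using G(4)[OF R(1)] R(3) by blast
  qed
  moreover have "real (card (hom_copies H G)) * d ^ (2 * q) \<le> real ?h ^ 3 * ?n ^ ?h"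
    using G(3) by (metis of_nat_le_iff of_nat_mult of_nat_power)
  ultimately have "\<delta> * ?n ^ ?h * d ^ (2 * q) \<le> real ?h ^ 3 * ?n ^ ?h"
    by (meson mult_right_mono of_nat_0_le_iff order_trans)
  then have "\<delta> * d ^ (2 * q) \<le> real ?h ^ 3" using n0 by (simp add: mult_ac)
  then have "\<delta> * ((real d)\<^sup>2) ^ q \<le> real ?h ^ 3" by (simp only: power_mult of_nat_power)
  moreover have "((real d)\<^sup>2) ^ q > 0" using d1(3) by simp
  ultimately have "\<delta> \<le> real ?h ^ 3 / ((real d)\<^sup>2) ^ q" by (simp only: pos_le_divide_eq)
  also have "\<dots> = real ?h ^ 3 * (1 / (real d)\<^sup>2) ^ q" by (simp add: power_one_over)
  also have "\<dots> \<le> real ?h ^ 3 * (4 * c * \<epsilon>) ^ q"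
    using dinv by (intro mult_left_mono power_mono) auto
  finally show ?thesis by (simp add: c_def)
qed

text \<open>The admissible values are closed under suprema, because the condition on the number of copies is a strict
  inequality. They are nonempty by the removal lemma and bounded by \<open>removable_bound\<close>, so the
  greatest one exists.\<close>

lemma delta_fun_removable:
  fixes H :: "'a graph" and \<epsilon> :: real
  assumes H: "simple_graph H" "connected_graph H" "\<not> bipartite H"
    and \<epsilon>: "\<epsilon> > 0" "\<epsilon> * hard_const (card (verts (core H))) 2 < 1"
  shows "delta_fun H \<epsilon> > 0" "removable H \<epsilon> (delta_fun H \<epsilon>)"
proof -
  define S where "S = {\<delta>. \<delta> > 0 \<and> removable H \<epsilon> \<delta>}"
  have E: "edges H \<noteq> {}" by (rule core_nonbipartite[OF H(1,3)])
  obtain \<delta>0 where "\<delta>0 > 0" "removable H \<epsilon> \<delta>0"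
    using graph_removal_lemma[OF H(1) E _ \<epsilon>(1), where ?'v = nat] connected_no_isolated[OF H(1,2) E]
    unfolding removable_def by blast
  then have ne: "S \<noteq> {}" unfolding S_def by blast
  have bdd: "bdd_above S"
  proof (rule bdd_aboveI)
    fix \<delta> assume "\<delta> \<in> S"
    then show "\<delta> \<le> real (card (verts H)) ^ 3 * (4 * hard_const (card (verts (core H))) (2 * 1) * \<epsilon>) ^ 1"
      using \<epsilon> unfolding S_def by (intro removable_bound[OF H]) simp_all
  qed
  have pos: "Sup S > 0"
    using cSup_upper[OF _ bdd, of \<delta>0] \<open>0 < \<delta>0\<close> \<open>removable H \<epsilon> \<delta>0\<close> by (simp add: S_def)
  have rem: "removable H \<epsilon> (Sup S)"
    unfolding removable_def
  proof (intro allI impI, elim conjE)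
    fix G :: "nat graph"
    let ?n = "real (card (verts G)) ^ card (verts H)"
    assume G: "simple_graph G" and few: "real (card (hom_copies H G)) < Sup S * ?n"
    have n: "?n > 0"
    proof (rule ccontr)
      assume "\<not> ?n > 0"
      moreover have "?n \<ge> 0" by simp
      ultimately have "?n = 0" by linarith
      then show False using few by (metis mult_zero_right not_less of_nat_0_le_iff)
    qed
    have "card (hom_copies H G) / ?n < Sup S" using few n by (simp add: pos_divide_less_eq)
    then obtain \<delta> where \<delta>: "\<delta> \<in> S" "card (hom_copies H G) / ?n < \<delta>" using less_cSup_iff[OF ne bdd] by blast
    then have "real (card (hom_copies H G)) < \<delta> * ?n" using n by (simp add: pos_divide_less_eq)
    then show "\<exists>R \<subseteq> edges G. real (card R) \<le> \<epsilon> * real (card (verts G)) ^ 2 \<and> hom_free H (remove_edges G R)"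
      using \<delta>(1) G unfolding S_def removable_def by blast
  qed
  have "delta_fun H \<epsilon> = Sup S"
    unfolding delta_fun_def removable_def[symmetric]
    by (rule Greatest_equality) (use pos rem cSup_upper[OF _ bdd] in \<open>auto simp: S_def\<close>)
  then show "delta_fun H \<epsilon> > 0" "removable H \<epsilon> (delta_fun H \<epsilon>)" using pos rem by simp_all
qed

definition approximable :: "'a graph \<Rightarrow> real \<Rightarrow> nat \<Rightarrow> bool" where
  "approximable H \<epsilon> M \<longleftrightarrow> (\<forall>G :: nat graph. simple_graph G \<and> hom_free H G \<longrightarrow>
     (\<exists>(F :: nat graph) \<phi>. simple_graph F \<and> hom_free H F \<and> card (verts F) \<le> M \<and> approx_hom \<epsilon> \<phi> G F))"

text \<open>The threshold for \<open>C\<close> has to ensure that \<open>\<epsilon> / C\<close> is small enough for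
  \<open>delta_fun\<close> to be meaningful for all \<open>\<epsilon> < 1\<close>, that the removal costs at
  most \<open>\<epsilon> / 4\<close>, and that \<open>C\<close> dominates the constant in the exponent.\<close>

lemma M_fun_upper:
  fixes H :: "'a graph"
  assumes H: "simple_graph H" "connected_graph H" "\<not> bipartite H"
  shows "\<exists>C0>0. \<forall>C \<ge> C0. \<forall>\<epsilon>. 0 < \<epsilon> \<and> \<epsilon> < 1 \<longrightarrow>
    approximable H \<epsilon> (M_fun H \<epsilon>) \<and> real (M_fun H \<epsilon>) \<le> exp (C * delta_fun H (\<epsilon> / C) powi (-2))"
proof -
  obtain P where P: "orientation H P" using exists_orientation[OF H(1)] by blast
  have finP: "finite P" by (rule finite_orientation[OF H(1) P])
  have E: "edges H \<noteq> {}" by (rule core_nonbipartite[OF H(1,3)])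
  have VH: "verts H \<noteq> {}" using H(2) by (simp add: connected_graph_def)
  define e where "e = card P"
  define h where "h = real (card (verts H))"
  have e0: "e > 0" using finP P E by (auto simp: e_def orientation_def card_gt_0_iff)
  have h0: "h > 0" using VH H(1) by (simp add: h_def simple_graph_def card_gt_0_iff)
  let ?k = "card (verts (core H))"
  define c1 where "c1 = real (hard_const ?k 2)"
  define c2 where "c2 = real (hard_const ?k (2 * (2 * e)))"
  have c2p: "c2 > 0" using core_nonbipartite(3)[OF H(1,3)] e0 by (simp add: c2_def hard_const_def)
  define B where "B = h ^ 3 * (4 * c2) ^ (2 * e)"
  have B0: "B > 0" using h0 c2p by (simp add: B_def)
  define A where "A = 5 * B\<^sup>2 + h * B\<^sup>2 + 2 * h * (real e)\<^sup>2 * 4 ^ (2 * e) * B"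
  have A0: "A > 0" using B0 h0 by (simp add: A_def add_pos_nonneg)
  define C0 where "C0 = 4 + c1 + c2 + A"
  have C00: "C0 > 0" using c2p A0 by (simp add: C0_def c1_def add_pos_nonneg)
  show ?thesis
  proof (intro exI[of _ C0] conjI C00 allI impI; elim conjE)
    fix C \<epsilon> :: real assume C: "C0 \<le> C" and \<epsilon>: "0 < \<epsilon>" "\<epsilon> < 1"
    have C4: "C \<ge> 4" "C > c1" "C > c2" "C \<ge> A" using C c2p A0 by (auto simp: C0_def c1_def)
    define \<epsilon>' where "\<epsilon>' = \<epsilon> / C"
    define \<delta> where "\<delta> = delta_fun H \<epsilon>'"
    have \<epsilon>'0: "\<epsilon>' > 0" "\<epsilon>' \<le> \<epsilon> / 4" "\<epsilon>' \<le> \<epsilon>" using \<epsilon> C4 by (auto simp: \<epsilon>'_def field_simps)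
    have small: "\<epsilon>' * t < 1" if "C > t" "t \<ge> 0" for t
    proof -
      have "\<epsilon> * t \<le> 1 * t" using \<epsilon> that by (intro mult_right_mono) auto
      then show ?thesis using that C4 by (simp add: \<epsilon>'_def field_simps)
    qed
    have \<delta>0: "\<delta> > 0" and rem: "removable H \<epsilon>' \<delta>"
      using delta_fun_removable[OF H \<epsilon>'0(1)] small[OF C4(2)] by (auto simp: \<delta>_def c1_def)
    have "\<delta> \<le> h ^ 3 * (4 * c2 * \<epsilon>') ^ (2 * e)"
      using removable_bound[OF H _ \<epsilon>'0(1) _ rem, of "2 * e"] small[OF C4(3)] e0 c2p by (simp add: h_def c2_def)
    also have "\<dots> = B * \<epsilon>' ^ (2 * e)" by (simp add: B_def power_mult_distrib)
    also have "\<dots> \<le> B * \<epsilon> ^ (2 * e)" using \<epsilon>'0 B0 by (intro mult_left_mono power_mono) auto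
    finally have \<delta>B: "\<delta> \<le> B * \<epsilon> ^ (2 * e)" .
    have inv: "1 / \<epsilon> ^ (2 * e) \<le> B / \<delta>" using \<delta>B \<delta>0 \<epsilon> by (simp add: field_simps)
    have "1 / \<epsilon> \<le> 1 / \<epsilon> ^ (2 * e)"
    proof -
      have "\<epsilon> ^ (2 * e) \<le> \<epsilon> ^ 1" using \<epsilon> e0 by (intro power_decreasing) auto
      then show ?thesis using \<epsilon> by (intro divide_left_mono) auto
    qed
    then have inv1: "1 / \<epsilon> \<le> B / \<delta>" using inv by linarith
    have "1 \<le> 1 / \<epsilon>" using \<epsilon> by simp
    then have B1: "1 \<le> B / \<delta>" using inv1 by linarith
    have sq: "B / \<delta> \<le> (B / \<delta>)\<^sup>2" "1 \<le> (B / \<delta>)\<^sup>2"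
      using B1 self_le_power[OF B1, of 2] one_le_power[OF B1, of 2] by auto
    define m where "m = nat \<lceil>4 / \<epsilon>\<rceil>"
    have "4 / \<epsilon> > 0" using \<epsilon> by simp
    then have "\<lceil>4 / \<epsilon>\<rceil> \<ge> 0" by linarith
    then have "real m = of_int \<lceil>4 / \<epsilon>\<rceil>" by (simp add: m_def)
    then have m: "4 / \<epsilon> \<le> m" "m \<le> 4 / \<epsilon> + 1" by linarith+
    define z where "z = 2 * (real e)\<^sup>2 / (\<delta> * (\<epsilon> / 4) ^ (2 * e))"
    have z0: "z \<ge> 0" using \<delta>0 \<epsilon> by (simp add: z_def)
    define N where "N = nat \<lfloor>z\<rfloor> + 1"
    have "real N = of_int \<lfloor>z\<rfloor> + 1" using z0 by (simp add: N_def)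
    then have N: "z < N" "N \<le> z + 1" by linarith+
    let ?M = "2 ^ (m + card (verts H) * N) :: nat"
    have app: "approximable H \<epsilon> ?M"
      unfolding approximable_def
    proof (intro allI impI, elim conjE)
      fix G :: "nat graph" assume G: "simple_graph G" "hom_free H G"
      show "\<exists>(F :: nat graph) \<phi>. simple_graph F \<and> hom_free H F \<and> card (verts F) \<le> ?M \<and> approx_hom \<epsilon> \<phi> G F"
      proof (rule approx_hom_of_removal[OF H(1) E VH P \<epsilon>(1) \<delta>0 _ _ _ G])
        show "4 \<le> real m * \<epsilon>" using m(1) \<epsilon> by (simp add: field_simps)
        have "z * (\<delta> * (\<epsilon> / 4) ^ (2 * e)) < N * (\<delta> * (\<epsilon> / 4) ^ (2 * e))"
          using N(1) \<delta>0 \<epsilon> by (intro mult_strict_right_mono) auto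
        then show "2 * real (card P) ^ 2 < real N * \<delta> * (\<epsilon> / 4) ^ (2 * card P)"
          using \<delta>0 \<epsilon> by (simp add: z_def e_def mult.assoc)
        fix G :: "nat graph"
        assume "simple_graph G" "real (card (hom_copies H G)) < \<delta> * real (card (verts G)) ^ card (verts H)"
        then obtain R where R: "R \<subseteq> edges G" "real (card R) \<le> \<epsilon>' * real (card (verts G)) ^ 2" "hom_free H (remove_edges G R)"
          using rem unfolding removable_def by blast
        moreover have "\<epsilon>' * real (card (verts G)) ^ 2 \<le> \<epsilon> / 4 * real (card (verts G)) ^ 2"
          using \<epsilon>'0 by (intro mult_right_mono) auto
        ultimately show "\<exists>R\<subseteq>edges G. real (card R) \<le> \<epsilon> / 4 * real (card (verts G)) ^ 2 \<and> hom_free H (remove_edges G R)"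
          by (meson order_trans)
      qed
    qed
    have Mdef: "M_fun H \<epsilon> = (LEAST M. approximable H \<epsilon> M)"
      by (simp only: M_fun_def approximable_def)
    have "approximable H \<epsilon> (M_fun H \<epsilon>)" unfolding Mdef using app by (rule LeastI)
    moreover have "real (M_fun H \<epsilon>) \<le> exp (C * delta_fun H (\<epsilon> / C) powi (-2))"
    proof -
      have "real (M_fun H \<epsilon>) \<le> real ?M" unfolding Mdef using app by (intro of_nat_mono Least_le)
      also have "\<dots> = 2 ^ (m + card (verts H) * N)" by simp
      also have "\<dots> \<le> exp 1 ^ (m + card (verts H) * N)"
        using exp_ge_add_one_self[of "1::real"] by (intro power_mono) auto
      also have "\<dots> = exp (m + h * N)" by (simp add: exp_of_nat_mult[symmetric] h_def)
      also have "\<dots> \<le> exp (C * (1 / \<delta>\<^sup>2))"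
      proof -
        have "m \<le> 4 / \<epsilon> + 1 / \<epsilon>" using m(2) \<open>1 \<le> 1 / \<epsilon>\<close> by linarith
        then have "m \<le> 5 * (1 / \<epsilon>)" by simp
        also have "\<dots> \<le> 5 * (B / \<delta>)\<^sup>2" using inv1 sq(1) by linarith
        finally have m': "m \<le> 5 * (B / \<delta>)\<^sup>2" .
        have "z = 2 * (real e)\<^sup>2 * 4 ^ (2 * e) / \<delta> * (1 / \<epsilon> ^ (2 * e))" by (simp add: z_def power_divide)
        also have "\<dots> \<le> 2 * (real e)\<^sup>2 * 4 ^ (2 * e) / \<delta> * (B / \<delta>)" using inv \<delta>0 by (intro mult_left_mono) auto
        finally have z': "z \<le> 2 * (real e)\<^sup>2 * 4 ^ (2 * e) / \<delta> * (B / \<delta>)" .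
        have "h * N \<le> h * ((B / \<delta>)\<^sup>2 + 2 * (real e)\<^sup>2 * 4 ^ (2 * e) / \<delta> * (B / \<delta>))"
          using N(2) z' sq(2) h0 by (intro mult_left_mono) auto
        then have "m + h * N \<le> 5 * (B / \<delta>)\<^sup>2 + h * ((B / \<delta>)\<^sup>2 + 2 * (real e)\<^sup>2 * 4 ^ (2 * e) / \<delta> * (B / \<delta>))"
          using m' by linarith
        also have "\<dots> = A * (1 / \<delta>\<^sup>2)"
          using \<delta>0 by (simp add: A_def power_divide field_simps power2_eq_square)
        also have "\<dots> \<le> C * (1 / \<delta>\<^sup>2)" using C4(4) by (intro mult_right_mono) auto
        finally show ?thesis by simp
      qed
      also have "\<dots> = exp (C * delta_fun H (\<epsilon> / C) powi (-2))"
        by (simp add: \<delta>_def \<epsilon>'_def power_int_minus inverse_eq_divide)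
      finally show ?thesis .
    qed
    ultimately show "approximable H \<epsilon> (M_fun H \<epsilon>)" "real (M_fun H \<epsilon>) \<le> exp (C * delta_fun H (\<epsilon> / C) powi (-2))"
      by blast+
  qed
qed

definition sparse_above :: "'a graph \<Rightarrow> real \<Rightarrow> nat \<Rightarrow> bool" where
  "sparse_above H \<epsilon> N \<longleftrightarrow> (\<forall>G :: nat graph. simple_graph G \<and> card (verts G) \<ge> N \<and> unique_copies (core H) G \<longrightarrow>
       real (card (edges G)) \<le> \<epsilon> * real (card (verts G)) ^ 2)"

text \<open>The lower bound on \<open>M\<close> limits the size of the graphs that violate the defining property of
  \<open>N\<close>, so the least \<open>N\<close> exists and, unless it is \<open>0\<close>, there is a
  violating graph with exactly \<open>N - 1\<close> vertices.\<close>

lemma N_fun_le_M: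
  fixes H :: "'a graph" and \<epsilon> C :: real
  assumes H: "simple_graph H" "\<not> bipartite H" and M: "approximable H \<epsilon> M" and \<epsilon>: "\<epsilon> > 0"
    and C: "80 * real (card (verts (core H))) ^ 2 * card (edges (core H)) \<le> C" "20 * real (card (edges (core H))) \<le> C"
  shows "exp (\<epsilon> * real (N_fun H (C * \<epsilon>)) / C) \<le> M"
proof -
  define e where "e = real (card (edges (core H)))"
  have K: "simple_graph (core H)" by (rule core_subgraph[OF H(1)])
  have e1: "e \<ge> 1" using core_nonbipartite(2)[OF H] finite_edges[OF K] by (simp add: e_def Suc_le_eq card_gt_0_iff)
  have C1: "C \<ge> 20 * e" "C > 0" using C(2) e1 by (auto simp: e_def)
  have lb: "exp (C * \<epsilon> * card (verts G) / (10 * e)) \<le> M"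
    if "simple_graph G" "unique_copies (core H) G" "C * \<epsilon> * real (card (verts G)) ^ 2 < card (edges G)" for G :: "nat graph"
    unfolding e_def by (rule lower_bound[OF H _ that \<epsilon> C(1)]) (use M in \<open>auto simp: approximable_def\<close>)
  have M1: "1 \<le> real M"
  proof -
    let ?G = "\<lparr>verts = {0 :: nat}, edges = {}\<rparr>"
    have "simple_graph ?G" by (simp add: simple_graph_def)
    moreover have "hom_free H ?G" using core_nonbipartite(4)[OF H] by (auto simp: hom_free_def is_hom_def)
    ultimately obtain F :: "nat graph" and \<phi> where F: "simple_graph F" "card (verts F) \<le> M" "approx_hom \<epsilon> \<phi> ?G F"
      using M unfolding approximable_def by blast
    have "verts F \<noteq> {}" using F(3) by (auto simp: approx_hom_def)
    then have "card (verts F) > 0" using F(1) by (simp add: simple_graph_def card_gt_0_iff)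
    then show ?thesis using F(2) by simp
  qed
  have Ndef: "N_fun H (C * \<epsilon>) = (LEAST N. sparse_above H (C * \<epsilon>) N)"
    by (simp only: N_fun_def sparse_above_def unique_copies_def)
  have ex: "\<exists>N. sparse_above H (C * \<epsilon>) N"
  proof
    let ?x = "real M * (10 * e) / (C * \<epsilon>)"
    show "sparse_above H (C * \<epsilon>) (Suc (nat \<lceil>?x\<rceil>))"
      unfolding sparse_above_def
    proof (intro allI impI, elim conjE, rule ccontr)
      fix G :: "nat graph" assume G: "simple_graph G" "Suc (nat \<lceil>?x\<rceil>) \<le> card (verts G)" "unique_copies (core H) G"
        and "\<not> real (card (edges G)) \<le> C * \<epsilon> * real (card (verts G)) ^ 2"
      then have "exp (C * \<epsilon> * card (verts G) / (10 * e)) \<le> M" by (intro lb) auto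
      then have "C * \<epsilon> * card (verts G) / (10 * e) \<le> M"
        using exp_ge_add_one_self[of "C * \<epsilon> * card (verts G) / (10 * e)"] by linarith
      then have "card (verts G) \<le> ?x" using C1 \<epsilon> e1 by (simp add: field_simps)
      then show False using G(2) by linarith
    qed
  qed
  define N where "N = N_fun H (C * \<epsilon>)"
  have N: "sparse_above H (C * \<epsilon>) N" unfolding N_def Ndef by (rule LeastI_ex[OF ex])
  show ?thesis
  proof (cases N)
    case 0
    then show ?thesis using M1 by (simp add: N_def[symmetric])
  next
    case (Suc n)
    have "\<not> sparse_above H (C * \<epsilon>) n" using not_less_Least[of n "sparse_above H (C * \<epsilon>)"] Suc unfolding N_def Ndef by simp
    then obtain G :: "nat graph" where G: "simple_graph G" "n \<le> card (verts G)" "unique_copies (core H) G"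
      "C * \<epsilon> * real (card (verts G)) ^ 2 < card (edges G)" unfolding sparse_above_def by (auto simp: not_le)
    have "\<not> N \<le> card (verts G)" using N G unfolding sparse_above_def by force
    then have n: "card (verts G) = n" using G(2) Suc by simp
    have "n > 0"
    proof (rule ccontr)
      assume "\<not> n > 0"
      then have "verts G = {}" using n G(1) by (simp add: simple_graph_def)
      then have "edges G = {}" using G(1) by (auto simp: simple_graph_def)
      then have "real (card (edges G)) = 0" by simp
      moreover have "0 \<le> C * \<epsilon> * real (card (verts G)) ^ 2" using C1 \<epsilon> by simp
      ultimately show False using G(4) by linarith
    qed
    \<comment> \<open>The graph has \<open>N - 1\<close> vertices; the loss from \<open>N\<close> to \<open>n\<close> is a factor of at most \<open>2\<close>.\<close>
    have "\<epsilon> * real N / C \<le> C * \<epsilon> * real n / (10 * e)"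
    proof -
      have "\<epsilon> * real N * (10 * e) \<le> \<epsilon> * (2 * real n) * (10 * e)"
        using Suc \<open>n > 0\<close> \<epsilon> e1 by (intro mult_right_mono mult_left_mono) auto
      also have "\<dots> = \<epsilon> * real n * (20 * e)" by simp
      also have "\<dots> \<le> \<epsilon> * real n * (C * C)"
      proof (intro mult_left_mono)
        have "C * 1 \<le> C * C" using C1 e1 by (intro mult_left_mono) auto
        then show "20 * e \<le> C * C" using C1 by linarith
      qed (use \<epsilon> in auto)
      finally show ?thesis using C1 e1 by (simp add: field_simps)
    qed
    then have "exp (\<epsilon> * real N / C) \<le> exp (C * \<epsilon> * real n / (10 * e))" by simp
    also have "\<dots> \<le> M" using lb[OF G(1,3,4)] n by simp
    finally show ?thesis by (simp add: N_def)
  qed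
qed

theorem theorem1p15:
  fixes H :: "'a graph"
  assumes "simple_graph H" and "connected_graph H" and "\<not> bipartite H"
  shows "\<exists>C::real. C > 0 \<and> (\<forall>\<epsilon>::real. 0 < \<epsilon> \<and> \<epsilon> < 1 \<longrightarrow>
           exp (\<epsilon> * real (N_fun H (C * \<epsilon>)) / C) \<le> real (M_fun H \<epsilon>) \<and>
           real (M_fun H \<epsilon>) \<le> exp (C * delta_fun H (\<epsilon> / C) powi (-2)))"
proof -
  obtain C0 where C0: "C0 > 0" and upper: "\<And>C \<epsilon>. C0 \<le> C \<Longrightarrow> 0 < \<epsilon> \<Longrightarrow> \<epsilon> < 1 \<Longrightarrow>
      approximable H \<epsilon> (M_fun H \<epsilon>) \<and> real (M_fun H \<epsilon>) \<le> exp (C * delta_fun H (\<epsilon> / C) powi (-2))"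
    using M_fun_upper[OF assms] by blast
  let ?k = "real (card (verts (core H)))" and ?e = "real (card (edges (core H)))"
  define C where "C = C0 + 80 * ?k\<^sup>2 * ?e + 20 * ?e"
  have C: "C0 \<le> C" "80 * ?k\<^sup>2 * ?e \<le> C" "20 * ?e \<le> C" "C > 0"
    using C0 by (auto simp: C_def intro!: add_pos_nonneg)
  show ?thesis
    using upper[OF C(1)] N_fun_le_M[OF assms(1,3) _ _ C(2,3)] C(4) by (intro exI[of _ C]) blast
qed

end
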